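(* Let $\Bbbk$ be an arbitrary field. Let $P=\Bbbk\langle a,b,c,d,x,y\rangle$ be the free associative algebra, augmented by sending each generator to $0$, and for $\ell\ge 0$ set $e_\ell=(1+a)(1+b)^\ell(1+c)-(1+d)(1+x)^\ell(1+y)\in P$. Let $A=P/(e_\ell\mid \ell\ge 0)$ with the induced augmentation. Then the augmented algebra $A$ is parafree of rank four, and $H_2(A)\cong \Bbbk^{\oplus\aleph_0}$ (a $\Bbbk$-vector space of countably infinite dimension). Moreover, $A$ is finitely generated but not finitely presented as an associative unital $\Bbbk$-algebra.
   Context: All algebras are associative unital $\Bbbk$-algebras and all ideals are two-sided; $(S)$ denotes the two-sided ideal generated by $S$. An augmentation of an algebra $B$ is a unital $\Bbbk$-algebra homomorphism $\varepsilon_B\colon B\to\Bbbk$; its kernel $I(B)$ is the augmentation ideal. An augmented algebra $B$ is residually nilpotent if $I(B)^\omega:=\bigcap_{n\ge1}I(B)^n=0$. A morphism $B\to C$ of augmented algebras (an algebra homomorphism commuting with the augmentations) is a para-equivalence if it induces an isomorphism $B/I(B)^n\to C/I(C)^n$ for every $n\ge1$. Free algebras $\Bbbk\langle X\rangle$ are augmented by $x\mapsto 0$ for $x\in X$. An augmented algebra $B$ is parafree of rank $m$ if it is residually nilpotent and there exists a para-equivalence $\Bbbk\langle X\rangle\to B$ for some set $X$ with $m$ elements. $H_i(B)=\operatorname{Tor}^B_i(\Bbbk,\Bbbk)$, where both copies of $\Bbbk$ are $B$-modules via the augmentation. *)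

theory Defs
  imports
    "HOL-Algebra.Module"
    "HOL-Algebra.QuotRing"
    "HOL-Algebra.Ideal_Product"
    "HOL-Algebra.Subrings"
    "HOL-Library.Poly_Mapping"
begin

section \<open>Modules over a noncommutative ring\<close>

text \<open>
  The locale \<^locale>\<open>module\<close> of the library requires a commutative ring of scalars, so left
  modules over an arbitrary ring are introduced here, on the same record type. As in the library,
  the fields \<^const>\<open>mult\<close> and \<^const>\<open>one\<close> of a record that is used only as a module carry no
  meaning.
\<close>

locale left_module = R?: ring R + M?: abelian_group M
  for R :: "('r, 'c) ring_scheme" (structure) and M :: "('r, 'm, 'z) module_scheme" (structure) +
  assumes smult_closed:
      "\<lbrakk>a \<in> carrier R; x \<in> carrier M\<rbrakk> \<Longrightarrow> a \<odot>\<^bsub>M\<^esub> x \<in> carrier M"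
    and smult_l_distr:
      "\<lbrakk>a \<in> carrier R; b \<in> carrier R; x \<in> carrier M\<rbrakk> \<Longrightarrow>
        (a \<oplus>\<^bsub>R\<^esub> b) \<odot>\<^bsub>M\<^esub> x = a \<odot>\<^bsub>M\<^esub> x \<oplus>\<^bsub>M\<^esub> b \<odot>\<^bsub>M\<^esub> x"
    and smult_r_distr:
      "\<lbrakk>a \<in> carrier R; x \<in> carrier M; y \<in> carrier M\<rbrakk> \<Longrightarrow>
        a \<odot>\<^bsub>M\<^esub> (x \<oplus>\<^bsub>M\<^esub> y) = a \<odot>\<^bsub>M\<^esub> x \<oplus>\<^bsub>M\<^esub> a \<odot>\<^bsub>M\<^esub> y"
    and smult_assoc:
      "\<lbrakk>a \<in> carrier R; b \<in> carrier R; x \<in> carrier M\<rbrakk> \<Longrightarrow>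
        (a \<otimes>\<^bsub>R\<^esub> b) \<odot>\<^bsub>M\<^esub> x = a \<odot>\<^bsub>M\<^esub> (b \<odot>\<^bsub>M\<^esub> x)"
    and smult_one:
      "x \<in> carrier M \<Longrightarrow> \<one>\<^bsub>R\<^esub> \<odot>\<^bsub>M\<^esub> x = x"

definition lmod_hom ::
  "('r, 'c) ring_scheme \<Rightarrow> ('r, 'm, 'y) module_scheme \<Rightarrow> ('r, 'n, 'z) module_scheme \<Rightarrow> ('m \<Rightarrow> 'n) set"
  where "lmod_hom R M N =
    {f \<in> carrier M \<rightarrow> carrier N.
      (\<forall>x\<in>carrier M. \<forall>y\<in>carrier M. f (x \<oplus>\<^bsub>M\<^esub> y) = f x \<oplus>\<^bsub>N\<^esub> f y) \<and>
      (\<forall>a\<in>carrier R. \<forall>x\<in>carrier M. f (a \<odot>\<^bsub>M\<^esub> x) = a \<odot>\<^bsub>N\<^esub> f x)}"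

definition lmod_isomorphic ::
  "('r, 'c) ring_scheme \<Rightarrow> ('r, 'm, 'y) module_scheme \<Rightarrow> ('r, 'n, 'z) module_scheme \<Rightarrow> bool"
  where "lmod_isomorphic R M N \<longleftrightarrow> (\<exists>f\<in>lmod_hom R M N. bij_betw f (carrier M) (carrier N))"

definition submodule_span ::
  "('r, 'c) ring_scheme \<Rightarrow> ('r, 'm, 'z) module_scheme \<Rightarrow> 'm set \<Rightarrow> 'm set"
  where "submodule_span R M X = \<Inter>{H. submodule H R M \<and> X \<subseteq> H}"

text \<open>
  The quotient by \<open>N\<close>, as \<^const>\<open>FactRing\<close> with the induced scalar multiplication. It serves both
  for an algebra modulo a two-sided ideal and for a module modulo a submodule (where the fields
  \<^const>\<open>mult\<close> and \<^const>\<open>one\<close> are irrelevant).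
\<close>

definition quot :: "('r, 'm, 'z) module_scheme \<Rightarrow> 'm set \<Rightarrow> ('r, 'm set) module"
  where "quot M N =
    \<lparr>carrier = carrier (M Quot N),
     mult = mult (M Quot N),
     one = one (M Quot N),
     zero = zero (M Quot N),
     add = add (M Quot N),
     smult = (\<lambda>c X. \<Union>x\<in>X. N +>\<^bsub>M\<^esub> (c \<odot>\<^bsub>M\<^esub> x))\<rparr>"

definition free_lmodule :: "('r, 'c) ring_scheme \<Rightarrow> 's set \<Rightarrow> ('r, 's \<Rightarrow> 'r) module"
  where "free_lmodule R S =
    \<lparr>carrier = {u. u \<in> S \<rightarrow> carrier R \<and> (\<forall>s. s \<notin> S \<longrightarrow> u s = \<zero>\<^bsub>R\<^esub>) \<and> finite {s. u s \<noteq> \<zero>\<^bsub>R\<^esub>}},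
     mult = undefined,
     one = undefined,
     zero = (\<lambda>_. \<zero>\<^bsub>R\<^esub>),
     add = (\<lambda>u v s. u s \<oplus>\<^bsub>R\<^esub> v s),
     smult = (\<lambda>a u s. a \<otimes>\<^bsub>R\<^esub> u s)\<rparr>"

text \<open>
  The value at \<open>u\<close> of the linear extension of \<open>\<phi> : S \<rightarrow> V\<close> to the free module on \<open>S\<close>.
\<close>

definition lin_ext ::
  "('r, 'c) ring_scheme \<Rightarrow> ('r, 'v, 'z) module_scheme \<Rightarrow> ('s \<Rightarrow> 'v) \<Rightarrow> ('s \<Rightarrow> 'r) \<Rightarrow> 'v"
  where "lin_ext R V \<phi> u = (\<Oplus>\<^bsub>V\<^esub>s\<in>{s. u s \<noteq> \<zero>\<^bsub>R\<^esub>}. u s \<odot>\<^bsub>V\<^esub> \<phi> s)"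

text \<open>
  Projective modules are the direct summands of free modules. Taking the basis \<open>S\<close> inside the type
  of elements of \<open>M\<close> is no restriction: if \<open>M\<close> is a direct summand of any free module, then the
  canonical surjection onto \<open>M\<close> from the free module on \<^term>\<open>carrier M\<close> splits.
\<close>

definition projective :: "('r, 'c) ring_scheme \<Rightarrow> ('r, 'm, 'z) module_scheme \<Rightarrow> bool"
  where "projective R M \<longleftrightarrow> left_module R M \<and>
    (\<exists>(S :: 'm set) i r. i \<in> lmod_hom R M (free_lmodule R S) \<and> r \<in> lmod_hom R (free_lmodule R S) M \<and>
      (\<forall>x\<in>carrier M. r (i x) = x))"

locale projective_resolution = left_module R N
  for R :: "('r, 'c) ring_scheme" and N :: "('r, 'n, 'z) module_scheme"
    and P :: "nat \<Rightarrow> ('r, 'p) module" and d :: "nat \<Rightarrow> 'p \<Rightarrow> 'p" and \<eta> :: "'p \<Rightarrow> 'n" +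
  assumes projective: "projective R (P n)"
    and differential: "d n \<in> lmod_hom R (P (Suc n)) (P n)"
    and augmentation: "\<eta> \<in> lmod_hom R (P 0) N"
    and surjective: "\<eta> ` carrier (P 0) = carrier N"
    and exact_0: "a_kernel (P 0) N \<eta> = d 0 ` carrier (P 1)"
    and exact_Suc: "a_kernel (P (Suc n)) (P n) (d n) = d (Suc n) ` carrier (P (Suc (Suc n)))"

text \<open>
  The complex \<open>C\<close> has differentials \<open>d n : C (Suc n) \<rightarrow> C n\<close>, and zero in negative degrees.
\<close>

definition cycles :: "(nat \<Rightarrow> ('r, 'm) module) \<Rightarrow> (nat \<Rightarrow> 'm \<Rightarrow> 'm) \<Rightarrow> nat \<Rightarrow> 'm set"
  where "cycles C d n =
    (case n of 0 \<Rightarrow> carrier (C 0) | Suc m \<Rightarrow> a_kernel (C (Suc m)) (C m) (d m))"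

definition homology ::
  "(nat \<Rightarrow> ('r, 'm) module) \<Rightarrow> (nat \<Rightarrow> 'm \<Rightarrow> 'm) \<Rightarrow> nat \<Rightarrow> ('r, 'm set) module"
  where "homology C d n = quot ((C n)\<lparr>carrier := cycles C d n\<rparr>) (d n ` carrier (C (Suc n)))"


section \<open>Algebras over a field\<close>

text \<open>
  The ground field is a type \<open>'k\<close> of class \<^class>\<open>field\<close>. The record below is this field as a ring
  of scalars, and also as an algebra over itself.
\<close>

definition ground :: "('k::field, 'k) module"
  where "ground = \<lparr>carrier = UNIV, mult = (*), one = 1, zero = 0, add = (+), smult = (*)\<rparr>"

locale k_algebra = module ground B + ring B
  for B :: "('k::field, 'b, 'z) module_scheme" (structure) +
  assumes smult_mult_left:
      "\<lbrakk>x \<in> carrier B; y \<in> carrier B\<rbrakk> \<Longrightarrow> (c \<odot> x) \<otimes> y = c \<odot> (x \<otimes> y)"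
    and smult_mult_right:
      "\<lbrakk>x \<in> carrier B; y \<in> carrier B\<rbrakk> \<Longrightarrow> x \<otimes> (c \<odot> y) = c \<odot> (x \<otimes> y)"

definition alg_hom ::
  "('k::field, 'b, 'y) module_scheme \<Rightarrow> ('k, 'c, 'z) module_scheme \<Rightarrow> ('b \<Rightarrow> 'c) set"
  where "alg_hom B C = ring_hom B C \<inter> lmod_hom ground B C"

definition alg_isomorphic ::
  "('k::field, 'b, 'y) module_scheme \<Rightarrow> ('k, 'c, 'z) module_scheme \<Rightarrow> bool"
  where "alg_isomorphic B C \<longleftrightarrow> (\<exists>f\<in>alg_hom B C. bij_betw f (carrier B) (carrier C))"

definition subalg :: "'b set \<Rightarrow> ('k::field, 'b, 'z) module_scheme \<Rightarrow> bool"
  where "subalg H B \<longleftrightarrow> subring H B \<and> submodule H ground B"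

definition finitely_generated :: "('k::field, 'b, 'z) module_scheme \<Rightarrow> bool"
  where "finitely_generated B \<longleftrightarrow>
    (\<exists>S. finite S \<and> S \<subseteq> carrier B \<and> \<Inter>{H. subalg H B \<and> S \<subseteq> H} = carrier B)"


subsection \<open>Free algebras\<close>

text \<open>
  Words with concatenation form the free monoid, so the finitely supported functions on words with
  the convolution product of the library form the free algebra; \<^term>\<open>Poly_Mapping.keys p\<close> is
  the set of words that occur in \<open>p\<close>.
\<close>

datatype 'x word = Word (letters: "'x list")

instantiation word :: (type) monoid_add
begin

definition "0 = Word []"

definition "v + w = Word (letters v @ letters w)"

instance
  by standard (simp_all add: zero_word_def plus_word_def)

end

definition free_algebra :: "'x set \<Rightarrow> ('k::field, 'x word \<Rightarrow>\<^sub>0 'k) module"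
  where "free_algebra X =
    \<lparr>carrier = {p. \<forall>w\<in>Poly_Mapping.keys p. set (letters w) \<subseteq> X},
     mult = (*),
     one = 1,
     zero = 0,
     add = (+),
     smult = (\<lambda>c. Poly_Mapping.map ((*) c))\<rparr>"

definition gen :: "'x \<Rightarrow> 'x word \<Rightarrow>\<^sub>0 'k::field"
  where "gen x = Poly_Mapping.single (Word [x]) 1"

text \<open>
  The augmentation that sends every generator to \<open>0\<close> is the constant coefficient.
\<close>

definition free_aug :: "('x word \<Rightarrow>\<^sub>0 'k::field) \<Rightarrow> 'k"
  where "free_aug p = Poly_Mapping.lookup p (Word [])"

text \<open>
  Finite generating sets may be taken to be sets of natural numbers.
\<close>

definition finitely_presented :: "('k::field, 'b, 'z) module_scheme \<Rightarrow> bool"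
  where "finitely_presented B \<longleftrightarrow>
    (\<exists>(X :: nat set) S. finite X \<and> finite S \<and> S \<subseteq> carrier (free_algebra X) \<and>
      alg_isomorphic (quot (free_algebra X) (Idl\<^bsub>free_algebra X\<^esub> S)) B)"


subsection \<open>Augmented algebras\<close>

locale augmented_algebra = k_algebra B
  for B :: "('k::field, 'b, 'z) module_scheme" (structure) and \<epsilon> :: "'b \<Rightarrow> 'k" +
  assumes augmentation: "\<epsilon> \<in> alg_hom B ground"

definition aug_ideal :: "('k::field, 'b, 'z) module_scheme \<Rightarrow> ('b \<Rightarrow> 'k) \<Rightarrow> 'b set"
  where "aug_ideal B \<epsilon> = a_kernel B ground \<epsilon>"

primrec ideal_power :: "('b, 'z) ring_scheme \<Rightarrow> 'b set \<Rightarrow> nat \<Rightarrow> 'b set"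
  where
    "ideal_power B I 0 = carrier B"
  | "ideal_power B I (Suc n) = ideal_prod B (ideal_power B I n) I"

text \<open>
  The augmentation of \<^term>\<open>quot B J\<close> induced by \<open>\<epsilon>\<close>; if \<open>\<epsilon>\<close> vanishes on \<open>J\<close> then it is constant on
  every coset.
\<close>

definition quot_aug :: "('b \<Rightarrow> 'k) \<Rightarrow> 'b set \<Rightarrow> 'k"
  where "quot_aug \<epsilon> X = the_elem (\<epsilon> ` X)"

definition residually_nilpotent :: "('k::field, 'b, 'z) module_scheme \<Rightarrow> ('b \<Rightarrow> 'k) \<Rightarrow> bool"
  where "residually_nilpotent B \<epsilon> \<longleftrightarrow>
    (\<Inter>n\<in>{1..}. ideal_power B (aug_ideal B \<epsilon>) n) = {\<zero>\<^bsub>B\<^esub>}"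

definition para_equivalence ::
  "('k::field, 'b, 'y) module_scheme \<Rightarrow> ('b \<Rightarrow> 'k) \<Rightarrow> ('k, 'c, 'z) module_scheme \<Rightarrow> ('c \<Rightarrow> 'k) \<Rightarrow>
    ('b \<Rightarrow> 'c) \<Rightarrow> bool"
  where "para_equivalence B \<epsilon> C \<epsilon>' f \<longleftrightarrow>
    f \<in> alg_hom B C \<and> (\<forall>x\<in>carrier B. \<epsilon>' (f x) = \<epsilon> x) \<and>
    (\<forall>n\<ge>1. let I = ideal_power B (aug_ideal B \<epsilon>) n; J = ideal_power C (aug_ideal C \<epsilon>') n in
      \<exists>\<phi>\<in>ring_iso (B Quot I) (C Quot J). \<forall>x\<in>carrier B. \<phi> (I +>\<^bsub>B\<^esub> x) = J +>\<^bsub>C\<^esub> f x)"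

definition parafree_of_rank ::
  "nat \<Rightarrow> ('k::field, 'b, 'z) module_scheme \<Rightarrow> ('b \<Rightarrow> 'k) \<Rightarrow> bool"
  where "parafree_of_rank m B \<epsilon> \<longleftrightarrow>
    augmented_algebra B \<epsilon> \<and> residually_nilpotent B \<epsilon> \<and>
    (\<exists>(X :: nat set) f. finite X \<and> card X = m \<and> para_equivalence (free_algebra X) free_aug B \<epsilon> f)"


subsection \<open>Tensor products and Tor\<close>

text \<open>
  In \<open>tensor B M N\<close> the algebra \<open>B\<close> acts on \<open>M\<close> from the right and on \<open>N\<close> from the left; the right
  action \<open>m \<cdot> b\<close> is stored as \<open>b \<odot>\<^bsub>M\<^esub> m\<close>. A scalar \<open>c\<close> acts on a \<open>B\<close>-module as \<open>c \<odot>\<^bsub>B\<^esub> \<one>\<^bsub>B\<^esub>\<close>. The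
  tensor product is the free vector space on the pairs, modulo the bilinearity and balancing
  relations.
\<close>

definition delta :: "'s \<Rightarrow> 's \<Rightarrow> 'k::field"
  where "delta s = (\<lambda>t. if t = s then 1 else 0)"

definition tensor_relations ::
  "('k::field, 'b, 'x) module_scheme \<Rightarrow> ('b, 'm, 'y) module_scheme \<Rightarrow> ('b, 'n, 'z) module_scheme \<Rightarrow>
    ('m \<times> 'n \<Rightarrow> 'k) set"
  where "tensor_relations B M N =
    {(\<lambda>t. delta (m \<oplus>\<^bsub>M\<^esub> m', n) t - delta (m, n) t - delta (m', n) t) | m m' n.
      m \<in> carrier M \<and> m' \<in> carrier M \<and> n \<in> carrier N} \<union>
    {(\<lambda>t. delta (m, n \<oplus>\<^bsub>N\<^esub> n') t - delta (m, n) t - delta (m, n') t) | m n n'.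
      m \<in> carrier M \<and> n \<in> carrier N \<and> n' \<in> carrier N} \<union>
    {(\<lambda>t. delta (b \<odot>\<^bsub>M\<^esub> m, n) t - delta (m, b \<odot>\<^bsub>N\<^esub> n) t) | b m n.
      b \<in> carrier B \<and> m \<in> carrier M \<and> n \<in> carrier N} \<union>
    {(\<lambda>t. delta ((c \<odot>\<^bsub>B\<^esub> \<one>\<^bsub>B\<^esub>) \<odot>\<^bsub>M\<^esub> m, n) t - c * delta (m, n) t) | c m n.
      m \<in> carrier M \<and> n \<in> carrier N}"

definition tensor_zero ::
  "('k::field, 'b, 'x) module_scheme \<Rightarrow> ('b, 'm, 'y) module_scheme \<Rightarrow> ('b, 'n, 'z) module_scheme \<Rightarrow>
    ('m \<times> 'n \<Rightarrow> 'k) set"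
  where "tensor_zero B M N =
    submodule_span ground (free_lmodule ground (carrier M \<times> carrier N)) (tensor_relations B M N)"

definition tensor ::
  "('k::field, 'b, 'x) module_scheme \<Rightarrow> ('b, 'm, 'y) module_scheme \<Rightarrow> ('b, 'n, 'z) module_scheme \<Rightarrow>
    ('k, ('m \<times> 'n \<Rightarrow> 'k) set) module"
  where "tensor B M N =
    quot (free_lmodule ground (carrier M \<times> carrier N)) (tensor_zero B M N)"

definition pure_tensor ::
  "('k::field, 'b, 'x) module_scheme \<Rightarrow> ('b, 'm, 'y) module_scheme \<Rightarrow> ('b, 'n, 'z) module_scheme \<Rightarrow>
    'm \<Rightarrow> 'n \<Rightarrow> ('m \<times> 'n \<Rightarrow> 'k) set"
  where "pure_tensor B M N m n =
    tensor_zero B M N +>\<^bsub>free_lmodule ground (carrier M \<times> carrier N)\<^esub> delta (m, n)"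

text \<open>
  For a homomorphism \<open>f : N \<rightarrow> N'\<close>, the map \<open>m \<otimes> n \<mapsto> m \<otimes> f n\<close> from \<open>tensor B M N\<close> to
  \<open>tensor B M N'\<close>. Its argument \<open>X\<close> is a coset of \<open>tensor_zero B M N\<close>, on which the linear extension
  of \<open>(m, n) \<mapsto> m \<otimes> f n\<close> is constant.
\<close>

definition tensor_map ::
  "('k::field, 'b, 'x) module_scheme \<Rightarrow> ('b, 'm, 'y) module_scheme \<Rightarrow> ('b, 'n, 'z) module_scheme \<Rightarrow>
    ('l \<Rightarrow> 'n) \<Rightarrow> ('m \<times> 'l \<Rightarrow> 'k) set \<Rightarrow> ('m \<times> 'n \<Rightarrow> 'k) set"
  where "tensor_map B M N' f X =
    the_elem (lin_ext ground (tensor B M N') (\<lambda>(m, n). pure_tensor B M N' m (f n)) ` X)"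

text \<open>
  \<open>Tor\<^sub>n\<^sup>B(M, N)\<close> computed from a projective resolution \<open>(P, d)\<close> of the left module \<open>N\<close>.
  Up to isomorphism it does not depend on the resolution, so an assertion about the isomorphism type
  of Tor is stated for all projective resolutions, over an arbitrary type \<open>'p\<close> of elements.
\<close>

definition tor_by ::
  "('k::field, 'b, 'x) module_scheme \<Rightarrow> ('b, 'm, 'y) module_scheme \<Rightarrow>
    (nat \<Rightarrow> ('b, 'p) module) \<Rightarrow> (nat \<Rightarrow> 'p \<Rightarrow> 'p) \<Rightarrow> nat \<Rightarrow> ('k, ('m \<times> 'p \<Rightarrow> 'k) set set) module"
  where "tor_by B M P d n =
    homology (\<lambda>i. tensor B M (P i)) (\<lambda>i. tensor_map B M (P i) (d i)) n"

text \<open>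
  The ground field as a module over an augmented algebra. As the field is commutative, the same
  record describes the left and the right module.
\<close>

definition aug_module :: "('b \<Rightarrow> 'k::field) \<Rightarrow> ('b, 'k) module"
  where "aug_module \<epsilon> =
    \<lparr>carrier = UNIV, mult = (*), one = 1, zero = 0, add = (+), smult = (\<lambda>b c. \<epsilon> b * c)\<rparr>"


section \<open>The relators\<close>

datatype letter = La | Lb | Lc | Ld | Lx | Ly

definition relator :: "nat \<Rightarrow> letter word \<Rightarrow>\<^sub>0 'k::field"
  where "relator l =
    (1 + gen La) * (1 + gen Lb) ^ l * (1 + gen Lc) - (1 + gen Ld) * (1 + gen Lx) ^ l * (1 + gen Ly)"

end

theory Submission
  imports Defs
begin

text \<open>
  Write \<open>S\<close> for \<open>1 + s\<close> when \<open>s\<close> is a generator. The relators are then the binomials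
  \<open>A B^l C - D X^l Y\<close>. Where \<open>S\<close> is invertible, as it is modulo every power of the
  augmentation ideal, the relations for \<open>l = 0\<close> and \<open>l = 1\<close> say \<open>Y = g C\<close> and
  \<open>X = g B g^-1\<close> with \<open>g = D^-1 A\<close>, and these two equations imply all the others,
  because \<open>D (g B g^-1)^l g C = D g B^l C = A B^l C\<close>. So modulo every power of the
  augmentation ideal the algebra is free on \<open>a\<close>, \<open>b\<close>, \<open>c\<close>, \<open>d\<close>, which gives the
  para-equivalence (\<open>para_equivalence_incl\<close>; the inverses are truncated geometric
  series).

  The same formulas define a homomorphism from the free algebra to the group algebra
  of a free group that kills the relators. Its kernel is exactly the relator ideal \<open>J\<close>
  (\<open>J_iff\<close>): modulo \<open>J\<close> every product of factors \<open>S\<close> can be rewritten by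
  \<open>D X^l Y -> A B^l C\<close> to one without a factor \<open>D X^l Y\<close>, and these normal words have
  distinct images in the free group (\<open>word_image_inj_on_normal\<close>), since their letters
  can be read off from the reduced images one after the other. Group algebras of free
  groups are residually nilpotent (\<open>fox_fil_Inter\<close>, by Fox derivatives), hence so is
  the algebra (\<open>J_separated\<close>).

  If the algebra were finitely presented then \<open>J\<close> would be generated as an ideal by
  finitely many elements, hence by the relators with index at most some \<open>N\<close>. But
  substituting \<open>s - 1\<close> for \<open>s\<close> turns the relators into \<open>a b^l c - d x^l y\<close>, and the
  monomial \<open>d x^(N+1) y\<close> contains none of the monomials of the relators with index at
  most \<open>N\<close>; so its coefficient separates the next relator from the ideal generated by
  the previous ones (\<open>relator_not_in_partial_J\<close>).

  The presentation yields a complex with one vertex, an edge for every generator and a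
  face for every relator, and this is a free resolution of length two of the trivial
  module (\<open>chains_resolution\<close>). It is exact at the edges because \<open>J\<close> is spanned modulo
  \<open>J I\<close> by the relators as a left module, \<open>I\<close> being the augmentation ideal
  (\<open>J_subset_relator_span\<close>). It is exact at the faces because the coefficient at the
  edge \<open>c\<close> of the boundary of the \<open>l\<close>-th face is \<open>A B^l\<close>, and appending \<open>A B^l\<close> to
  normal words gives normal words again, distinct for distinct \<open>l\<close> (\<open>boundary_1_inj\<close>).
  After tensoring with the ground field, the boundary of the \<open>l\<close>-th face becomes
  \<open>(1, l, 1, -1, -l, -1)\<close>. So the second homology consists of the finitely supported
  \<open>v\<close> with \<open>\<Sum>l. v l = 0\<close> and \<open>\<Sum>l. l v l = 0\<close>. These two equations determine
  \<open>v 0\<close> and \<open>v 1\<close> from the other values, which are arbitrary, and the second homology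
  has a countably infinite basis in every characteristic (\<open>second_homology\<close>). That the
  value of Tor does not depend on the resolution is proved in the degree in question
  by comparing resolutions up to degree three (\<open>tor_2_isomorphic\<close>).
\<close>


section \<open>Homomorphisms of free algebras\<close>

text \<open>
  Monoids are written additively, so \<open>0\<close> is the empty word or the neutral element of a
  group, and this is the constant \<open>c\<close>.
\<close>

abbreviation scal :: "'k::comm_ring_1 \<Rightarrow> ('m::monoid_add \<Rightarrow>\<^sub>0 'k)"
  where "scal c \<equiv> Poly_Mapping.single 0 c"

lemma poly_mapping_single_induct [case_names single add]:
  fixes p :: "'a \<Rightarrow>\<^sub>0 'k::comm_monoid_add"
  assumes "\<And>w c. P (Poly_Mapping.single w c)" and "\<And>p q. P p \<Longrightarrow> P q \<Longrightarrow> P (p + q)"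
  shows "P p"
proof (induction p rule: update_induct)
  case const
  show ?case using assms(1)[of undefined 0] by simp
next
  case (update f a b)
  have "Poly_Mapping.update a b f = f + Poly_Mapping.single a b"
    using update(1) by (intro poly_mapping_eqI)
      (auto simp: lookup_update lookup_add lookup_single when_def in_keys_iff)
  with update assms show ?case by simp
qed

lemma lookup_scal_mult: "Poly_Mapping.lookup (scal c * p) w = c * Poly_Mapping.lookup p w"
  unfolding mult_map_scale_conv_mult[symmetric] by (simp add: Poly_Mapping.map.rep_eq when_def)

lemma scal_mult_single: "scal c * Poly_Mapping.single w d = Poly_Mapping.single w (c * d)"
  by (simp add: mult_single)

lemma scal_commute: "scal c * p = p * scal c"
  by (induction p rule: poly_mapping_single_induct) (simp_all add: mult_single algebra_simps)

lemma scal_left_commute: "p * (scal c * q) = scal c * (p * q)"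
  by (simp only: mult.assoc[symmetric] scal_commute[of c p])

lemma scal_add: "scal (c + d) = scal c + scal d"
  by (simp add: single_add)

lemma scal_mult: "scal (c * d) = scal c * scal d"
  by (simp add: mult_single)

definition linext :: "('a \<Rightarrow> ('m \<Rightarrow>\<^sub>0 'k)) \<Rightarrow> ('a \<Rightarrow>\<^sub>0 'k) \<Rightarrow> ('m::monoid_add \<Rightarrow>\<^sub>0 'k::comm_ring_1)"
  where "linext g p = (\<Sum>w\<in>Poly_Mapping.keys p. scal (Poly_Mapping.lookup p w) * g w)"

lemma linext_superset:
  assumes "finite S" "Poly_Mapping.keys p \<subseteq> S"
  shows "linext g p = (\<Sum>w\<in>S. scal (Poly_Mapping.lookup p w) * g w)"
  unfolding linext_def using assms
  by (intro sum.mono_neutral_left) (auto simp: in_keys_iff)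

lemma linext_add: "linext g (p + q) = linext g p + linext g q"
proof -
  let ?S = "Poly_Mapping.keys p \<union> Poly_Mapping.keys q"
  have "linext g r = (\<Sum>w\<in>?S. scal (Poly_Mapping.lookup r w) * g w)" if "r \<in> {p, q, p + q}" for r
    using that keys_add[of p q] by (intro linext_superset) auto
  then show ?thesis by (simp add: lookup_add scal_add distrib_right sum.distrib)
qed

lemma linext_single [simp]: "linext g (Poly_Mapping.single w c) = scal c * g w"
  by (simp add: linext_def)

lemma linext_zero [simp]: "linext g 0 = 0"
  by (simp add: linext_def)

lemma linext_uminus: "linext g (- p) = - linext g p"
  using linext_add[of g p "- p"] by (simp add: eq_neg_iff_add_eq_0 add.commute)

lemma linext_diff: "linext g (p - q) = linext g p - linext g q"
  using linext_add[of g p "- q"] by (simp add: linext_uminus)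

lemma linext_scal: "linext g (scal c * p) = scal c * linext g p"
  by (induction p rule: poly_mapping_single_induct)
     (simp_all add: mult_single linext_add distrib_left mult.assoc[symmetric])

lemma linext_sum: "linext g (sum f S) = (\<Sum>i\<in>S. linext g (f i))"
  by (induction S rule: infinite_finite_induct) (simp_all add: linext_add)

lemma linext_id: "linext (\<lambda>w. Poly_Mapping.single w 1) p = p"
  by (induction p rule: poly_mapping_single_induct) (simp_all add: linext_add mult_single)

definition free_hom :: "('x \<Rightarrow> ('m \<Rightarrow>\<^sub>0 'k)) \<Rightarrow> ('x word \<Rightarrow>\<^sub>0 'k) \<Rightarrow> ('m::monoid_add \<Rightarrow>\<^sub>0 'k::comm_ring_1)"
  where "free_hom h = linext (\<lambda>w. prod_list (map h (letters w)))"

text \<open>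
  Algebra homomorphisms between monoid algebras that are defined on the whole type.
  They need no side conditions about carriers, so that their equations can be used for
  rewriting.
\<close>

locale alg_map =
  fixes f :: "('a::monoid_add \<Rightarrow>\<^sub>0 'k::comm_ring_1) \<Rightarrow> ('b::monoid_add \<Rightarrow>\<^sub>0 'k)"
  assumes add: "f (p + q) = f p + f q"
    and mult: "f (p * q) = f p * f q"
    and scal: "f (scal c) = scal c"
begin

lemma zero [simp]: "f 0 = 0"
  using add[of 0 0] by simp

lemma one [simp]: "f 1 = 1"
  using scal[of 1] by simp

lemma uminus: "f (- p) = - f p"
  using add[of p "- p"] by (simp add: eq_neg_iff_add_eq_0 add.commute)

lemma diff: "f (p - q) = f p - f q"
  using add[of p "- q"] by (simp add: uminus)

lemma power: "f (p ^ n) = f p ^ n"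
  by (induction n) (simp_all add: mult)

lemma sum: "f (sum g S) = (\<Sum>i\<in>S. f (g i))"
  by (induction S rule: infinite_finite_induct) (simp_all add: add)

lemmas simps = add mult scal uminus diff power sum

end

lemma alg_map_comp: "alg_map f \<Longrightarrow> alg_map g \<Longrightarrow> alg_map (\<lambda>p. g (f p))"
  by (simp add: alg_map_def)

lemma alg_map_id: "alg_map (\<lambda>p. p)"
  by (simp add: alg_map_def)

lemma alg_map_free_hom:
  fixes h :: "'x \<Rightarrow> ('m::monoid_add \<Rightarrow>\<^sub>0 'k::comm_ring_1)"
  shows "alg_map (free_hom h)"
proof
  show "free_hom h (p + q) = free_hom h p + free_hom h q" for p q
    by (simp add: free_hom_def linext_add)
  show "free_hom h (scal c) = scal c" for c
    by (simp add: free_hom_def zero_word_def mult_single)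
  have *: "free_hom h (Poly_Mapping.single v c * q) = free_hom h (Poly_Mapping.single v c) * free_hom h q"
    for v c q
  proof (induction q rule: poly_mapping_single_induct)
    case (single w d)
    have "scal (c * d) * (x * y) = scal c * x * (scal d * y)" for x y :: "'m \<Rightarrow>\<^sub>0 'k"
    proof -
      have "scal (c * d) * (x * y) = scal c * ((scal d * x) * y)"
        by (simp only: scal_mult mult.assoc)
      also have "scal d * x = x * scal d" by (rule scal_commute)
      finally show ?thesis by (simp only: mult.assoc)
    qed
    then show ?case by (simp add: free_hom_def mult_single plus_word_def)
  next
    case (add p q)
    then show ?case by (simp add: free_hom_def linext_add distrib_left)
  qed
  show "free_hom h (p * q) = free_hom h p * free_hom h q" for p q
  proof (induction p rule: poly_mapping_single_induct)
    case (add p p')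
    then show ?case by (simp add: free_hom_def linext_add distrib_right)
  qed (rule *)
qed

lemma free_hom_gen [simp]: "free_hom h (gen x) = h x"
  by (simp add: free_hom_def gen_def)

lemma single_word_Cons:
  "Poly_Mapping.single (Word (x # w)) 1 = gen x * Poly_Mapping.single (Word w) (1 :: 'k::field)"
  by (simp add: gen_def mult_single plus_word_def)

lemma single_word_Nil: "Poly_Mapping.single (Word []) 1 = (1 :: 'x word \<Rightarrow>\<^sub>0 'k::field)"
  by (simp flip: zero_word_def)

lemma single_word_append:
  "Poly_Mapping.single (Word (u @ v)) 1
     = Poly_Mapping.single (Word u) 1 * Poly_Mapping.single (Word v) (1 :: 'k::field)"
  by (simp add: mult_single plus_word_def)

lemma single_word_replicate:
  "Poly_Mapping.single (Word (replicate n x)) 1 = gen x ^ n"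
  by (induction n) (simp_all add: single_word_Nil single_word_Cons)

lemmas single_word_simps =
  single_word_Nil single_word_Cons single_word_append single_word_replicate

text \<open>
  The free algebra on \<open>X\<close> is generated by \<open>X\<close>; stated as an induction rule on
  elements, because most uses compare two homomorphisms.
\<close>

lemma free_algebra_induct [consumes 1, case_names scal gen add mult]:
  fixes p :: "'x word \<Rightarrow>\<^sub>0 'k::field"
  assumes X: "p \<in> carrier (free_algebra X)"
    and scal: "\<And>c. P (scal c)" and gen: "\<And>x. x \<in> X \<Longrightarrow> P (gen x)"
    and add: "\<And>p q. P p \<Longrightarrow> P q \<Longrightarrow> P (p + q)" and mult: "\<And>p q. P p \<Longrightarrow> P q \<Longrightarrow> P (p * q)"
  shows "P p"
proof -
  have w: "P (Poly_Mapping.single (Word w) 1)" if "set w \<subseteq> X" for w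
    using that
  proof (induction w)
    case Nil
    show ?case unfolding single_word_Nil using scal[of 1] by simp
  next
    case (Cons x w)
    then show ?case unfolding single_word_Cons by (intro mult gen) auto
  qed
  have "p = (\<Sum>w\<in>Poly_Mapping.keys p. scal (Poly_Mapping.lookup p w) * Poly_Mapping.single w 1)"
    using linext_id[of p] by (simp add: linext_def)
  moreover have "P (\<Sum>w\<in>S. scal (Poly_Mapping.lookup p w) * Poly_Mapping.single w 1)"
    if "finite S" "S \<subseteq> Poly_Mapping.keys p" for S
    using that
  proof (induction S)
    case empty
    show ?case using scal[of 0] by simp
  next
    case (insert v S)
    have "set (letters v) \<subseteq> X" using insert.prems X by (simp add: free_algebra_def)
    from w[OF this] have "P (Poly_Mapping.single v 1)" by simp
    then have "P (scal (Poly_Mapping.lookup p v) * Poly_Mapping.single v 1)" by (rule mult[OF scal])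
    moreover have "P (\<Sum>w\<in>S. scal (Poly_Mapping.lookup p w) * Poly_Mapping.single w 1)"
      using insert by blast
    ultimately show ?case unfolding sum.insert[OF insert.hyps] by (rule add)
  qed
  ultimately show ?thesis using finite_keys[of p] by (metis subset_refl)
qed

lemma carrier_free_algebra_UNIV [simp]: "carrier (free_algebra UNIV) = UNIV"
  by (simp add: free_algebra_def)


section \<open>Two-sided ideals and congruences\<close>

text \<open>
  The relator ideal is handled as a set in the type of polynomials;
  \<open>genideal_eq_ideal_gen\<close> below identifies it with the generated ideal of the record.
\<close>

definition two_sided :: "'a::ring_1 set \<Rightarrow> bool"
  where "two_sided K \<longleftrightarrow> 0 \<in> K \<and> (\<forall>x\<in>K. \<forall>y\<in>K. x + y \<in> K) \<and> (\<forall>x\<in>K. \<forall>a. a * x \<in> K \<and> x * a \<in> K)"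

lemma two_sidedD:
  assumes "two_sided K"
  shows "0 \<in> K" "x \<in> K \<Longrightarrow> y \<in> K \<Longrightarrow> x + y \<in> K" "x \<in> K \<Longrightarrow> a * x \<in> K" "x \<in> K \<Longrightarrow> x * a \<in> K"
    "x \<in> K \<Longrightarrow> - x \<in> K" "x \<in> K \<Longrightarrow> y \<in> K \<Longrightarrow> x - y \<in> K"
proof -
  show neg: "- x \<in> K" if "x \<in> K" for x
    using assms that unfolding two_sided_def by (metis mult_minus1)
  show "x \<in> K \<Longrightarrow> y \<in> K \<Longrightarrow> x - y \<in> K"
    using assms neg[of y] unfolding two_sided_def by (metis diff_conv_add_uminus)
qed (use assms in \<open>auto simp: two_sided_def\<close>)

lemma two_sided_sum: "two_sided K \<Longrightarrow> (\<And>i. i \<in> S \<Longrightarrow> f i \<in> K) \<Longrightarrow> sum f S \<in> K"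
  by (induction S rule: infinite_finite_induct) (auto simp: two_sidedD)

definition eqmod :: "'a::ring_1 set \<Rightarrow> 'a \<Rightarrow> 'a \<Rightarrow> bool"
  where "eqmod K x y \<longleftrightarrow> x - y \<in> K"

lemma eqmod_refl: "two_sided K \<Longrightarrow> eqmod K x x"
  by (simp add: eqmod_def two_sidedD)

lemma eqmod_sym: "two_sided K \<Longrightarrow> eqmod K x y \<Longrightarrow> eqmod K y x"
  unfolding eqmod_def by (metis minus_diff_eq two_sidedD(5))

lemma eqmod_trans: "two_sided K \<Longrightarrow> eqmod K x y \<Longrightarrow> eqmod K y z \<Longrightarrow> eqmod K x z"
  unfolding eqmod_def using two_sidedD(2)[of K "x - y" "y - z"] by simp

lemma eqmod_add: "two_sided K \<Longrightarrow> eqmod K x y \<Longrightarrow> eqmod K x' y' \<Longrightarrow> eqmod K (x + x') (y + y')"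
  unfolding eqmod_def using two_sidedD(2)[of K "x - y" "x' - y'"] by (simp add: algebra_simps)

lemma eqmod_mult:
  assumes "two_sided K" "eqmod K x y" "eqmod K x' y'"
  shows "eqmod K (x * x') (y * y')"
proof -
  have "x * x' - y * y' = (x - y) * x' + y * (x' - y')" by (simp add: algebra_simps)
  then show ?thesis using assms by (simp add: eqmod_def two_sidedD)
qed

lemma two_sided_vimage: "alg_map f \<Longrightarrow> two_sided K \<Longrightarrow> two_sided {p. f p \<in> K}"
  by (simp add: two_sided_def alg_map.simps alg_map.zero)

text \<open>
  Used for \<open>J + I^n\<close>, the ideal modulo which the inverse of the para-equivalence is
  checked.
\<close>

lemma two_sided_sum_set:
  assumes K: "two_sided K" and L: "two_sided L"
  shows "two_sided {x + y | x y. x \<in> K \<and> y \<in> L}" (is "two_sided ?S")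
proof -
  have mem: "x + y \<in> ?S" if "x \<in> K" "y \<in> L" for x y using that by blast
  show ?thesis unfolding two_sided_def
  proof (intro conjI ballI allI)
    show "0 \<in> ?S" using mem[OF two_sidedD(1)[OF K] two_sidedD(1)[OF L]] by simp
  next
    fix u v assume "u \<in> ?S" "v \<in> ?S"
    then obtain x y x' y' where *: "u = x + y" "v = x' + y'" "x \<in> K" "y \<in> L" "x' \<in> K" "y' \<in> L"
      by blast
    have "(x + x') + (y + y') \<in> ?S" by (intro mem two_sidedD(2)[OF K] two_sidedD(2)[OF L] *)
    then show "u + v \<in> ?S" by (simp only: * add_ac)
  next
    fix u a assume "u \<in> ?S"
    then obtain x y where *: "u = x + y" "x \<in> K" "y \<in> L" by blast
    show "a * u \<in> ?S" unfolding * distrib_left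
      by (intro mem two_sidedD(3)[OF K] two_sidedD(3)[OF L] *)
    show "u * a \<in> ?S" unfolding * distrib_right
      by (intro mem two_sidedD(4)[OF K] two_sidedD(4)[OF L] *)
  qed
qed

lemma alg_maps_eqmod:
  assumes f: "alg_map f" and g: "alg_map g" and K: "two_sided K"
    and gen: "\<And>x. x \<in> X \<Longrightarrow> eqmod K (f (gen x)) (g (gen x))"
    and p: "p \<in> carrier (free_algebra X)"
  shows "eqmod K (f p) (g p)"
  using p
proof (induction p rule: free_algebra_induct)
  case (scal c)
  then show ?case using K by (simp add: alg_map.scal[OF f] alg_map.scal[OF g] eqmod_refl)
qed (use K in \<open>simp_all add: gen alg_map.simps[OF f] alg_map.simps[OF g] eqmod_add eqmod_mult\<close>)

lemma alg_maps_eq: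
  assumes f: "alg_map f" and g: "alg_map g"
    and gen: "\<And>x. x \<in> X \<Longrightarrow> f (gen x) = g (gen x)" and p: "p \<in> carrier (free_algebra X)"
  shows "f p = g p"
  using alg_maps_eqmod[OF f g, of "{0}" X p] gen p by (simp add: eqmod_def two_sided_def)

definition ideal_gen :: "'a::ring_1 set \<Rightarrow> 'a set"
  where "ideal_gen S = \<Inter>{K. two_sided K \<and> S \<subseteq> K}"

lemma two_sided_ideal_gen: "two_sided (ideal_gen S)"
  by (auto simp: ideal_gen_def two_sided_def)

lemma ideal_gen_superset: "S \<subseteq> ideal_gen S"
  by (auto simp: ideal_gen_def)

lemma ideal_gen_minimal: "two_sided K \<Longrightarrow> S \<subseteq> K \<Longrightarrow> ideal_gen S \<subseteq> K"
  by (auto simp: ideal_gen_def)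


section \<open>The filtration of a free algebra by word length\<close>

lemma carrier_free_algebra_iff:
  "p \<in> carrier (free_algebra X) \<longleftrightarrow> (\<forall>w\<in>Poly_Mapping.keys p. set (letters w) \<subseteq> X)"
  by (simp add: free_algebra_def)

lemma free_algebra_simps [simp]:
  "mult (free_algebra X) = (*)" "one (free_algebra X) = 1" "zero (free_algebra X) = 0"
  "add (free_algebra X) = (+)" "smult (free_algebra X) c p = scal c * p"
  by (simp_all add: free_algebra_def mult_map_scale_conv_mult)

lemma free_algebra_closed:
  fixes p q :: "'x word \<Rightarrow>\<^sub>0 'k::field"
  assumes "p \<in> carrier (free_algebra X)" "q \<in> carrier (free_algebra X)"
  shows "p + q \<in> carrier (free_algebra X)" "p * q \<in> carrier (free_algebra X)"
    "- p \<in> carrier (free_algebra X)" "p - q \<in> carrier (free_algebra X)"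
    "p ^ n \<in> carrier (free_algebra X)" "scal c * p \<in> carrier (free_algebra X)"
proof -
  have 1: "p + q \<in> carrier (free_algebra X)"
    if "p \<in> carrier (free_algebra X)" "q \<in> carrier (free_algebra X)" for p q :: "'x word \<Rightarrow>\<^sub>0 'k"
    using that keys_add[of p q] by (auto simp: carrier_free_algebra_iff)
  have 2: "p * q \<in> carrier (free_algebra X)"
    if "p \<in> carrier (free_algebra X)" "q \<in> carrier (free_algebra X)" for p q :: "'x word \<Rightarrow>\<^sub>0 'k"
    using that keys_mult[of p q] by (fastforce simp: carrier_free_algebra_iff plus_word_def)
  have 3: "- p \<in> carrier (free_algebra X)" if "p \<in> carrier (free_algebra X)" for p :: "'x word \<Rightarrow>\<^sub>0 'k"
    using that by (auto simp: carrier_free_algebra_iff in_keys_iff)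
  show "p + q \<in> carrier (free_algebra X)" "p * q \<in> carrier (free_algebra X)"
    "- p \<in> carrier (free_algebra X)"
    using 1 2 3 assms by blast+
  show "p - q \<in> carrier (free_algebra X)" using 1[OF assms(1) 3[OF assms(2)]] by simp
  show "p ^ n \<in> carrier (free_algebra X)"
  proof (induction n)
    case (Suc n)
    then show ?case using 2[OF assms(1)] by simp
  qed (simp add: carrier_free_algebra_iff zero_word_def)
  show "scal c * p \<in> carrier (free_algebra X)"
    using assms(1) by (auto simp: carrier_free_algebra_iff in_keys_iff lookup_scal_mult)
qed

lemma free_algebra_scal [simp]: "scal c \<in> carrier (free_algebra X)"
  by (simp add: carrier_free_algebra_iff zero_word_def)

lemma free_algebra_one [simp]: "1 \<in> carrier (free_algebra X)"
  using free_algebra_scal[of 1] by (simp del: free_algebra_scal)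

lemma free_algebra_zero [simp]: "0 \<in> carrier (free_algebra X)"
  using free_algebra_scal[of 0] by (simp del: free_algebra_scal)

lemma free_algebra_gen [simp]: "gen x \<in> carrier (free_algebra X) \<longleftrightarrow> x \<in> X"
  by (simp add: carrier_free_algebra_iff gen_def)

lemma free_hom_carrier:
  assumes "\<And>x. x \<in> Y \<Longrightarrow> h x \<in> carrier (free_algebra X)" and "p \<in> carrier (free_algebra Y)"
  shows "free_hom h p \<in> carrier (free_algebra X)"
proof -
  interpret alg_map "free_hom h" by (rule alg_map_free_hom)
  show ?thesis using assms(2)
    by (induction p rule: free_algebra_induct) (simp_all add: simps assms(1) free_algebra_closed)
qed

lemma k_algebra_free_algebra: "k_algebra (free_algebra X)"
proof -
  have inv: "\<exists>q\<in>carrier (free_algebra X). q + p = 0 \<and> p + q = 0"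
    if "p \<in> carrier (free_algebra X)" for p :: "'a word \<Rightarrow>\<^sub>0 'b"
    using that by (intro bexI[of _ "- p"]) (auto simp: free_algebra_closed)
  have g: "cring (ground :: ('b, 'b) module)"
    by unfold_locales (auto simp: ground_def Units_def algebra_simps
      intro: exI[of _ "- x" for x :: 'b] add.right_inverse add.left_inverse)
  have a: "abelian_group (free_algebra X :: ('b, 'a word \<Rightarrow>\<^sub>0 'b) module)"
    by (rule abelian_groupI) (use inv in \<open>auto simp: algebra_simps free_algebra_closed\<close>)
  have "ring (free_algebra X :: ('b, 'a word \<Rightarrow>\<^sub>0 'b) module)"
    by (rule ringI[OF a]) (unfold_locales, auto simp: algebra_simps free_algebra_closed)
  moreover have "module ground (free_algebra X :: ('b, 'a word \<Rightarrow>\<^sub>0 'b) module)"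
    by (rule moduleI[OF g a]) (auto simp: ground_def algebra_simps free_algebra_closed scal_add scal_mult)
  moreover have "k_algebra_axioms (free_algebra X :: ('b, 'a word \<Rightarrow>\<^sub>0 'b) module)"
  proof
    show "x \<otimes>\<^bsub>free_algebra X\<^esub> (c \<odot>\<^bsub>free_algebra X\<^esub> y) = c \<odot>\<^bsub>free_algebra X\<^esub> (x \<otimes>\<^bsub>free_algebra X\<^esub> y)"
      for c and x y :: "'a word \<Rightarrow>\<^sub>0 'b"
      by (simp add: scal_commute[of c] mult.assoc)
  qed (simp add: mult.assoc)
  ultimately show ?thesis by (simp add: k_algebra_def)
qed

lemma ring_free_algebra: "ring (free_algebra X)"
  by (rule k_algebra.axioms(2)[OF k_algebra_free_algebra])

lemma cring_ground: "cring ground"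
  by (rule module.axioms(1)[OF k_algebra.axioms(1)[OF k_algebra_free_algebra]])

text \<open>
  This is the \<open>n\<close>-th power of the augmentation ideal of the free algebra
  (\<open>ideal_power_image\<close>), in a form that makes membership a statement about monomials.
\<close>

definition length_ge :: "nat \<Rightarrow> ('x word \<Rightarrow>\<^sub>0 'k::field) set"
  where "length_ge n = {p. \<forall>w\<in>Poly_Mapping.keys p. n \<le> length (letters w)}"

lemma length_ge_add: "p \<in> length_ge n \<Longrightarrow> q \<in> length_ge n \<Longrightarrow> p + q \<in> length_ge n"
  using keys_add[of p q] by (auto simp: length_ge_def)

lemma length_ge_mult: "p \<in> length_ge m \<Longrightarrow> q \<in> length_ge n \<Longrightarrow> p * q \<in> length_ge (m + n)"
  using keys_mult[of p q] by (fastforce simp: length_ge_def plus_word_def)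

lemma length_ge_0 [simp]: "length_ge 0 = UNIV"
  by (simp add: length_ge_def)

lemma length_ge_antimono: "m \<le> n \<Longrightarrow> length_ge n \<subseteq> length_ge m"
  by (auto simp: length_ge_def)

lemma two_sided_length_ge: "two_sided (length_ge n :: ('x word \<Rightarrow>\<^sub>0 'k::field) set)"
  unfolding two_sided_def
proof (intro conjI ballI allI)
  fix x a :: "'x word \<Rightarrow>\<^sub>0 'k" assume "x \<in> length_ge n"
  then show "a * x \<in> length_ge n" "x * a \<in> length_ge n"
    using length_ge_mult[of a 0 x n] length_ge_mult[of x n a 0] by simp_all
qed (simp_all add: length_ge_add, simp add: length_ge_def)

lemma gen_length_ge: "gen x \<in> length_ge 1"
  by (simp add: length_ge_def gen_def)

lemma length_ge_power: "p \<in> length_ge 1 \<Longrightarrow> p ^ n \<in> length_ge n"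
proof (induction n)
  case (Suc n)
  then show ?case using length_ge_mult[of p 1 "p ^ n" n] by simp
qed simp

lemma free_aug_simps [simp]:
  "free_aug (p + q) = free_aug p + free_aug q" "free_aug (p - q) = free_aug p - free_aug q"
  "free_aug (- p) = - free_aug p"
  "free_aug (0 :: 'x word \<Rightarrow>\<^sub>0 'k::field) = 0" "free_aug (1 :: 'x word \<Rightarrow>\<^sub>0 'k) = 1"
  "free_aug (scal c) = c" "free_aug (gen x) = 0"
  by (simp_all add: free_aug_def lookup_add lookup_minus lookup_one zero_word_def gen_def lookup_single)

lemma free_aug_mult [simp]: "free_aug (p * q) = free_aug p * free_aug q"
proof (induction p rule: poly_mapping_single_induct)
  case (single v c)
  show ?case
  proof (induction q rule: poly_mapping_single_induct)
    case (single w d)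
    show ?case by (cases v; cases w) (auto simp: free_aug_def mult_single lookup_single when_def plus_word_def)
  qed (simp add: distrib_left)
qed (simp add: distrib_right)

lemma free_aug_power [simp]: "free_aug (p ^ n) = free_aug p ^ n"
  by (induction n) simp_all

lemma free_aug_sum: "free_aug (sum f S) = (\<Sum>i\<in>S. free_aug (f i))"
  by (induction S rule: infinite_finite_induct) simp_all

lemma length_ge_1_iff: "p \<in> length_ge 1 \<longleftrightarrow> free_aug p = 0"
proof -
  have eq: "1 \<le> length (letters w) \<longleftrightarrow> w \<noteq> Word []" for w :: "'a word"
    by (cases w) (simp add: Suc_le_eq)
  show ?thesis
    unfolding length_ge_def mem_Collect_eq eq free_aug_def
    by (metis in_keys_iff)
qed

lemma free_hom_length_ge:
  assumes h: "\<And>x. free_aug (h x) = 0" and p: "p \<in> length_ge n"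
  shows "free_hom h p \<in> length_ge n"
proof -
  have w: "prod_list (map h w) \<in> length_ge (length w)" for w
  proof (induction w)
    case (Cons x w)
    have "h x \<in> length_ge 1" by (rule length_ge_1_iff[THEN iffD2, OF h])
    from length_ge_mult[OF this Cons] show ?case by simp
  qed simp
  show ?thesis unfolding free_hom_def linext_def
  proof (rule two_sided_sum[OF two_sided_length_ge], rule two_sidedD(3)[OF two_sided_length_ge])
    fix v assume "v \<in> Poly_Mapping.keys p"
    with p have "n \<le> length (letters v)" by (simp add: length_ge_def)
    with w show "prod_list (map h (letters v)) \<in> length_ge n"
      using length_ge_antimono by blast
  qed
qed


section \<open>The free group and its group algebra\<close>

text \<open>
  The pair \<open>(x, True)\<close> stands for the generator \<open>x\<close> and \<open>(x, False)\<close> for its inverse.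
  Elements of the free group are reduced words; left multiplication by a signed letter
  is \<open>cancel_cons\<close>.
\<close>

definition flip :: "'x \<times> bool \<Rightarrow> 'x \<times> bool"
  where "flip s = (fst s, \<not> snd s)"

lemma flip_flip [simp]: "flip (flip s) = s"
  by (simp add: flip_def)

lemma flip_neq [simp]: "flip s \<noteq> s" "s \<noteq> flip s"
  by (simp_all add: flip_def prod_eq_iff)

lemma flip_simp [simp]: "flip (x, b) = (x, \<not> b)"
  by (simp add: flip_def)

definition cancel_cons :: "'x \<times> bool \<Rightarrow> ('x \<times> bool) list \<Rightarrow> ('x \<times> bool) list"
  where "cancel_cons s w = (if w \<noteq> [] \<and> hd w = flip s then tl w else s # w)"

fun reduced :: "('x \<times> bool) list \<Rightarrow> bool" where
  "reduced (s # t # w) \<longleftrightarrow> t \<noteq> flip s \<and> reduced (t # w)"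
| "reduced _ \<longleftrightarrow> True"

lemma reduced_Cons: "reduced (s # w) \<longleftrightarrow> reduced w \<and> (w \<noteq> [] \<longrightarrow> hd w \<noteq> flip s)"
  by (cases w) auto

lemma cancel_cons_Nil [simp]: "cancel_cons s [] = [s]"
  by (simp add: cancel_cons_def)

lemma cancel_cons_Cons [simp]: "cancel_cons s (t # w) = (if t = flip s then w else s # t # w)"
  by (simp add: cancel_cons_def)

lemma cancel_cons_reduced: "reduced (s # w) \<Longrightarrow> cancel_cons s w = s # w"
  by (cases w) auto

lemma reduced_cancel_cons: "reduced w \<Longrightarrow> reduced (cancel_cons s w)"
  by (cases w) (auto simp: reduced_Cons)

lemma cancel_cons_flip: "reduced w \<Longrightarrow> cancel_cons (flip s) (cancel_cons s w) = w"
  by (cases w) (auto simp: reduced_Cons cancel_cons_reduced)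

lemma reduced_foldr: "reduced w \<Longrightarrow> reduced (foldr cancel_cons u w)"
  by (induction u) (simp_all add: reduced_cancel_cons)

text \<open>
  Left multiplication by \<open>flip s\<close> undoes left multiplication by \<open>s\<close>. Hence a
  cancellation inside the first factor does not change its action on a reduced word,
  and associativity follows.
\<close>

lemma foldr_cancel_cons_assoc:
  assumes w: "reduced w"
  shows "foldr cancel_cons (foldr cancel_cons u v) w = foldr cancel_cons u (foldr cancel_cons v w)"
proof (induction u)
  case (Cons s u)
  have "foldr cancel_cons (cancel_cons s x) w = cancel_cons s (foldr cancel_cons x w)" for x
  proof (cases x)
    case (Cons t x')
    then show ?thesis
      using cancel_cons_flip[OF reduced_foldr[OF w, of x'], of "flip s"] by simp
  qed simp
  with Cons show ?case by simp
qed simp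

lemma foldr_cancel_cons_Nil: "reduced w \<Longrightarrow> foldr cancel_cons w [] = w"
  by (induction w) (simp_all add: reduced_Cons cancel_cons_reduced)

typedef 'x free_group = "{w :: ('x \<times> bool) list. reduced w}" morphisms redword Abs_free_group
  by (rule exI[of _ "[]"]) simp

setup_lifting type_definition_free_group

text \<open>
  The group is written additively so that the convolution product makes the finitely
  supported functions on it the group algebra. Inverses enter through the signed
  letters.
\<close>

instantiation free_group :: (type) monoid_add
begin

lift_definition zero_free_group :: "'a free_group" is "[]" by simp

lift_definition plus_free_group :: "'a free_group \<Rightarrow> 'a free_group \<Rightarrow> 'a free_group"
  is "foldr cancel_cons" by (rule reduced_foldr)

instance
  by standard (transfer; simp add: foldr_cancel_cons_assoc foldr_cancel_cons_Nil)+

end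

lift_definition sgen :: "'x \<times> bool \<Rightarrow> 'x free_group" is "\<lambda>s. [s]" by simp

lemma redword_zero [simp]: "redword 0 = []"
  by transfer simp

lemma redword_sgen_plus: "redword (sgen s + g) = cancel_cons s (redword g)"
  by transfer simp

lemma reduced_redword [simp]: "reduced (redword g)"
  using redword by simp

lemma sgen_flip_left: "sgen (flip s) + (sgen s + g) = g" "sgen s + (sgen (flip s) + g) = g"
proof -
  show *: "sgen (flip s) + (sgen s + g) = g" for s by transfer (simp add: cancel_cons_flip)
  show "sgen s + (sgen (flip s) + g) = g" using *[of "flip s"] by simp
qed

lemma free_group_left_cancel: "sgen s + g = sgen s + h \<Longrightarrow> g = h"
  by (metis sgen_flip_left(1))

lemma free_group_induct [case_names zero plus]:
  assumes "P 0"
    and "\<And>s g. P g \<Longrightarrow> redword (sgen s + g) = s # redword g \<Longrightarrow> P (sgen s + g)"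
  shows "P g"
proof (induction "redword g" arbitrary: g)
  case Nil
  then show ?case using assms(1) by (metis redword_inject redword_zero)
next
  case (Cons s w)
  have "reduced (s # w)" unfolding Cons.hyps(2) by (rule reduced_redword)
  then have r: "reduced w" "reduced (s # w)" by (simp_all add: reduced_Cons)
  define h where "h = Abs_free_group w"
  have h: "redword h = w" using r by (simp add: h_def Abs_free_group_inverse)
  then have "sgen s + h = g"
    using Cons.hyps(2) r by (simp add: redword_sgen_plus cancel_cons_reduced flip: redword_inject)
  then show ?case using assms(2)[of h s] Cons.hyps h by simp
qed

definition gp :: "'x \<times> bool \<Rightarrow> 'x free_group \<Rightarrow>\<^sub>0 'k::field"
  where "gp s = Poly_Mapping.single (sgen s) 1"

lemma gp_mult_single: "gp s * Poly_Mapping.single g c = Poly_Mapping.single (sgen s + g) c"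
  by (simp add: gp_def mult_single)

lemma gp_flip_left: "gp (flip s) * (gp s * p) = p" "gp s * (gp (flip s) * p) = p"
  by (induction p rule: poly_mapping_single_induct)
     (simp_all add: gp_mult_single distrib_left sgen_flip_left)


section \<open>Residual nilpotence of the group algebra of a free group\<close>

definition group_aug :: "('x free_group \<Rightarrow>\<^sub>0 'k::field) \<Rightarrow> 'k"
  where "group_aug p = (\<Sum>g\<in>Poly_Mapping.keys p. Poly_Mapping.lookup p g)"

lemma group_aug_add: "group_aug (p + q) = group_aug p + group_aug q"
proof -
  let ?S = "Poly_Mapping.keys p \<union> Poly_Mapping.keys q"
  have "group_aug r = (\<Sum>g\<in>?S. Poly_Mapping.lookup r g)" if "r \<in> {p, q, p + q}" for r
    unfolding group_aug_def using that keys_add[of p q]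
    by (intro sum.mono_neutral_left) (auto simp: in_keys_iff)
  then show ?thesis by (simp add: lookup_add sum.distrib)
qed

lemma group_aug_single [simp]: "group_aug (Poly_Mapping.single g c) = c"
  by (simp add: group_aug_def)

lemma group_aug_zero [simp]: "group_aug 0 = 0"
  by (simp add: group_aug_def)

lemma group_aug_gp: "group_aug (gp s * p) = group_aug p"
  by (induction p rule: poly_mapping_single_induct) (simp_all add: gp_mult_single group_aug_add distrib_left)

lemma group_aug_scal: "group_aug (scal c * p) = c * group_aug p"
  by (induction p rule: poly_mapping_single_induct) (simp_all add: mult_single group_aug_add distrib_left)

text \<open>
  The Fox derivatives of the free group, in the version with
  \<open>p = \<epsilon> p + \<Sum>x. (x - 1) D\<^sub>x p\<close> for the augmentation \<open>\<epsilon>\<close>;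
  so \<open>D\<^sub>x (u v) = \<epsilon>(u) D\<^sub>x(v) + D\<^sub>x(u) v\<close>, with
  \<open>D\<^sub>x x = 1\<close> and \<open>D\<^sub>x x^-1 = - x^-1\<close>.
\<close>

fun fox_list :: "'x \<Rightarrow> ('x \<times> bool) list \<Rightarrow> 'x free_group \<Rightarrow>\<^sub>0 'k::field" where
  "fox_list x [] = 0"
| "fox_list x ((y, b) # w) = fox_list x w +
    (if y = x then if b then Poly_Mapping.single (Abs_free_group w) 1
      else - Poly_Mapping.single (Abs_free_group ((y, b) # w)) 1 else 0)"

definition fox :: "'x \<Rightarrow> ('x free_group \<Rightarrow>\<^sub>0 'k) \<Rightarrow> 'x free_group \<Rightarrow>\<^sub>0 'k::field"
  where "fox x = linext (\<lambda>g. fox_list x (redword g))"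

lemma fox_add: "fox x (p + q) = fox x p + fox x q"
  by (simp add: fox_def linext_add)

lemma fox_diff: "fox x (p - q) = fox x p - fox x q"
  by (simp add: fox_def linext_diff)

lemma fox_scal: "fox x (scal c * p) = scal c * fox x p"
  by (simp add: fox_def linext_scal)

lemma fox_zero [simp]: "fox x 0 = 0"
  by (simp add: fox_def)

lemma fox_single: "fox x (Poly_Mapping.single g c) = scal c * fox_list x (redword g)"
  by (simp add: fox_def)

lemma Abs_free_group_redword [simp]: "Abs_free_group (redword g) = g"
  by (rule redword_inverse)

text \<open>
  The product rule holds also when the new letter cancels: the term that it
  contributes is the negative of the one that disappears.
\<close>

lemma fox_list_sgen:
  "fox_list x (redword (sgen (y, b) + g)) =
    fox_list x (redword g) +
      (if y = x then if b then Poly_Mapping.single g 1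
        else - Poly_Mapping.single (sgen (y, b) + g) (1::'k::field) else 0)"
proof (cases "redword g \<noteq> [] \<and> hd (redword g) = flip (y, b)")
  case False
  then have "redword (sgen (y, b) + g) = (y, b) # redword g"
    unfolding redword_sgen_plus cancel_cons_def by (simp only: if_False)
  moreover have "Abs_free_group ((y, b) # redword g) = sgen (y, b) + g"
    using calculation by (metis redword_inverse)
  ultimately show ?thesis by (cases b) auto
next
  case True
  then obtain w where w: "redword g = (y, \<not> b) # w" by (cases "redword g") auto
  then have "redword (sgen (y, b) + g) = w" by (simp add: redword_sgen_plus)
  moreover from this have "Abs_free_group w = sgen (y, b) + g" by (metis redword_inverse)
  moreover have "Abs_free_group ((y, \<not> b) # w) = g" using w by (metis redword_inverse)
  ultimately show ?thesis using w by (cases b) auto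
qed

lemma fox_gp:
  "fox x (gp (y, b) * p) = fox x p + (if y = x then if b then p else - (gp (y, b) * p) else 0)"
proof (induction p rule: poly_mapping_single_induct)
  case (single g c)
  show ?case
    by (simp add: gp_mult_single fox_single fox_list_sgen distrib_left mult_single)
next
  case (add p q)
  then show ?case by (simp add: distrib_left fox_add)
qed

text \<open>
  By the expansion \<open>p = \<epsilon> p + \<Sum>x. (x - 1) D\<^sub>x p\<close> this is the
  \<open>n\<close>-th power of the augmentation ideal of the group algebra. In this form an element
  of the intersection can be differentiated without leaving the intersection.
\<close>

primrec fox_fil :: "nat \<Rightarrow> ('x free_group \<Rightarrow>\<^sub>0 'k::field) set" where
  "fox_fil 0 = UNIV"
| "fox_fil (Suc n) = {p. group_aug p = 0 \<and> (\<forall>x. fox x p \<in> fox_fil n)}"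

lemma fox_fil_add: "p \<in> fox_fil n \<Longrightarrow> q \<in> fox_fil n \<Longrightarrow> p + q \<in> fox_fil n"
  by (induction n arbitrary: p q) (simp_all add: group_aug_add fox_add)

lemma fox_fil_scal: "p \<in> fox_fil n \<Longrightarrow> scal c * p \<in> fox_fil n"
  by (induction n arbitrary: p) (simp_all add: group_aug_scal fox_scal)

lemma fox_fil_uminus: "p \<in> fox_fil n \<Longrightarrow> - p \<in> fox_fil n"
  using fox_fil_scal[of p n "- 1"] by (simp add: single_uminus)

lemma fox_fil_diff: "p \<in> fox_fil n \<Longrightarrow> q \<in> fox_fil n \<Longrightarrow> p - q \<in> fox_fil n"
  using fox_fil_add[of p n "- q"] by (simp add: fox_fil_uminus)

lemma fox_fil_zero [simp]: "0 \<in> fox_fil n"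
  by (induction n) (simp_all add: group_aug_def)

lemma fox_fil_Suc_subset: "p \<in> fox_fil (Suc n) \<Longrightarrow> p \<in> fox_fil n"
  by (induction n arbitrary: p) auto

lemma fox_fil_gp: "p \<in> fox_fil n \<Longrightarrow> gp s * p \<in> fox_fil n"
proof (induction n arbitrary: p)
  case (Suc n)
  obtain y b where s: "s = (y, b)" by (cases s)
  have p: "p \<in> fox_fil n" by (rule fox_fil_Suc_subset[OF Suc.prems])
  show ?case using Suc.prems Suc.IH[OF p] p
    by (auto simp: s group_aug_gp fox_gp intro!: fox_fil_add fox_fil_uminus fox_fil_diff)
qed simp

lemma fox_fil_gp_minus_1:
  assumes p: "p \<in> fox_fil n"
  shows "(gp s - 1) * p \<in> fox_fil (Suc n)"
proof -
  obtain y b where s: "s = (y, b)" by (cases s)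
  have "group_aug ((gp s - 1) * p) = 0"
    using group_aug_add[of "gp s * p - p" p] by (simp add: left_diff_distrib group_aug_gp)
  moreover have "fox x ((gp s - 1) * p) \<in> fox_fil n" for x
    using p fox_fil_gp[OF p, of s] by (auto simp: left_diff_distrib fox_diff fox_gp s fox_fil_uminus)
  ultimately show ?thesis by simp
qed

text \<open>
  For \<open>q = g - 1\<close> with a group element \<open>g\<close> this follows by induction from
  \<open>s g - 1 = s (g - 1) + (s - 1)\<close> for signed letters \<open>s\<close>, and such differences span
  the elements of augmentation zero.
\<close>

lemma fox_fil_mult:
  assumes p: "p \<in> fox_fil n"
  shows "q * p \<in> fox_fil n" and "group_aug q = 0 \<Longrightarrow> q * p \<in> fox_fil (Suc n)"
proof -
  have *: "Poly_Mapping.single g 1 * p \<in> fox_fil n \<and>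
    (Poly_Mapping.single g 1 - 1) * p \<in> fox_fil (Suc n)" for g
  proof (induction g rule: free_group_induct)
    case zero
    then show ?case using p by simp
  next
    case (plus s g)
    let ?g = "Poly_Mapping.single g 1 :: 'a free_group \<Rightarrow>\<^sub>0 'b"
    have e: "Poly_Mapping.single (sgen s + g) 1 = gp s * ?g"
      by (simp add: gp_mult_single)
    have d: "(gp s * ?g - 1) * p = gp s * ((?g - 1) * p) + (gp s - 1) * p"
      by (simp add: algebra_simps)
    from plus show ?case unfolding e d
      by (intro conjI fox_fil_add[OF fox_fil_gp fox_fil_gp_minus_1[OF p]])
        (auto simp: mult.assoc simp del: fox_fil.simps intro: fox_fil_gp)
  qed
  have "q * p \<in> fox_fil n \<and> (q - scal (group_aug q)) * p \<in> fox_fil (Suc n)"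
  proof (induction q rule: poly_mapping_single_induct)
    case (single g c)
    have "Poly_Mapping.single g c * p = scal c * (Poly_Mapping.single g 1 * p)"
      "(Poly_Mapping.single g c - scal c) * p = scal c * ((Poly_Mapping.single g 1 - 1) * p)"
      by (simp_all add: mult_single right_diff_distrib flip: mult.assoc)
    with *[of g] show ?case by (simp only: group_aug_single fox_fil_scal simp_thms)
  next
    case (add q q')
    have "(q + q' - scal (group_aug (q + q'))) * p =
      (q - scal (group_aug q)) * p + (q' - scal (group_aug q')) * p"
      by (simp add: group_aug_add scal_add algebra_simps)
    with add show ?case by (simp only: distrib_right fox_fil_add simp_thms)
  qed
  then show "q * p \<in> fox_fil n" and "group_aug q = 0 \<Longrightarrow> q * p \<in> fox_fil (Suc n)"
    by (simp_all del: fox_fil.simps)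
qed


text \<open>
  The intersection of the filtration is shown to be zero by descent on the length of
  the longest word that occurs, where the words are sorted by their first letter.
\<close>

definition length_le :: "nat \<Rightarrow> ('x free_group \<Rightarrow>\<^sub>0 'k::field) set"
  where "length_le n = {p. \<forall>g\<in>Poly_Mapping.keys p. length (redword g) \<le> n}"

lemma length_le_zero [simp]: "0 \<in> length_le n"
  by (simp add: length_le_def)

lemma length_le_add: "p \<in> length_le n \<Longrightarrow> q \<in> length_le n \<Longrightarrow> p + q \<in> length_le n"
  using keys_add[of p q] by (auto simp: length_le_def)

lemma length_le_uminus: "p \<in> length_le n \<Longrightarrow> - p \<in> length_le n"
  by (simp add: length_le_def in_keys_iff)

lemma length_le_diff: "p \<in> length_le n \<Longrightarrow> q \<in> length_le n \<Longrightarrow> p - q \<in> length_le n"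
  using length_le_add[of p n "- q"] by (simp add: length_le_uminus)

lemma length_le_scal: "p \<in> length_le n \<Longrightarrow> scal c * p \<in> length_le n"
  by (auto simp: length_le_def in_keys_iff lookup_scal_mult)

lemma length_le_mono: "p \<in> length_le m \<Longrightarrow> m \<le> n \<Longrightarrow> p \<in> length_le n"
  by (auto simp: length_le_def)

lemma linext_length_le:
  assumes "\<And>g. g \<in> Poly_Mapping.keys p \<Longrightarrow> f g \<in> length_le n"
  shows "linext f p \<in> length_le n"
proof -
  have "(\<Sum>g\<in>S. scal (Poly_Mapping.lookup p g) * f g) \<in> length_le n"
    if "finite S" "S \<subseteq> Poly_Mapping.keys p" for S
    using that
  proof (induction S)
    case (insert g S)
    then show ?case by (simp add: length_le_add length_le_scal assms)
  qed simp
  from this[OF finite_keys subset_refl] show ?thesis unfolding linext_def .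
qed

definition head_part :: "'x \<times> bool \<Rightarrow> ('x free_group \<Rightarrow>\<^sub>0 'k::field) \<Rightarrow> 'x free_group \<Rightarrow>\<^sub>0 'k"
  where "head_part s = linext (\<lambda>g. if redword g \<noteq> [] \<and> hd (redword g) = s then Poly_Mapping.single g 1 else 0)"

lemma head_part_add: "head_part s (p + q) = head_part s p + head_part s q"
  by (simp add: head_part_def linext_add)

lemma head_part_diff: "head_part s (p - q) = head_part s p - head_part s q"
  by (simp add: head_part_def linext_diff)

lemma lookup_head_part:
  "Poly_Mapping.lookup (head_part s p) g =
    (if redword g \<noteq> [] \<and> hd (redword g) = s then Poly_Mapping.lookup p g else 0)"
proof (induction p rule: poly_mapping_single_induct)
  case (single h c)
  show ?case by (auto simp: head_part_def mult_single lookup_single when_def)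
next
  case (add p q)
  then show ?case by (simp add: head_part_add lookup_add)
qed

lemma head_part_head_part: "head_part s (head_part t p) = (if s = t then head_part s p else 0)"
  by (rule poly_mapping_eqI) (simp add: lookup_head_part)

lemma head_part_length_le: "p \<in> length_le n \<Longrightarrow> head_part s p \<in> length_le n"
  by (auto simp: length_le_def in_keys_iff lookup_head_part split: if_splits)

lemma length_le_if_head_parts:
  assumes "\<And>s. head_part s p \<in> length_le n"
  shows "p \<in> length_le n"
  unfolding length_le_def
proof (clarify)
  fix g assume g: "g \<in> Poly_Mapping.keys p"
  show "length (redword g) \<le> n"
  proof (cases "redword g")
    case (Cons s w)
    then have "g \<in> Poly_Mapping.keys (head_part s p)" using g by (simp add: in_keys_iff lookup_head_part)
    with assms[of s] show ?thesis by (auto simp: length_le_def)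
  qed simp
qed

text \<open>
  Every word in \<open>D\<^sub>x w\<close> is a suffix of \<open>w\<close>, and only a first letter \<open>x^-1\<close>
  contributes \<open>w\<close> itself.
\<close>

lemma fox_list_keys:
  assumes "g \<in> Poly_Mapping.keys (fox_list x w :: 'x free_group \<Rightarrow>\<^sub>0 'k::field)" "reduced w"
  shows "length (redword g) \<le> length w \<and>
    (length (redword g) = length w \<longrightarrow> redword g \<noteq> [] \<and> hd (redword g) = (x, False))"
  using assms
proof (induction w)
  case (Cons s w)
  obtain y b where s: "s = (y, b)" by (cases s)
  have r: "reduced w" "reduced (s # w)" using Cons.prems by (simp_all add: reduced_Cons)
  then have R: "redword (Abs_free_group w) = w" "redword (Abs_free_group (s # w)) = s # w"
    by (simp_all add: Abs_free_group_inverse)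
  let ?d = "if y = x then if b then Poly_Mapping.single (Abs_free_group w) 1
      else - Poly_Mapping.single (Abs_free_group ((y, b) # w)) 1 else 0 :: 'x free_group \<Rightarrow>\<^sub>0 'k"
  have "g \<in> Poly_Mapping.keys (fox_list x w :: 'x free_group \<Rightarrow>\<^sub>0 'k) \<or> g \<in> Poly_Mapping.keys ?d"
    using Cons.prems(1) keys_add[of "fox_list x w" ?d] by (auto simp: s)
  then show ?case
  proof
    assume "g \<in> Poly_Mapping.keys (fox_list x w :: 'x free_group \<Rightarrow>\<^sub>0 'k)"
    from Cons.IH[OF this r(1)] show ?thesis by simp
  next
    assume "g \<in> Poly_Mapping.keys ?d"
    then have "y = x \<and> (if b then g = Abs_free_group w else g = Abs_free_group (s # w))"
      by (auto simp: in_keys_iff lookup_single when_def s split: if_splits)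
    with R show ?thesis by (auto simp: s split: if_splits)
  qed
qed simp

lemma fox_list_head:
  assumes "length (redword g) \<le> Suc n"
  shows "fox_list x (redword g) +
      (if redword g \<noteq> [] \<and> hd (redword g) = (x, False) then Poly_Mapping.single g 1 else 0)
    \<in> (length_le n :: ('x free_group \<Rightarrow>\<^sub>0 'k::field) set)" (is ?A)
    and "gp (x, True) * fox_list x (redword g) -
      (if redword g \<noteq> [] \<and> hd (redword g) = (x, True) then Poly_Mapping.single g 1 else 0)
    \<in> (length_le n :: ('x free_group \<Rightarrow>\<^sub>0 'k::field) set)" (is ?B)
proof -
  have "?A \<and> ?B"
  proof (cases "redword g")
    case (Cons s w)
    obtain y b where s: "s = (y, b)" by (cases s)
    have "reduced (s # w)" using reduced_redword[of g] unfolding Cons .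
    then have r: "reduced w" "reduced (s # w)" by (simp_all add: reduced_Cons)
    have R: "redword (Abs_free_group w) = w" using r by (simp add: Abs_free_group_inverse)
    have G: "Abs_free_group (s # w) = g" using Cons by (metis redword_inverse)
    have len: "length w \<le> n" using assms Cons by simp
    have 1: "fox_list x w \<in> (length_le n :: ('x free_group \<Rightarrow>\<^sub>0 'k) set)"
      using fox_list_keys[OF _ r(1)] len by (force simp: length_le_def)
    have 2: "gp (x, True) * fox_list x w \<in> (length_le n :: ('x free_group \<Rightarrow>\<^sub>0 'k) set)"
      unfolding length_le_def
    proof clarify
      fix h assume "h \<in> Poly_Mapping.keys (gp (x, True) * fox_list x w :: 'x free_group \<Rightarrow>\<^sub>0 'k)"
      then obtain h' where h': "h' \<in> Poly_Mapping.keys (fox_list x w :: 'x free_group \<Rightarrow>\<^sub>0 'k)"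
        and h: "h = sgen (x, True) + h'"
        using keys_mult[of "gp (x, True)" "fox_list x w :: 'x free_group \<Rightarrow>\<^sub>0 'k"] by (auto simp: gp_def)
      from fox_list_keys[OF h' r(1)] len show "length (redword h) \<le> n"
        by (cases w) (auto simp: h redword_sgen_plus cancel_cons_def)
    qed
    have 3: "Poly_Mapping.single (Abs_free_group w) 1 \<in> (length_le n :: ('x free_group \<Rightarrow>\<^sub>0 'k) set)"
      using len R by (simp add: length_le_def)
    have gw: "sgen s + Abs_free_group w = g"
      using r Cons R by (simp add: redword_sgen_plus cancel_cons_reduced flip: redword_inject)
    have gw': "sgen (flip s) + g = Abs_free_group w"
      unfolding gw[symmetric] by (rule sgen_flip_left)
    have ?A using 1 3 G Cons s by (cases b) (auto intro: length_le_add)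
    moreover have ?B using 2 3 gw gw' G Cons s
      by (cases b) (auto simp: distrib_left right_diff_distrib gp_mult_single intro: length_le_add length_le_diff)
    ultimately show ?thesis ..
  qed simp
  then show ?A ?B by blast+
qed

text \<open>
  Up to shorter words, \<open>D\<^sub>x p\<close> is the negative of the part of \<open>p\<close> that begins
  with \<open>x^-1\<close>, and \<open>x D\<^sub>x p\<close> is the part that begins with \<open>x\<close>. So the
  derivatives see all the longest words.
\<close>

lemma fox_head_part:
  assumes p: "p \<in> length_le (Suc n)"
  shows "fox x p + head_part (x, False) p \<in> length_le n"
    and "gp (x, True) * fox x p - head_part (x, True) p \<in> length_le n"
proof -
  let ?h = "\<lambda>s g. if redword g \<noteq> [] \<and> hd (redword g) = s then Poly_Mapping.single g 1 else 0"
  have "fox x p + head_part (x, False) p = linext (\<lambda>g. fox_list x (redword g) + ?h (x, False) g) p"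
    by (simp only: fox_def head_part_def linext_def distrib_left sum.distrib)
  also have "\<dots> \<in> length_le n"
    by (rule linext_length_le, rule fox_list_head(1)) (use p in \<open>simp add: length_le_def\<close>)
  finally show "fox x p + head_part (x, False) p \<in> length_le n" .
  have "gp (x, True) * fox x p - head_part (x, True) p =
      linext (\<lambda>g. gp (x, True) * fox_list x (redword g) - ?h (x, True) g) p"
    by (simp only: fox_def head_part_def linext_def right_diff_distrib sum_subtractf sum_distrib_left scal_left_commute)
  also have "\<dots> \<in> length_le n"
    by (rule linext_length_le, rule fox_list_head(2)) (use p in \<open>simp add: length_le_def\<close>)
  finally show "gp (x, True) * fox x p - head_part (x, True) p \<in> length_le n" .
qed

text \<open>
  Let \<open>\<Omega>\<close> be the intersection, a left ideal that is closed under the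
  derivatives. If the words of \<open>p \<in> \<Omega>\<close> have length at most \<open>n + 1\<close>, then up
  to shorter words \<open>q = x D\<^sub>x p\<close> is the part of \<open>p\<close> that begins with \<open>x\<close>. As no
  longest word of \<open>q\<close> begins with \<open>x^-1\<close>, the derivative \<open>D\<^sub>x q\<close> has words of
  length at most \<open>n\<close> and vanishes by induction. But up to shorter words
  \<open>x D\<^sub>x q\<close> is \<open>q\<close> again, so \<open>p\<close> has no word of length \<open>n + 1\<close> that begins with
  \<open>x\<close>. The same argument with \<open>q = D\<^sub>x p\<close> excludes \<open>x^-1\<close>.
\<close>

theorem fox_fil_Inter:
  assumes "\<And>n. p \<in> fox_fil n"
  shows "p = 0"
proof -
  define \<Omega> where "\<Omega> = (\<Inter>n. fox_fil n :: ('a free_group \<Rightarrow>\<^sub>0 'b) set)"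
  have fox: "fox x p \<in> \<Omega>" if "p \<in> \<Omega>" for x p
    unfolding \<Omega>_def
  proof
    fix n
    have "p \<in> fox_fil (Suc n)" using that by (simp only: \<Omega>_def INT_iff UNIV_I simp_thms)
    then show "fox x p \<in> fox_fil n" by simp
  qed
  have gp: "gp s * p \<in> \<Omega>" if "p \<in> \<Omega>" for s p
    using that unfolding \<Omega>_def by (blast intro: fox_fil_gp)
  have zero: "p = 0" if "p \<in> \<Omega>" "p \<in> length_le n" for n p
    using that
  proof (induction n arbitrary: p)
    case 0
    have "g = 0" if "g \<in> Poly_Mapping.keys p" for g
    proof -
      have "redword g = []" using 0(2) that by (auto simp: length_le_def)
      then show ?thesis by (metis redword_inverse redword_zero)
    qed
    then have p: "p = Poly_Mapping.single 0 (Poly_Mapping.lookup p 0)"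
      by (intro poly_mapping_eqI) (auto simp: lookup_single when_def in_keys_iff)
    have "p \<in> fox_fil (Suc 0)" using 0 by (simp only: \<Omega>_def INT_iff UNIV_I simp_thms)
    then have "group_aug p = 0" by simp
    then have "Poly_Mapping.lookup p 0 = 0"
      using arg_cong[OF p, of group_aug] by (simp only: group_aug_single)
    then show ?case by (subst p) simp
  next
    case (Suc n)
    have *: "head_part (x, True) p \<in> length_le n \<and> head_part (x, False) p \<in> length_le n" for x
    proof
      let ?S = "gp (x, True) :: 'a free_group \<Rightarrow>\<^sub>0 'b"
      define q where "q = ?S * fox x p"
      have r: "q - head_part (x, True) p \<in> length_le n"
        unfolding q_def by (rule fox_head_part(2)[OF Suc.prems(2)])
      have q: "q \<in> \<Omega>" unfolding q_def by (intro gp fox Suc.prems)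
      have "q \<in> length_le (Suc n)"
        using length_le_add[OF length_le_mono[OF r, of "Suc n"] head_part_length_le[OF Suc.prems(2)], of "(x, True)"] by simp
      note Q = fox_head_part[OF this, of x]
      have "head_part (x, False) q \<in> length_le n"
        using head_part_length_le[OF r, of "(x, False)"] by (simp add: head_part_diff head_part_head_part)
      from length_le_diff[OF Q(1) this] have "fox x q \<in> length_le n" by simp
      then have "fox x q = 0" by (intro Suc.IH fox q)
      with Q(2) have "- head_part (x, True) q \<in> length_le n" by simp
      from length_le_uminus[OF this] have "head_part (x, True) q \<in> length_le n" by simp
      from length_le_diff[OF this head_part_length_le[OF r, of "(x, True)"]]
      show "head_part (x, True) p \<in> length_le n" by (simp add: head_part_diff head_part_head_part)
    next
      let ?S = "gp (x, True) :: 'a free_group \<Rightarrow>\<^sub>0 'b"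
      define q where "q = fox x p"
      have r: "q + head_part (x, False) p \<in> length_le n"
        unfolding q_def by (rule fox_head_part(1)[OF Suc.prems(2)])
      have q: "q \<in> \<Omega>" unfolding q_def by (intro fox Suc.prems)
      have "q \<in> length_le (Suc n)"
        using length_le_diff[OF length_le_mono[OF r, of "Suc n"] head_part_length_le[OF Suc.prems(2)], of "(x, False)"] by simp
      note Q = fox_head_part[OF this, of x]
      have "head_part (x, True) q \<in> length_le n"
        using head_part_length_le[OF r, of "(x, True)"] by (simp add: head_part_add head_part_head_part)
      from length_le_add[OF Q(2) this] have "?S * fox x q \<in> length_le n" by simp
      then have "?S * fox x q = 0" by (intro Suc.IH gp fox q)
      then have "fox x q = 0" using gp_flip_left(1)[of "(x, True)" "fox x q"] by simp
      with Q(1) have "head_part (x, False) q \<in> length_le n" by simp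
      from length_le_diff[OF head_part_length_le[OF r, of "(x, False)"] this]
      show "head_part (x, False) p \<in> length_le n" by (simp add: head_part_add head_part_head_part)
    qed
    have "head_part s p \<in> length_le n" for s
    proof (cases s)
      case (Pair x b)
      with * show ?thesis by (cases b) simp_all
    qed
    from Suc.IH[OF Suc.prems(1) length_le_if_head_parts[OF this]] show ?case .
  qed
  have "p \<in> \<Omega>" using assms by (simp add: \<Omega>_def)
  moreover have "p \<in> length_le (Max (insert 0 ((\<lambda>g. length (redword g)) ` Poly_Mapping.keys p)))"
    by (auto simp: length_le_def)
  ultimately show ?thesis by (rule zero)
qed


section \<open>Normal words\<close>

text \<open>
  The words with a prefix \<open>x^l y\<close>. A word is normal if it contains no factor
  \<open>d x^l y\<close>, the left-hand side of the rewriting rule \<open>d x^l y -> a b^l c\<close>.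
\<close>

fun starts_xy :: "letter list \<Rightarrow> bool" where
  "starts_xy (Lx # w) \<longleftrightarrow> starts_xy w"
| "starts_xy (Ly # w) \<longleftrightarrow> True"
| "starts_xy _ \<longleftrightarrow> False"

fun normal :: "letter list \<Rightarrow> bool" where
  "normal [] \<longleftrightarrow> True"
| "normal (s # w) \<longleftrightarrow> normal w \<and> \<not> (s = Ld \<and> starts_xy w)"

lemma starts_xyD: "starts_xy w \<Longrightarrow> \<exists>l v. w = replicate l Lx @ Ly # v"
proof (induction w rule: starts_xy.induct)
  case (1 w)
  then obtain l v where "w = replicate l Lx @ Ly # v" by auto
  then show ?case by (intro exI[of _ "Suc l"] exI[of _ v]) simp
next
  case (2 w)
  show ?case by (intro exI[of _ 0] exI[of _ w]) simp
qed simp_all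

lemma normal_append_right: "normal (u @ v) \<Longrightarrow> normal v"
  by (induction u) simp_all

lemma starts_xy_append_AB: "starts_xy (w @ La # replicate l Lb) \<longleftrightarrow> starts_xy w"
  by (induction w rule: starts_xy.induct) simp_all

text \<open>
  For the injectivity of the boundary map on faces.
\<close>

lemma normal_append_AB:
  "normal w \<Longrightarrow> normal (w @ La # replicate l Lb)"
proof (induction w)
  case Nil
  have "\<not> starts_xy (replicate l Lb)" "normal (replicate l Lb)" for l
    by (induction l) simp_all
  then show ?case by simp
qed (simp add: starts_xy_append_AB)

lemma normal_ABC:
  assumes "normal v"
  shows "normal (La # replicate l Lb @ Lc # v)"
proof -
  have "normal (replicate l Lb @ Lc # v)" using assms by (induction l) auto
  then show ?thesis by simp
qed

text \<open>
  The image of \<open>1 + s\<close>: with \<open>g = d^-1 a\<close> it is \<open>g b g^-1\<close> for \<open>s = x\<close> and \<open>g c\<close> for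
  \<open>s = y\<close>. These are the values that the relations for \<open>l = 0\<close> and \<open>l = 1\<close> force when
  the elements \<open>1 + s\<close> are invertible.
\<close>

fun cap_image :: "letter \<Rightarrow> letter free_group" where
  "cap_image Lx = sgen (Ld, False) + (sgen (La, True) + (sgen (Lb, True) + (sgen (La, False) + sgen (Ld, True))))"
| "cap_image Ly = sgen (Ld, False) + (sgen (La, True) + sgen (Lc, True))"
| "cap_image s = sgen (s, True)"

definition word_image :: "letter list \<Rightarrow> letter free_group"
  where "word_image w = sum_list (map cap_image w)"

lemma word_image_simps [simp]:
  "word_image [] = 0" "word_image (s # w) = cap_image s + word_image w"
  "word_image (u @ v) = word_image u + word_image v"
  by (simp_all add: word_image_def)

lemma cap_image_left_cancel: "cap_image s + g = cap_image s + h \<Longrightarrow> g = h"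
  by (cases s) (auto simp: add.assoc dest!: free_group_left_cancel)

text \<open>
  The words with a prefix \<open>b^k s\<close>.
\<close>

primrec Bs_then :: "letter \<times> bool \<Rightarrow> (letter \<times> bool) list \<Rightarrow> bool" where
  "Bs_then s [] \<longleftrightarrow> False"
| "Bs_then s (t # w) \<longleftrightarrow> t = s \<or> t = (Lb, True) \<and> Bs_then s w"

text \<open>
  The first letter of a normal word can be recovered from the reduced form of its
  image. The image of \<open>d x \<dots>\<close> loses its first letter and begins with
  \<open>a b^k a^-1\<close>, but the image of a normal word that begins with \<open>a\<close> never does so. The
  images of \<open>x\<close> and \<open>y\<close> begin with \<open>d^-1 a b\<close> and \<open>d^-1 a c\<close> and differ in the third
  letter.
\<close>

definition first_letter :: "(letter \<times> bool) list \<Rightarrow> letter option" where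
  "first_letter r =
    (if r = [] then None
     else if hd r = (La, True) then Some (if Bs_then (La, False) (tl r) then Ld else La)
     else if hd r = (Ld, False) then Some (if r ! 2 = (Lc, True) then Ly else Lx)
     else Some (fst (hd r)))"

text \<open>
  How the reduced image of a normal word begins, depending on the first letter of the
  word. The image of \<open>x^k\<close> is \<open>d^-1 a b^k a^-1 d\<close>. If \<open>y\<close> follows then \<open>a^-1 d\<close>
  cancels and \<open>c\<close> comes next; otherwise \<open>a^-1\<close> stays. A normal word that begins with
  \<open>d\<close> does not begin with \<open>d x^l y\<close>, so its image does not begin with \<open>a b^k c\<close>.
\<close>

fun shaped :: "letter list \<Rightarrow> (letter \<times> bool) list \<Rightarrow> bool" where
  "shaped [] r \<longleftrightarrow> r = []"
| "shaped (La # w) r \<longleftrightarrow> (\<exists>u. r = (La, True) # u \<and> \<not> Bs_then (La, False) u)"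
| "shaped (Lb # w) r \<longleftrightarrow> (\<exists>u. r = (Lb, True) # u \<and> \<not> Bs_then (La, False) u)"
| "shaped (Lc # w) r \<longleftrightarrow> (\<exists>u. r = (Lc, True) # u)"
| "shaped (Ld # w) r \<longleftrightarrow> (\<exists>u. r = (Ld, True) # u) \<or> (\<exists>u. r = (La, True) # (Lb, True) # u \<and> Bs_then (La, False) u)"
| "shaped (Lx # w) r \<longleftrightarrow> (\<exists>u. r = (Ld, False) # (La, True) # (Lb, True) # u \<and>
                (if starts_xy w then Bs_then (Lc, True) u else Bs_then (La, False) u))"
| "shaped (Ly # w) r \<longleftrightarrow> (\<exists>u. r = (Ld, False) # (La, True) # (Lc, True) # u)"

lemma shaped_word_image: "normal w \<Longrightarrow> shaped w (redword (word_image w))"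
proof (induction w)
  case (Cons s w)
  define g where "g = word_image w"
  have IH: "shaped w (redword g)" using Cons by (simp add: g_def)
  have n: "\<not> (s = Ld \<and> starts_xy w)" using Cons.prems by simp
  have "shaped (s # w) (redword (cap_image s + g))"
    using IH n
    by (cases w; cases "hd w"; cases s)
      (auto simp: redword_sgen_plus add.assoc split: if_splits)
  then show ?case by (simp add: g_def)
qed simp

lemma first_letter_shaped:
  "shaped w r \<Longrightarrow> first_letter r = (case w of [] \<Rightarrow> None | s # v \<Rightarrow> Some s)"
  by (cases w; cases "hd w") (auto simp: first_letter_def)

text \<open>
  Normal words with the same image have the same first letter, and this letter can be
  cancelled in the group.
\<close>

theorem word_image_inj_on_normal:
  "normal v \<Longrightarrow> normal w \<Longrightarrow> word_image v = word_image w \<Longrightarrow> v = w"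
proof (induction v arbitrary: w)
  case Nil
  then show ?case
    using first_letter_shaped[OF shaped_word_image[OF Nil(2)]] by (cases w) (simp_all add: first_letter_def)
next
  case (Cons s v)
  have "first_letter (redword (word_image w)) = Some s"
    using first_letter_shaped[OF shaped_word_image[OF Cons.prems(1)]] Cons.prems(3) by simp
  then obtain w' where w: "w = s # w'"
    using first_letter_shaped[OF shaped_word_image[OF Cons.prems(2)]] by (cases w) auto
  have "v = w'"
    using Cons.prems by (intro Cons.IH) (auto simp: w dest: cap_image_left_cancel)
  then show ?case by (simp add: w)
qed


section \<open>The relator ideal is the kernel of the map to the free group algebra\<close>

type_synonym 'k presalg = "letter word \<Rightarrow>\<^sub>0 'k"

text \<open>
  In terms of these products the relators are binomials, so that the quotient by them
  is a monoid algebra.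
\<close>

definition cap :: "letter list \<Rightarrow> letter word \<Rightarrow>\<^sub>0 'k::field"
  where "cap w = prod_list (map (\<lambda>s. 1 + gen s) w)"

lemma cap_simps [simp]: "cap [] = 1" "cap (s # w) = (1 + gen s) * cap w" "cap (u @ v) = cap u * cap v"
  "cap (replicate l s) = (1 + gen s) ^ l"
  by (simp_all add: cap_def prod_list_replicate)

lemma relator_eq_cap: "relator l = cap (La # replicate l Lb @ [Lc]) - cap (Ld # replicate l Lx @ [Ly])"
  unfolding relator_def cap_simps mult_1_right mult.assoc ..

abbreviation J :: "'k::field presalg set" where "J \<equiv> ideal_gen (range relator)"

lemma two_sided_J: "two_sided J"
  by (rule two_sided_ideal_gen)

definition to_group :: "'k::field presalg \<Rightarrow> letter free_group \<Rightarrow>\<^sub>0 'k"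
  where "to_group = free_hom (\<lambda>s. Poly_Mapping.single (cap_image s) 1 - 1)"

interpretation to_group: alg_map to_group
  unfolding to_group_def by (rule alg_map_free_hom)

lemma to_group_gen: "to_group (gen s) = Poly_Mapping.single (cap_image s) 1 - 1"
  by (simp add: to_group_def)

lemma to_group_cap: "to_group (cap w) = Poly_Mapping.single (word_image w) 1"
  by (induction w) (simp_all add: to_group.simps to_group_gen mult_single)

text \<open>
  The computation \<open>d (g b g^-1)^l g = a b^l\<close> with \<open>g = d^-1 a\<close>.
\<close>

lemma word_image_relator:
  "word_image (La # replicate l Lb @ [Lc]) = word_image (Ld # replicate l Lx @ [Ly])"
proof -
  have "sgen (Ld, True) + (word_image (replicate l Lx) + (sgen (Ld, False) + (sgen (La, True) + g)))
    = sgen (La, True) + (word_image (replicate l Lb) + g)" for g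
  proof (induction l)
    case 0
    then show ?case using sgen_flip_left(2)[of "(Ld, True)"] by simp
  next
    case (Suc l)
    have *: "sgen (Ld, True) + (sgen (Ld, False) + h) = h" "sgen (La, False) + (sgen (La, True) + h) = h" for h
      using sgen_flip_left(2)[of "(Ld, True)" h] sgen_flip_left(1)[of "(La, True)" h] by simp_all
    show ?case by (simp add: add.assoc * Suc)
  qed
  from this[of "sgen (Lc, True)"] show ?thesis by (simp add: add.assoc)
qed

lemma to_group_J: "p \<in> J \<Longrightarrow> to_group p = 0"
proof -
  have "two_sided {p :: 'a presalg. to_group p \<in> {0}}"
    by (intro two_sided_vimage to_group.alg_map_axioms) (simp add: two_sided_def)
  moreover have "range relator \<subseteq> {p :: 'a presalg. to_group p \<in> {0}}"
    by (auto simp: relator_eq_cap to_group.diff to_group_cap word_image_relator simp del: cap_simps word_image_simps)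
  ultimately have "J \<subseteq> {p :: 'a presalg. to_group p \<in> {0}}" by (rule ideal_gen_minimal)
  then show "p \<in> J \<Longrightarrow> to_group p = 0" by blast
qed

lemma relator_in_J: "relator l \<in> J"
  by (rule subsetD[OF ideal_gen_superset rangeI])

text \<open>
  A normal word stays normal when a letter is put in front, unless this creates a
  prefix \<open>d x^l y\<close>. Replacing the prefix by \<open>a b^l c\<close> gives a normal word again, since
  it ends with \<open>c\<close> and contains no \<open>d\<close>.
\<close>

lemma exists_normal_word: "\<exists>v. normal v \<and> eqmod J (cap w :: 'k::field presalg) (cap v)"
proof (induction w)
  case Nil
  show ?case by (intro exI[of _ "[]"]) (simp add: eqmod_refl two_sided_J)
next
  case (Cons s w)
  then obtain v where v: "normal v" "eqmod J (cap w :: 'k presalg) (cap v)" by blast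
  have s: "eqmod J (cap (s # w) :: 'k presalg) (cap (s # v))"
    using v(2) by (simp add: eqmod_mult eqmod_refl two_sided_J)
  show ?case
  proof (cases "s = Ld \<and> starts_xy v")
    case True
    then obtain l u where u: "v = replicate l Lx @ Ly # u" using starts_xyD by blast
    have "- (relator l :: 'k presalg) * cap u \<in> J"
      by (intro two_sidedD(4)[OF two_sided_J] two_sidedD(5)[OF two_sided_J] relator_in_J)
    then have "eqmod J (cap (s # v) :: 'k presalg) (cap (La # replicate l Lb @ Lc # u))"
      using True u by (simp add: eqmod_def relator_def algebra_simps)
    then have "eqmod J (cap (s # w) :: 'k presalg) (cap (La # replicate l Lb @ Lc # u))"
      using s eqmod_trans[OF two_sided_J] by blast
    moreover have "normal (La # replicate l Lb @ Lc # u)"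
      using normal_append_right[of "replicate l Lx @ [Ly]" u] v(1) u by (intro normal_ABC) simp
    ultimately show ?thesis by blast
  next
    case False
    with v(1) s show ?thesis by (intro exI[of _ "s # v"]) simp
  qed
qed

definition cap_comb :: "(letter list \<Rightarrow>\<^sub>0 'k) \<Rightarrow> 'k::field presalg"
  where "cap_comb = linext cap"

lemma to_group_cap_comb:
  "to_group (cap_comb u) = linext (\<lambda>w. Poly_Mapping.single (word_image w) 1) u"
  by (induction u rule: poly_mapping_single_induct)
     (simp_all add: cap_comb_def linext_add to_group.simps to_group_cap mult_single)

lemma to_group_cap_comb_eq_0:
  assumes "\<forall>w\<in>Poly_Mapping.keys u. normal w" "to_group (cap_comb u) = 0"
  shows "u = 0"
proof (rule ccontr)
  assume "u \<noteq> 0"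
  then obtain v where v: "v \<in> Poly_Mapping.keys u" by (metis ex_in_conv keys_eq_empty)
  have "Poly_Mapping.lookup (to_group (cap_comb u)) (word_image v) =
    (\<Sum>w\<in>Poly_Mapping.keys u. if w = v then Poly_Mapping.lookup u v else 0)"
    unfolding to_group_cap_comb linext_def lookup_sum
  proof (rule sum.cong)
    fix w assume "w \<in> Poly_Mapping.keys u"
    then have "word_image w = word_image v \<longleftrightarrow> w = v" using assms(1) v word_image_inj_on_normal by blast
    then show "Poly_Mapping.lookup (scal (Poly_Mapping.lookup u w) * Poly_Mapping.single (word_image w) 1)
      (word_image v) = (if w = v then Poly_Mapping.lookup u v else 0)"
      by (simp add: mult_single lookup_single when_def)
  qed simp
  also have "\<dots> = Poly_Mapping.lookup u v" using v by (simp add: sum.delta)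
  finally show False using v assms(2) by (simp add: in_keys_iff)
qed

text \<open>
  The products \<open>cap w\<close> span the free algebra because \<open>s = (1 + s) - 1\<close>.
\<close>

lemma exists_normal_comb:
  "\<exists>u. (\<forall>w\<in>Poly_Mapping.keys u. normal w) \<and> eqmod J p (cap_comb u)" for p :: "'k::field presalg"
proof -
  note J = two_sided_J
  have cap: "\<exists>u. (\<forall>w\<in>Poly_Mapping.keys u. normal w) \<and> eqmod J (linext cap q :: 'k presalg) (cap_comb u)" for q
  proof (induction q rule: poly_mapping_single_induct)
    case (single w c)
    obtain v where "normal v" "eqmod J (cap w :: 'k presalg) (cap v)" using exists_normal_word by blast
    then show ?case
      by (intro exI[of _ "Poly_Mapping.single v c"]) (simp add: cap_comb_def eqmod_mult[OF J] eqmod_refl[OF J])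
  next
    case (add p q)
    then obtain u v where "\<forall>w\<in>Poly_Mapping.keys u. normal w" "\<forall>w\<in>Poly_Mapping.keys v. normal w"
      "eqmod J (linext cap p :: 'k presalg) (cap_comb u)" "eqmod J (linext cap q :: 'k presalg) (cap_comb v)" by blast
    then show ?case
      using keys_add[of u v]
      by (intro exI[of _ "u + v"]) (auto simp: linext_add cap_comb_def intro!: eqmod_add[OF J])
  qed
  have "\<exists>q. p = linext cap q"
  proof -
    have "p = free_hom (\<lambda>s. 1 + gen s) (free_hom (\<lambda>s. gen s - 1) p)"
      by (rule alg_maps_eq[where X = UNIV, OF alg_map_id alg_map_comp[OF alg_map_free_hom alg_map_free_hom]])
        (simp_all add: alg_map.simps[OF alg_map_free_hom] alg_map.one[OF alg_map_free_hom])
    moreover have "\<exists>q'. free_hom (\<lambda>s. 1 + gen s) q = linext cap q'" for q :: "'k presalg"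
    proof (induction q rule: poly_mapping_single_induct)
      case (single w c)
      then show ?case
        by (intro exI[of _ "Poly_Mapping.single (letters w) c"]) (simp add: free_hom_def cap_def)
    next
      case (add p q)
      then obtain p' q' where "free_hom (\<lambda>s. 1 + gen s) p = linext cap p'"
        "free_hom (\<lambda>s. 1 + gen s) q = linext cap q'" by blast
      then have "free_hom (\<lambda>s. 1 + gen s) (p + q) = linext cap (p' + q')"
        by (simp add: alg_map.add[OF alg_map_free_hom] linext_add)
      then show ?case by blast
    qed
    ultimately show ?thesis by (rule ssubst)
  qed
  with cap show ?thesis by blast
qed

text \<open>
  The quotient by \<open>J\<close> is spanned by the normal words, and these are mapped to distinct
  group elements, which are linearly independent in the group algebra.
\<close>

theorem J_iff: "p \<in> J \<longleftrightarrow> to_group p = 0"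
proof
  assume p: "to_group p = 0"
  obtain u where u: "\<forall>w\<in>Poly_Mapping.keys u. normal w" "eqmod J p (cap_comb u)"
    using exists_normal_comb by blast
  then have "to_group (p - cap_comb u) = 0" using to_group_J by (auto simp: eqmod_def)
  then have "to_group (cap_comb u) = 0" using p by (simp add: to_group.simps)
  then have "u = 0" using u(1) to_group_cap_comb_eq_0 by blast
  then show "p \<in> J" using u(2) by (simp add: eqmod_def cap_comb_def)
qed (rule to_group_J)

text \<open>
  The images of the generators have augmentation zero.
\<close>

lemma to_group_length_ge: "p \<in> length_ge n \<Longrightarrow> to_group p \<in> fox_fil n"
proof -
  have w: "prod_list (map (\<lambda>s. Poly_Mapping.single (cap_image s) 1 - 1) w) \<in>
      (fox_fil (length w) :: (letter free_group \<Rightarrow>\<^sub>0 'a) set)" for w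
  proof (induction w)
    case (Cons s w)
    have "group_aug (Poly_Mapping.single (cap_image s) 1 - 1 :: letter free_group \<Rightarrow>\<^sub>0 'a) = 0"
      using group_aug_add[of "Poly_Mapping.single (cap_image s) 1 - 1 :: letter free_group \<Rightarrow>\<^sub>0 'a" 1]
        group_aug_single[of "0 :: letter free_group" "1::'a"] group_aug_single[of "cap_image s" "1::'a"]
      by (simp del: group_aug_single)
    from fox_fil_mult(2)[OF Cons this] show ?case by (simp del: fox_fil.simps)
  qed simp
  have mono: "q \<in> fox_fil m \<Longrightarrow> n \<le> m \<Longrightarrow> q \<in> fox_fil n" for m and q :: "letter free_group \<Rightarrow>\<^sub>0 'a"
  proof (induction m)
    case (Suc m)
    then show ?case using fox_fil_Suc_subset[of q m] by (cases "n = Suc m") auto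
  qed simp
  assume p: "p \<in> length_ge n"
  have "(\<Sum>w\<in>S. scal (Poly_Mapping.lookup p w) *
      prod_list (map (\<lambda>s. Poly_Mapping.single (cap_image s) 1 - 1) (letters w))) \<in> fox_fil n"
    if "finite S" "S \<subseteq> Poly_Mapping.keys p" for S
    using that
  proof (induction S)
    case (insert v S)
    have "n \<le> length (letters v)" using insert.prems p by (auto simp: length_ge_def)
    with insert show ?case by (simp add: fox_fil_add fox_fil_scal mono[OF w])
  qed simp
  from this[OF finite_keys subset_refl] show "to_group p \<in> fox_fil n"
    unfolding to_group_def free_hom_def linext_def .
qed

text \<open>
  The algebra embeds into the group algebra, which is residually nilpotent, and the
  embedding maps powers of the augmentation ideal into powers of the augmentation
  ideal.
\<close>

theorem J_separated:
  assumes "\<And>n. \<exists>q\<in>length_ge n. eqmod J p q"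
  shows "p \<in> J"
proof -
  have "to_group p \<in> fox_fil n" for n
  proof -
    obtain q where q: "q \<in> length_ge n" "eqmod J p q" using assms by blast
    then have "to_group p = to_group q" using J_iff[of "p - q"] by (simp add: eqmod_def to_group.simps)
    then show ?thesis using to_group_length_ge[OF q(1)] by simp
  qed
  then show ?thesis using fox_fil_Inter J_iff by blast
qed


section \<open>Left modules\<close>

context left_module
begin

lemma smult_zero_left [simp]:
  assumes "x \<in> carrier M" shows "\<zero> \<odot>\<^bsub>M\<^esub> x = \<zero>\<^bsub>M\<^esub>"
proof -
  have "\<zero> \<odot>\<^bsub>M\<^esub> x \<oplus>\<^bsub>M\<^esub> \<zero> \<odot>\<^bsub>M\<^esub> x = \<zero> \<odot>\<^bsub>M\<^esub> x"
    using smult_l_distr[of \<zero> \<zero> x] assms by simp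
  then show ?thesis using assms smult_closed[of \<zero> x] by (metis M.add.r_cancel_one' R.zero_closed)
qed

lemma smult_zero_right [simp]:
  assumes "a \<in> carrier R" shows "a \<odot>\<^bsub>M\<^esub> \<zero>\<^bsub>M\<^esub> = \<zero>\<^bsub>M\<^esub>"
proof -
  have "a \<odot>\<^bsub>M\<^esub> \<zero>\<^bsub>M\<^esub> \<oplus>\<^bsub>M\<^esub> a \<odot>\<^bsub>M\<^esub> \<zero>\<^bsub>M\<^esub> = a \<odot>\<^bsub>M\<^esub> \<zero>\<^bsub>M\<^esub>"
    using smult_r_distr[of a "\<zero>\<^bsub>M\<^esub>" "\<zero>\<^bsub>M\<^esub>"] assms by simp
  then show ?thesis using assms smult_closed[of a "\<zero>\<^bsub>M\<^esub>"] by (metis M.add.r_cancel_one' M.zero_closed)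
qed

lemma smult_minus_right:
  assumes "a \<in> carrier R" "x \<in> carrier M"
  shows "a \<odot>\<^bsub>M\<^esub> (\<ominus>\<^bsub>M\<^esub> x) = \<ominus>\<^bsub>M\<^esub> (a \<odot>\<^bsub>M\<^esub> x)"
proof (rule M.minus_equality[symmetric])
  show "a \<odot>\<^bsub>M\<^esub> (\<ominus>\<^bsub>M\<^esub> x) \<oplus>\<^bsub>M\<^esub> a \<odot>\<^bsub>M\<^esub> x = \<zero>\<^bsub>M\<^esub>"
    using assms smult_r_distr[of a "\<ominus>\<^bsub>M\<^esub> x" x] by (simp add: M.l_neg)
qed (use assms smult_closed in auto)

end

lemma left_module_if_module: "module R M \<Longrightarrow> left_module R M"
  unfolding module_def left_module_def left_module_axioms_def module_axioms_def cring_def by auto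

lemma module_if_left_module: "left_module R M \<Longrightarrow> cring R \<Longrightarrow> module R M"
  unfolding module_def left_module_def left_module_axioms_def module_axioms_def by auto


subsection \<open>Homomorphisms\<close>

lemma lmod_homI:
  assumes "\<And>x. x \<in> carrier M \<Longrightarrow> f x \<in> carrier N"
    and "\<And>x y. x \<in> carrier M \<Longrightarrow> y \<in> carrier M \<Longrightarrow> f (x \<oplus>\<^bsub>M\<^esub> y) = f x \<oplus>\<^bsub>N\<^esub> f y"
    and "\<And>a x. a \<in> carrier R \<Longrightarrow> x \<in> carrier M \<Longrightarrow> f (a \<odot>\<^bsub>M\<^esub> x) = a \<odot>\<^bsub>N\<^esub> f x"
  shows "f \<in> lmod_hom R M N"
  using assms by (auto simp: lmod_hom_def)

lemma lmod_homD:
  assumes "f \<in> lmod_hom R M N"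
  shows "x \<in> carrier M \<Longrightarrow> f x \<in> carrier N"
    and "x \<in> carrier M \<Longrightarrow> y \<in> carrier M \<Longrightarrow> f (x \<oplus>\<^bsub>M\<^esub> y) = f x \<oplus>\<^bsub>N\<^esub> f y"
    and "a \<in> carrier R \<Longrightarrow> x \<in> carrier M \<Longrightarrow> f (a \<odot>\<^bsub>M\<^esub> x) = a \<odot>\<^bsub>N\<^esub> f x"
  using assms by (auto simp: lmod_hom_def)

lemma lmod_hom_zero:
  assumes "left_module R M" "left_module R N" "f \<in> lmod_hom R M N"
  shows "f \<zero>\<^bsub>M\<^esub> = \<zero>\<^bsub>N\<^esub>"
proof -
  interpret M: left_module R M by fact
  interpret N: left_module R N by fact
  have "f \<zero>\<^bsub>M\<^esub> \<oplus>\<^bsub>N\<^esub> f \<zero>\<^bsub>M\<^esub> = f \<zero>\<^bsub>M\<^esub>"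
    using lmod_homD(2)[OF assms(3), of "\<zero>\<^bsub>M\<^esub>" "\<zero>\<^bsub>M\<^esub>"] by simp
  then show ?thesis using lmod_homD(1)[OF assms(3), of "\<zero>\<^bsub>M\<^esub>"] by (metis N.add.r_cancel_one' M.M.zero_closed)
qed

lemma lmod_hom_uminus:
  assumes "left_module R M" "left_module R N" "f \<in> lmod_hom R M N" "x \<in> carrier M"
  shows "f (\<ominus>\<^bsub>M\<^esub> x) = \<ominus>\<^bsub>N\<^esub> f x"
proof -
  interpret M: left_module R M by fact
  interpret N: left_module R N by fact
  show ?thesis
  proof (rule N.M.minus_equality[symmetric])
    show "f (\<ominus>\<^bsub>M\<^esub> x) \<oplus>\<^bsub>N\<^esub> f x = \<zero>\<^bsub>N\<^esub>"
      using lmod_homD(2)[OF assms(3), of "\<ominus>\<^bsub>M\<^esub> x" x] assms by (simp add: M.M.l_neg lmod_hom_zero)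
  qed (use assms lmod_homD(1)[OF assms(3)] in auto)
qed

lemma lmod_hom_minus:
  assumes "left_module R M" "left_module R N" "f \<in> lmod_hom R M N" "x \<in> carrier M" "y \<in> carrier M"
  shows "f (x \<ominus>\<^bsub>M\<^esub> y) = f x \<ominus>\<^bsub>N\<^esub> f y"
proof -
  interpret M: left_module R M by fact
  show ?thesis using assms by (simp add: a_minus_def lmod_homD(2)[OF assms(3)] lmod_hom_uminus)
qed

lemma lmod_hom_comp:
  "f \<in> lmod_hom R M N \<Longrightarrow> g \<in> lmod_hom R N L \<Longrightarrow> (\<lambda>x. g (f x)) \<in> lmod_hom R M L"
  by (intro lmod_homI) (simp_all add: lmod_homD)

lemma lmod_hom_id: "(\<lambda>x. x) \<in> lmod_hom R M M"
  by (auto simp: lmod_hom_def)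

lemma lmod_hom_diff:
  assumes "left_module R N" "f \<in> lmod_hom R M N" "g \<in> lmod_hom R M N"
  shows "(\<lambda>x. f x \<ominus>\<^bsub>N\<^esub> g x) \<in> lmod_hom R M N"
proof -
  interpret N: left_module R N by fact
  show ?thesis using lmod_homD[OF assms(2)] lmod_homD[OF assms(3)]
    by (intro lmod_homI)
      (simp_all add: a_minus_def N.M.a_ac N.smult_r_distr N.M.minus_add N.smult_minus_right)
qed

lemma submodule_iff:
  assumes "left_module R M"
  shows "submodule H R M \<longleftrightarrow> H \<subseteq> carrier M \<and> \<zero>\<^bsub>M\<^esub> \<in> H \<and>
    (\<forall>x\<in>H. \<forall>y\<in>H. x \<oplus>\<^bsub>M\<^esub> y \<in> H) \<and> (\<forall>a\<in>carrier R. \<forall>x\<in>H. a \<odot>\<^bsub>M\<^esub> x \<in> H)" (is "_ \<longleftrightarrow> ?r")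
proof
  interpret M: left_module R M by fact
  assume "submodule H R M"
  then interpret H: submodule H R M .
  show ?r using H.subset H.one_closed H.m_closed H.smult_closed by auto
next
  interpret M: left_module R M by fact
  assume r: ?r
  have "\<ominus>\<^bsub>M\<^esub> x \<in> H" if "x \<in> H" for x
  proof -
    have x: "x \<in> carrier M" using that r by auto
    have "(\<ominus>\<^bsub>R\<^esub> \<one>\<^bsub>R\<^esub>) \<odot>\<^bsub>M\<^esub> x \<oplus>\<^bsub>M\<^esub> x = \<zero>\<^bsub>M\<^esub>"
      using M.smult_l_distr[of "\<ominus>\<^bsub>R\<^esub> \<one>\<^bsub>R\<^esub>" "\<one>\<^bsub>R\<^esub>" x] x by (simp add: M.smult_one M.R.l_neg)
    then have "\<ominus>\<^bsub>M\<^esub> x = (\<ominus>\<^bsub>R\<^esub> \<one>\<^bsub>R\<^esub>) \<odot>\<^bsub>M\<^esub> x"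
      using x by (intro M.M.minus_equality M.smult_closed) auto
    then show ?thesis using r that by simp
  qed
  then show "submodule H R M"
    using r by unfold_locales (auto simp: a_inv_def)
qed


subsection \<open>Quotients\<close>

text \<open>
  For calculations with \<open>quot\<close> on representatives of cosets.
\<close>

locale submodule_quotient = left_module R M
  for R :: "('r, 'c) ring_scheme" and M :: "('r, 'm, 'z) module_scheme" +
  fixes N :: "'m set"
  assumes submodule: "submodule N R M"
begin

lemmas submodule_closed = submodule[unfolded submodule_iff[OF left_module_axioms]]

lemma abelian_subgroup: "abelian_subgroup N M"
  by (intro abelian_subgroupI3 additive_subgroup.intro submodule.axioms(1)[OF submodule] M.abelian_group_axioms)

sublocale N: abelian_subgroup N M
  by (rule abelian_subgroup)

lemma coset_eq_iff:
  assumes "x \<in> carrier M" "y \<in> carrier M"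
  shows "N +>\<^bsub>M\<^esub> x = N +>\<^bsub>M\<^esub> y \<longleftrightarrow> x \<ominus>\<^bsub>M\<^esub> y \<in> N"
  using assms N.a_rcos_module[of y x] N.a_rcos_self[of x] M.a_repr_independence[of x N y] N.a_subgroup
  by (auto simp: a_minus_def)

lemma coset_zero: "N +>\<^bsub>M\<^esub> \<zero>\<^bsub>M\<^esub> = N"
  using M.a_coset_join2[OF M.zero_closed N.a_subgroup] submodule_closed by auto

lemma coset_eq_zero_iff:
  assumes "x \<in> carrier M" shows "N +>\<^bsub>M\<^esub> x = N \<longleftrightarrow> x \<in> N"
  using coset_eq_iff[OF assms M.zero_closed] assms by (simp add: coset_zero a_minus_def M.minus_equality[of "\<zero>\<^bsub>M\<^esub>" "\<zero>\<^bsub>M\<^esub>"])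

lemma quot_carrier: "carrier (quot M N) = (\<lambda>x. N +>\<^bsub>M\<^esub> x) ` carrier M"
  by (auto simp: quot_def FactRing_def A_RCOSETS_def' )

lemma quot_zero: "\<zero>\<^bsub>quot M N\<^esub> = N"
  by (simp add: quot_def FactRing_def)

lemma quot_add:
  "x \<in> carrier M \<Longrightarrow> y \<in> carrier M \<Longrightarrow>
    (N +>\<^bsub>M\<^esub> x) \<oplus>\<^bsub>quot M N\<^esub> (N +>\<^bsub>M\<^esub> y) = N +>\<^bsub>M\<^esub> (x \<oplus>\<^bsub>M\<^esub> y)"
  by (simp add: quot_def FactRing_def N.a_rcos_sum)

lemma quot_smult:
  assumes a: "a \<in> carrier R" and x: "x \<in> carrier M"
  shows "a \<odot>\<^bsub>quot M N\<^esub> (N +>\<^bsub>M\<^esub> x) = N +>\<^bsub>M\<^esub> (a \<odot>\<^bsub>M\<^esub> x)"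
proof -
  have "N +>\<^bsub>M\<^esub> (a \<odot>\<^bsub>M\<^esub> y) = N +>\<^bsub>M\<^esub> (a \<odot>\<^bsub>M\<^esub> x)" if y: "y \<in> N +>\<^bsub>M\<^esub> x" for y
  proof -
    have yc: "y \<in> carrier M" using N.a_elemrcos_carrier[OF x y] .
    then have "y \<ominus>\<^bsub>M\<^esub> x \<in> N" using y x N.a_rcos_module[of x y] by (simp add: a_minus_def)
    then have "a \<odot>\<^bsub>M\<^esub> (y \<ominus>\<^bsub>M\<^esub> x) \<in> N" using submodule_closed a by blast
    then show ?thesis using a x yc smult_closed
      by (simp add: coset_eq_iff a_minus_def smult_r_distr smult_minus_right)
  qed
  then have "(\<Union>y\<in>N +>\<^bsub>M\<^esub> x. N +>\<^bsub>M\<^esub> (a \<odot>\<^bsub>M\<^esub> y)) = (\<Union>y\<in>N +>\<^bsub>M\<^esub> x. N +>\<^bsub>M\<^esub> (a \<odot>\<^bsub>M\<^esub> x))"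
    by (intro SUP_cong refl)
  also have "\<dots> = N +>\<^bsub>M\<^esub> (a \<odot>\<^bsub>M\<^esub> x)"
    by (rule SUP_const) (use N.a_rcos_self[OF x] in blast)
  finally show ?thesis by (simp add: quot_def)
qed

lemma quot_cases:
  assumes "X \<in> carrier (quot M N)"
  obtains x where "x \<in> carrier M" "X = N +>\<^bsub>M\<^esub> x"
  using assms unfolding quot_carrier by (elim imageE)

lemma coset_in_quot: "x \<in> carrier M \<Longrightarrow> N +>\<^bsub>M\<^esub> x \<in> carrier (quot M N)"
  unfolding quot_carrier by (rule imageI)

lemma left_module_quot: "left_module R (quot M N)"
proof -
  have z: "\<zero>\<^bsub>quot M N\<^esub> = N +>\<^bsub>M\<^esub> \<zero>\<^bsub>M\<^esub>" by (simp add: quot_zero coset_zero)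
  have "abelian_group (quot M N)"
  proof (rule abelian_groupI)
    fix X Y Z assume "X \<in> carrier (quot M N)" "Y \<in> carrier (quot M N)" "Z \<in> carrier (quot M N)"
    then show "X \<oplus>\<^bsub>quot M N\<^esub> Y \<oplus>\<^bsub>quot M N\<^esub> Z = X \<oplus>\<^bsub>quot M N\<^esub> (Y \<oplus>\<^bsub>quot M N\<^esub> Z)"
      by (elim quot_cases) (simp add: quot_add M.a_assoc)
  next
    fix X Y assume XY: "X \<in> carrier (quot M N)" "Y \<in> carrier (quot M N)"
    from XY show "X \<oplus>\<^bsub>quot M N\<^esub> Y \<in> carrier (quot M N)"
      by (elim quot_cases) (simp add: quot_add coset_in_quot)
    from XY show "X \<oplus>\<^bsub>quot M N\<^esub> Y = Y \<oplus>\<^bsub>quot M N\<^esub> X"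
      by (elim quot_cases) (simp add: quot_add M.a_comm)
  next
    fix X assume X: "X \<in> carrier (quot M N)"
    from X show "\<zero>\<^bsub>quot M N\<^esub> \<oplus>\<^bsub>quot M N\<^esub> X = X"
      by (elim quot_cases) (simp add: quot_add z)
    obtain x where x: "x \<in> carrier M" "X = N +>\<^bsub>M\<^esub> x" using X by (rule quot_cases)
    show "\<exists>Y\<in>carrier (quot M N). Y \<oplus>\<^bsub>quot M N\<^esub> X = \<zero>\<^bsub>quot M N\<^esub>"
      by (rule bexI[of _ "N +>\<^bsub>M\<^esub> (\<ominus>\<^bsub>M\<^esub> x)"]) (use x in \<open>simp_all add: quot_add z M.l_neg coset_in_quot\<close>)
  next
    show "\<zero>\<^bsub>quot M N\<^esub> \<in> carrier (quot M N)" by (simp add: z coset_in_quot)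
  qed
  moreover have "left_module_axioms R (quot M N)"
  proof
    fix a b X assume a: "a \<in> carrier R" and b: "b \<in> carrier R" and X: "X \<in> carrier (quot M N)"
    from X show "(a \<oplus>\<^bsub>R\<^esub> b) \<odot>\<^bsub>quot M N\<^esub> X = a \<odot>\<^bsub>quot M N\<^esub> X \<oplus>\<^bsub>quot M N\<^esub> b \<odot>\<^bsub>quot M N\<^esub> X"
      by (elim quot_cases) (use a b in \<open>simp add: quot_add quot_smult smult_closed smult_l_distr\<close>)
    from X show "(a \<otimes>\<^bsub>R\<^esub> b) \<odot>\<^bsub>quot M N\<^esub> X = a \<odot>\<^bsub>quot M N\<^esub> (b \<odot>\<^bsub>quot M N\<^esub> X)"
      by (elim quot_cases) (use a b in \<open>simp add: quot_smult smult_closed smult_assoc\<close>)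
  next
    fix a X Y assume a: "a \<in> carrier R" and "X \<in> carrier (quot M N)" "Y \<in> carrier (quot M N)"
    then show "a \<odot>\<^bsub>quot M N\<^esub> (X \<oplus>\<^bsub>quot M N\<^esub> Y) = a \<odot>\<^bsub>quot M N\<^esub> X \<oplus>\<^bsub>quot M N\<^esub> a \<odot>\<^bsub>quot M N\<^esub> Y"
      by (elim quot_cases) (simp add: quot_add quot_smult smult_closed smult_r_distr)
  next
    fix a X assume a: "a \<in> carrier R" and "X \<in> carrier (quot M N)"
    then show "a \<odot>\<^bsub>quot M N\<^esub> X \<in> carrier (quot M N)"
      by (elim quot_cases) (simp add: quot_smult smult_closed coset_in_quot)
  next
    fix X assume "X \<in> carrier (quot M N)"
    then show "\<one>\<^bsub>R\<^esub> \<odot>\<^bsub>quot M N\<^esub> X = X"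
      by (elim quot_cases) (simp add: quot_smult smult_one)
  qed
  ultimately show ?thesis by (intro left_module.intro R.ring_axioms)
qed

lemma coset_hom: "(\<lambda>x. N +>\<^bsub>M\<^esub> x) \<in> lmod_hom R M (quot M N)"
  by (rule lmod_homI) (simp_all add: coset_in_quot quot_add quot_smult)

end


subsection \<open>Free modules\<close>

definition basis_vec :: "('r, 'c) ring_scheme \<Rightarrow> 's \<Rightarrow> 's \<Rightarrow> 'r"
  where "basis_vec R s = (\<lambda>t. if t = s then \<one>\<^bsub>R\<^esub> else \<zero>\<^bsub>R\<^esub>)"

lemma free_lmodule_simps:
  "u \<in> carrier (free_lmodule R S) \<longleftrightarrow>
    (\<forall>s\<in>S. u s \<in> carrier R) \<and> (\<forall>s. s \<notin> S \<longrightarrow> u s = \<zero>\<^bsub>R\<^esub>) \<and> finite {s. u s \<noteq> \<zero>\<^bsub>R\<^esub>}"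
  "\<zero>\<^bsub>free_lmodule R S\<^esub> = (\<lambda>_. \<zero>\<^bsub>R\<^esub>)"
  "u \<oplus>\<^bsub>free_lmodule R S\<^esub> v = (\<lambda>s. u s \<oplus>\<^bsub>R\<^esub> v s)"
  "a \<odot>\<^bsub>free_lmodule R S\<^esub> u = (\<lambda>s. a \<otimes>\<^bsub>R\<^esub> u s)"
  by (auto simp: free_lmodule_def)

context ring
begin

lemma free_coeff_closed: "u \<in> carrier (free_lmodule R S) \<Longrightarrow> u s \<in> carrier R"
  by (cases "s \<in> S") (auto simp: free_lmodule_simps)

lemma free_closed_add:
  assumes u: "u \<in> carrier (free_lmodule R S)" and v: "v \<in> carrier (free_lmodule R S)"
  shows "(\<lambda>s. u s \<oplus> v s) \<in> carrier (free_lmodule R S)"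
proof -
  have "{s. u s \<oplus> v s \<noteq> \<zero>} \<subseteq> {s. u s \<noteq> \<zero>} \<union> {s. v s \<noteq> \<zero>}" by auto
  then have "finite {s. u s \<oplus> v s \<noteq> \<zero>}" using u v finite_subset by (auto simp: free_lmodule_simps)
  then show ?thesis using u v by (auto simp: free_lmodule_simps)
qed

lemma free_closed_smult:
  assumes a: "a \<in> carrier R" and u: "u \<in> carrier (free_lmodule R S)"
  shows "(\<lambda>s. a \<otimes> u s) \<in> carrier (free_lmodule R S)"
proof -
  have "{s. a \<otimes> u s \<noteq> \<zero>} \<subseteq> {s. u s \<noteq> \<zero>}" using a by auto
  then have "finite {s. a \<otimes> u s \<noteq> \<zero>}" using u finite_subset by (auto simp: free_lmodule_simps)
  then show ?thesis using u a by (auto simp: free_lmodule_simps)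
qed

lemma left_module_free: "left_module R (free_lmodule R S)"
proof -
  note c = free_coeff_closed
  have "abelian_group (free_lmodule R S)"
  proof (rule abelian_groupI)
    fix u assume u: "u \<in> carrier (free_lmodule R S)"
    have "(\<lambda>s. \<ominus> \<one> \<otimes> u s) \<in> carrier (free_lmodule R S)" by (rule free_closed_smult[OF _ u]) simp
    moreover have "\<ominus> \<one> \<otimes> u s \<oplus> u s = \<zero>" for s
      using c[OF u, of s] by (simp add: l_minus l_neg)
    ultimately show "\<exists>v\<in>carrier (free_lmodule R S). v \<oplus>\<^bsub>free_lmodule R S\<^esub> u = \<zero>\<^bsub>free_lmodule R S\<^esub>"
      by (intro bexI[of _ "\<lambda>s. \<ominus> \<one> \<otimes> u s"]) (simp_all add: free_lmodule_simps(2,3))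
  next
    fix u v w assume "u \<in> carrier (free_lmodule R S)" "v \<in> carrier (free_lmodule R S)"
      "w \<in> carrier (free_lmodule R S)"
    note c = this[THEN c]
    show "u \<oplus>\<^bsub>free_lmodule R S\<^esub> v \<oplus>\<^bsub>free_lmodule R S\<^esub> w =
      u \<oplus>\<^bsub>free_lmodule R S\<^esub> (v \<oplus>\<^bsub>free_lmodule R S\<^esub> w)"
      using c by (simp add: free_lmodule_simps(3) a_assoc)
  next
    fix u v assume "u \<in> carrier (free_lmodule R S)" "v \<in> carrier (free_lmodule R S)"
    note c = this[THEN c]
    show "u \<oplus>\<^bsub>free_lmodule R S\<^esub> v = v \<oplus>\<^bsub>free_lmodule R S\<^esub> u"
      using c by (simp add: free_lmodule_simps(3) a_comm)
  next
    fix u assume "u \<in> carrier (free_lmodule R S)"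
    note c = this[THEN c]
    show "\<zero>\<^bsub>free_lmodule R S\<^esub> \<oplus>\<^bsub>free_lmodule R S\<^esub> u = u"
      using c by (simp add: free_lmodule_simps(2,3))
  next
    show "\<zero>\<^bsub>free_lmodule R S\<^esub> \<in> carrier (free_lmodule R S)"
      by (simp add: free_lmodule_simps)
  qed (simp add: free_lmodule_simps(3) free_closed_add)
  then show ?thesis
    by (intro left_module.intro ring_axioms left_module_axioms.intro)
      (simp_all add: free_lmodule_simps(2,3,4) free_closed_smult l_distr r_distr m_assoc
        c[where S = S] fun_eq_iff)
qed

lemma basis_vec_closed: "s \<in> S \<Longrightarrow> basis_vec R s \<in> carrier (free_lmodule R S)"
  by (auto simp: free_lmodule_simps basis_vec_def)

lemma free_lmodule_induct [consumes 1, case_names zero add]: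
  assumes u: "u \<in> carrier (free_lmodule R S)"
    and zero: "P (\<lambda>_. \<zero>)"
    and add: "\<And>u a s. u \<in> carrier (free_lmodule R S) \<Longrightarrow> P u \<Longrightarrow> a \<in> carrier R \<Longrightarrow> s \<in> S \<Longrightarrow>
      P (u \<oplus>\<^bsub>free_lmodule R S\<^esub> a \<odot>\<^bsub>free_lmodule R S\<^esub> basis_vec R s)"
  shows "P u"
proof -
  have "P u" if "finite T" "{s. u s \<noteq> \<zero>} \<subseteq> T" "u \<in> carrier (free_lmodule R S)" for T u
    using that
  proof (induction T arbitrary: u)
    case empty
    then have "u = (\<lambda>_. \<zero>)" by auto
    then show ?case using zero by simp
  next
    case (insert t T)
    show ?case
    proof (cases "t \<in> S")
      case False
      then have "u t = \<zero>" using insert.prems(2) by (simp add: free_lmodule_simps(1))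
      then show ?thesis using insert by (intro insert.IH) auto
    next
      case True
      define v where "v = u(t := \<zero>)"
      have "finite {s. v s \<noteq> \<zero>}"
        by (rule finite_subset[of _ "{s. u s \<noteq> \<zero>}"]) (use insert.prems(2) in \<open>auto simp: v_def free_lmodule_simps(1)\<close>)
      then have v: "v \<in> carrier (free_lmodule R S)"
        using insert.prems(2) by (auto simp: v_def free_lmodule_simps(1))
      have "P v" using insert.prems(1) by (intro insert.IH v) (auto simp: v_def)
      moreover have u: "u = v \<oplus>\<^bsub>free_lmodule R S\<^esub> u t \<odot>\<^bsub>free_lmodule R S\<^esub> basis_vec R t"
        using free_coeff_closed[OF insert.prems(2)]
        by (auto simp: v_def free_lmodule_simps basis_vec_def intro!: ext)
      ultimately show ?thesis
        using add[OF v _ free_coeff_closed[OF insert.prems(2), of t] True] by (simp only: flip: u)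
    qed
  qed
  then show ?thesis using u by (auto simp: free_lmodule_simps(1))
qed

end

lemma free_hom_eqI:
  assumes "left_module R N" "f \<in> lmod_hom R (free_lmodule R S) N" "g \<in> lmod_hom R (free_lmodule R S) N"
    and "\<And>s. s \<in> S \<Longrightarrow> f (basis_vec R s) = g (basis_vec R s)" and "u \<in> carrier (free_lmodule R S)"
  shows "f u = g u"
proof -
  interpret N: left_module R N by fact
  interpret F: left_module R "free_lmodule R S" by (rule N.R.left_module_free)
  note f = lmod_homD[OF assms(2)] and g = lmod_homD[OF assms(3)]
  show ?thesis
    using assms(5)
  proof (induction u rule: N.R.free_lmodule_induct)
    case zero
    show ?case using lmod_hom_zero[OF F.left_module_axioms N.left_module_axioms assms(2)]
      lmod_hom_zero[OF F.left_module_axioms N.left_module_axioms assms(3)] by (simp add: free_lmodule_simps(2))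
  next
    case (add u a s)
    have b: "basis_vec R s \<in> carrier (free_lmodule R S)" by (rule N.R.basis_vec_closed[OF add.hyps(3)])
    show ?case using add b F.smult_closed[OF add.hyps(2) b] assms(4)
      by (simp add: f(2,3) g(2,3))
  qed
qed

context left_module
begin

lemma lin_ext_superset:
  assumes \<phi>: "\<And>s. s \<in> S \<Longrightarrow> \<phi> s \<in> carrier M" and u: "u \<in> carrier (free_lmodule R S)"
    and T: "finite T" "T \<subseteq> S" "{s. u s \<noteq> \<zero>} \<subseteq> T"
  shows "lin_ext R M \<phi> u = (\<Oplus>\<^bsub>M\<^esub>s\<in>T. u s \<odot>\<^bsub>M\<^esub> \<phi> s)"
  unfolding lin_ext_def
proof (rule M.add.finprod_mono_neutral_cong_left)
  show "(\<lambda>s. u s \<odot>\<^bsub>M\<^esub> \<phi> s) \<in> T \<rightarrow> carrier M"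
    using T \<phi> R.free_coeff_closed[OF u] by (auto intro!: smult_closed)
  show "u i \<odot>\<^bsub>M\<^esub> \<phi> i = \<zero>\<^bsub>M\<^esub>" if "i \<in> T - {s. u s \<noteq> \<zero>}" for i
    using that T \<phi> by auto
qed (use T in auto)

lemma lin_ext_hom:
  assumes \<phi>: "\<And>s. s \<in> S \<Longrightarrow> \<phi> s \<in> carrier M"
  shows "lin_ext R M \<phi> \<in> lmod_hom R (free_lmodule R S) M"
    and "s \<in> S \<Longrightarrow> lin_ext R M \<phi> (basis_vec R s) = \<phi> s"
proof -
  interpret F: left_module R "free_lmodule R S" by (rule R.left_module_free)
  have supp: "finite {s. u s \<noteq> \<zero>}" "{s. u s \<noteq> \<zero>} \<subseteq> S" if "u \<in> carrier (free_lmodule R S)" for u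
    using that by (auto simp: free_lmodule_simps(1))
  have cl: "(\<lambda>s. u s \<odot>\<^bsub>M\<^esub> \<phi> s) \<in> T \<rightarrow> carrier M" if "u \<in> carrier (free_lmodule R S)" "T \<subseteq> S" for u T
    using that \<phi> R.free_coeff_closed[OF that(1)] by (auto intro!: smult_closed)
  show "lin_ext R M \<phi> \<in> lmod_hom R (free_lmodule R S) M"
  proof (rule lmod_homI)
    fix u assume u: "u \<in> carrier (free_lmodule R S)"
    show "lin_ext R M \<phi> u \<in> carrier M" unfolding lin_ext_def by (intro M.finsum_closed cl u supp)
    fix v assume v: "v \<in> carrier (free_lmodule R S)"
    let ?T = "{s. u s \<noteq> \<zero>} \<union> {s. v s \<noteq> \<zero>}"
    have T: "finite ?T" "?T \<subseteq> S" using supp[OF u] supp[OF v] by auto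
    have "lin_ext R M \<phi> (u \<oplus>\<^bsub>free_lmodule R S\<^esub> v) = (\<Oplus>\<^bsub>M\<^esub>s\<in>?T. (u \<oplus>\<^bsub>free_lmodule R S\<^esub> v) s \<odot>\<^bsub>M\<^esub> \<phi> s)"
      by (rule lin_ext_superset[OF \<phi> F.M.a_closed[OF u v] T]) (auto simp: free_lmodule_simps(3))
    also have "\<dots> = (\<Oplus>\<^bsub>M\<^esub>s\<in>?T. u s \<odot>\<^bsub>M\<^esub> \<phi> s \<oplus>\<^bsub>M\<^esub> v s \<odot>\<^bsub>M\<^esub> \<phi> s)"
      using T \<phi> R.free_coeff_closed[OF u] R.free_coeff_closed[OF v]
      by (intro M.add.finprod_cong') (auto simp: free_lmodule_simps(3) smult_l_distr intro!: M.a_closed smult_closed)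
    also have "\<dots> = (\<Oplus>\<^bsub>M\<^esub>s\<in>?T. u s \<odot>\<^bsub>M\<^esub> \<phi> s) \<oplus>\<^bsub>M\<^esub> (\<Oplus>\<^bsub>M\<^esub>s\<in>?T. v s \<odot>\<^bsub>M\<^esub> \<phi> s)"
      by (intro M.finsum_addf cl u v T)
    also have "\<dots> = lin_ext R M \<phi> u \<oplus>\<^bsub>M\<^esub> lin_ext R M \<phi> v"
      using lin_ext_superset[of S \<phi>, OF \<phi> u T] lin_ext_superset[of S \<phi>, OF \<phi> v T] by simp
    finally show "lin_ext R M \<phi> (u \<oplus>\<^bsub>free_lmodule R S\<^esub> v) = lin_ext R M \<phi> u \<oplus>\<^bsub>M\<^esub> lin_ext R M \<phi> v" .
  next
    fix a u assume a: "a \<in> carrier R" and u: "u \<in> carrier (free_lmodule R S)"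
    let ?T = "{s. u s \<noteq> \<zero>}"
    have "lin_ext R M \<phi> (a \<odot>\<^bsub>free_lmodule R S\<^esub> u) = (\<Oplus>\<^bsub>M\<^esub>s\<in>?T. (a \<odot>\<^bsub>free_lmodule R S\<^esub> u) s \<odot>\<^bsub>M\<^esub> \<phi> s)"
      by (rule lin_ext_superset[OF \<phi> F.smult_closed[OF a u] supp[OF u]])
        (use a in \<open>auto simp: free_lmodule_simps(4)\<close>)
    also have "\<dots> = a \<odot>\<^bsub>M\<^esub> lin_ext R M \<phi> u"
    proof -
      have "(\<Oplus>\<^bsub>M\<^esub>s\<in>T. (a \<odot>\<^bsub>free_lmodule R S\<^esub> u) s \<odot>\<^bsub>M\<^esub> \<phi> s) = a \<odot>\<^bsub>M\<^esub> (\<Oplus>\<^bsub>M\<^esub>s\<in>T. u s \<odot>\<^bsub>M\<^esub> \<phi> s)"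
        if "finite T" "T \<subseteq> S" for T
        using that
      proof (induction T)
        case empty
        then show ?case using a by simp
      next
        case (insert t T)
        have 1: "(\<lambda>s. (a \<odot>\<^bsub>free_lmodule R S\<^esub> u) s \<odot>\<^bsub>M\<^esub> \<phi> s) \<in> T \<rightarrow> carrier M"
          "(a \<odot>\<^bsub>free_lmodule R S\<^esub> u) t \<odot>\<^bsub>M\<^esub> \<phi> t \<in> carrier M"
          using cl[OF F.smult_closed[OF a u], of "insert t T"] insert.prems by auto
        have 2: "(\<lambda>s. u s \<odot>\<^bsub>M\<^esub> \<phi> s) \<in> T \<rightarrow> carrier M" "u t \<odot>\<^bsub>M\<^esub> \<phi> t \<in> carrier M"
          using cl[OF u, of "insert t T"] insert.prems by auto
        have 3: "(a \<odot>\<^bsub>free_lmodule R S\<^esub> u) t \<odot>\<^bsub>M\<^esub> \<phi> t = a \<odot>\<^bsub>M\<^esub> (u t \<odot>\<^bsub>M\<^esub> \<phi> t)"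
          using a R.free_coeff_closed[OF u] \<phi> insert.prems by (simp add: free_lmodule_simps(4) smult_assoc)
        show ?case using insert 1 2 a
          by (simp add: M.finsum_insert 3 smult_r_distr M.finsum_closed)
      qed
      from this[OF supp[OF u]] show ?thesis by (simp add: lin_ext_def)
    qed
    finally show "lin_ext R M \<phi> (a \<odot>\<^bsub>free_lmodule R S\<^esub> u) = a \<odot>\<^bsub>M\<^esub> lin_ext R M \<phi> u" .
  qed
  assume s: "s \<in> S"
  have "lin_ext R M \<phi> (basis_vec R s) = (\<Oplus>\<^bsub>M\<^esub>t\<in>{s}. basis_vec R s t \<odot>\<^bsub>M\<^esub> \<phi> t)"
    by (rule lin_ext_superset[OF \<phi> R.basis_vec_closed[OF s]]) (use s in \<open>auto simp: basis_vec_def\<close>)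
  also have "\<dots> = \<phi> s" using \<phi>[OF s] by (simp add: basis_vec_def smult_one)
  finally show "lin_ext R M \<phi> (basis_vec R s) = \<phi> s" .
qed

end


subsection \<open>Lifting\<close>

text \<open>
  The splitting in the definition of \<open>projective\<close>, for a given basis.
\<close>

definition free_summand :: "('r, 'c) ring_scheme \<Rightarrow> ('r, 'm, 'z) module_scheme \<Rightarrow> 's set \<Rightarrow> bool"
  where "free_summand R M S \<longleftrightarrow>
    (\<exists>i r. i \<in> lmod_hom R M (free_lmodule R S) \<and> r \<in> lmod_hom R (free_lmodule R S) M \<and>
      (\<forall>x\<in>carrier M. r (i x) = x))"

lemma free_summand_if_projective: "projective R M \<Longrightarrow> \<exists>S. free_summand R M (S :: 'm set)"
  for M :: "('r, 'm, 'z) module_scheme"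
  by (auto simp: projective_def free_summand_def)

text \<open>
  Lift the images of the basis of the free module, extend linearly and restrict to the
  summand.
\<close>

lemma lift_through:
  assumes P: "free_summand R P S" and M: "left_module R M" and N: "left_module R N"
    and u: "u \<in> lmod_hom R P N" and v: "v \<in> lmod_hom R M N" and uv: "u ` carrier P \<subseteq> v ` carrier M"
  shows "\<exists>w\<in>lmod_hom R P M. \<forall>x\<in>carrier P. v (w x) = u x"
proof -
  interpret M: left_module R M by fact
  obtain i r where i: "i \<in> lmod_hom R P (free_lmodule R S)" and r: "r \<in> lmod_hom R (free_lmodule R S) P"
    and ri: "\<And>x. x \<in> carrier P \<Longrightarrow> r (i x) = x" using P by (auto simp: free_summand_def)
  have "\<exists>m. m \<in> carrier M \<and> v m = u (r (basis_vec R s))" if "s \<in> S" for s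
  proof -
    have "u (r (basis_vec R s)) \<in> v ` carrier M"
      using uv lmod_homD(1)[OF r M.R.basis_vec_closed[OF that]] by blast
    then show ?thesis by auto
  qed
  then have "\<forall>s\<in>S. \<exists>m. m \<in> carrier M \<and> v m = u (r (basis_vec R s))" by (intro ballI)
  from bchoice[OF this] obtain m where "\<forall>s\<in>S. m s \<in> carrier M \<and> v (m s) = u (r (basis_vec R s))" ..
  then have m: "\<And>s. s \<in> S \<Longrightarrow> m s \<in> carrier M" "\<And>s. s \<in> S \<Longrightarrow> v (m s) = u (r (basis_vec R s))"
    by simp_all
  define w' where "w' = lin_ext R M m"
  have w': "w' \<in> lmod_hom R (free_lmodule R S) M" "\<And>s. s \<in> S \<Longrightarrow> w' (basis_vec R s) = m s"
    unfolding w'_def by (rule M.lin_ext_hom[OF m(1)], assumption+)+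
  have eq: "v (w' y) = u (r y)" if "y \<in> carrier (free_lmodule R S)" for y
    by (rule free_hom_eqI[OF N lmod_hom_comp[OF w'(1) v] lmod_hom_comp[OF r u] _ that]) (simp add: w' m)
  have "(\<lambda>x. w' (i x)) \<in> lmod_hom R P M" by (rule lmod_hom_comp[OF i w'(1)])
  moreover have "v (w' (i x)) = u x" if "x \<in> carrier P" for x
    using eq[OF lmod_homD(1)[OF i that]] ri[OF that] by simp
  ultimately show ?thesis by (intro bexI[of _ "\<lambda>x. w' (i x)"] ballI)
qed

lemma (in left_module) minus_zero_right: "x \<in> carrier M \<Longrightarrow> x \<ominus>\<^bsub>M\<^esub> \<zero>\<^bsub>M\<^esub> = x"
  using M.minus_equality[of "\<zero>\<^bsub>M\<^esub>" "\<zero>\<^bsub>M\<^esub>"] by (simp add: a_minus_def)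


section \<open>Comparison of projective resolutions in low degrees\<close>

lemma a_kernel_iff: "x \<in> a_kernel M N f \<longleftrightarrow> x \<in> carrier M \<and> f x = \<zero>\<^bsub>N\<^esub>"
  by (simp add: a_kernel_def kernel_def)

lemma lift_into_kernel:
  assumes P: "free_summand R P S" and M: "left_module R M" and N: "left_module R N"
    and u: "u \<in> lmod_hom R P N" and v: "v \<in> lmod_hom R M N"
    and ker: "a_kernel N L w = v ` carrier M" and wu: "\<And>x. x \<in> carrier P \<Longrightarrow> w (u x) = \<zero>\<^bsub>L\<^esub>"
  obtains f where "f \<in> lmod_hom R P M" "\<And>x. x \<in> carrier P \<Longrightarrow> v (f x) = u x"
proof -
  have "u ` carrier P \<subseteq> v ` carrier M"
    unfolding ker[symmetric] using wu lmod_homD(1)[OF u] by (auto simp: a_kernel_iff)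
  from lift_through[OF P M N u v this] show thesis using that by blast
qed

context projective_resolution
begin

lemma left_module_P: "left_module R (P n)"
  using projective[of n] by (simp add: projective_def)

lemma \<eta>_d: "x \<in> carrier (P 1) \<Longrightarrow> \<eta> (d 0 x) = \<zero>\<^bsub>N\<^esub>"
  using exact_0 by (auto simp: a_kernel_iff set_eq_iff)

lemma d_d: "x \<in> carrier (P (Suc (Suc n))) \<Longrightarrow> d n (d (Suc n) x) = \<zero>\<^bsub>P n\<^esub>"
  using exact_Suc[of n] by (auto simp: a_kernel_iff set_eq_iff)

end

text \<open>
  The comparison theorem for projective resolutions in the degrees that determine
  \<open>Tor\<^sub>2\<close>; each map is a lift of the preceding one.
\<close>

lemma resolution_chain_map:
  fixes P :: "nat \<Rightarrow> ('r, 'p) module" and P' :: "nat \<Rightarrow> ('r, 'q) module"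
  assumes P: "projective_resolution R N P d \<eta>" and P': "projective_resolution R N P' d' \<eta>'"
  obtains f0 f1 f2 where
    "f0 \<in> lmod_hom R (P 0) (P' 0)" "f1 \<in> lmod_hom R (P 1) (P' 1)" "f2 \<in> lmod_hom R (P 2) (P' 2)"
    "\<And>x. x \<in> carrier (P 0) \<Longrightarrow> \<eta>' (f0 x) = \<eta> x"
    "\<And>x. x \<in> carrier (P 1) \<Longrightarrow> d' 0 (f1 x) = f0 (d 0 x)"
    "\<And>x. x \<in> carrier (P 2) \<Longrightarrow> d' 1 (f2 x) = f1 (d 1 x)"
proof -
  interpret P: projective_resolution R N P d \<eta> by fact
  interpret P': projective_resolution R N P' d' \<eta>' by fact
  have S: "\<exists>S. free_summand R (P n) (S :: 'p set)" for n by (rule free_summand_if_projective[OF P.projective])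
  obtain S0 S1 S2 :: "'p set" where S: "free_summand R (P 0) S0" "free_summand R (P 1) S1" "free_summand R (P 2) S2"
    using S[of 0] S[of 1] S[of 2] by blast
  obtain f0 where f0: "f0 \<in> lmod_hom R (P 0) (P' 0)" "\<And>x. x \<in> carrier (P 0) \<Longrightarrow> \<eta>' (f0 x) = \<eta> x"
  proof -
    have "\<eta> ` carrier (P 0) \<subseteq> \<eta>' ` carrier (P' 0)" by (simp add: P.surjective P'.surjective)
    from lift_through[OF S(1) P'.left_module_P P.left_module_axioms P.augmentation P'.augmentation this]
    show thesis using that by blast
  qed
  have d: "d 0 \<in> lmod_hom R (P 1) (P 0)" "d' 0 \<in> lmod_hom R (P' 1) (P' 0)"
    "d 1 \<in> lmod_hom R (P 2) (P 1)" "d' 1 \<in> lmod_hom R (P' 2) (P' 1)"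
    using P.differential[of 0] P'.differential[of 0] P.differential[of 1] P'.differential[of 1]
    by (simp_all add: numeral_2_eq_2)
  obtain f1 where f1: "f1 \<in> lmod_hom R (P 1) (P' 1)" "\<And>x. x \<in> carrier (P 1) \<Longrightarrow> d' 0 (f1 x) = f0 (d 0 x)"
  proof (rule lift_into_kernel[OF S(2) P'.left_module_P P'.left_module_P lmod_hom_comp[OF d(1) f0(1)] d(2) P'.exact_0])
    fix x assume x: "x \<in> carrier (P 1)"
    then show "\<eta>' (f0 (d 0 x)) = \<zero>\<^bsub>N\<^esub>"
      using f0(2)[OF lmod_homD(1)[OF d(1) x]] P.\<eta>_d[OF x] by simp
  qed (rule that)
  have ex: "a_kernel (P' 1) (P' 0) (d' 0) = d' 1 ` carrier (P' 2)"
    using P'.exact_Suc[of 0] by (simp add: numeral_2_eq_2)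
  obtain f2 where f2: "f2 \<in> lmod_hom R (P 2) (P' 2)" "\<And>x. x \<in> carrier (P 2) \<Longrightarrow> d' 1 (f2 x) = f1 (d 1 x)"
  proof (rule lift_into_kernel[OF S(3) P'.left_module_P P'.left_module_P lmod_hom_comp[OF d(3) f1(1)] d(4) ex])
    fix x assume x: "x \<in> carrier (P 2)"
    have "d 0 (d 1 x) = \<zero>\<^bsub>P 0\<^esub>" using P.d_d[of x 0] x by (simp add: numeral_2_eq_2)
    then show "d' 0 (f1 (d 1 x)) = \<zero>\<^bsub>P' 0\<^esub>"
      using f1(2)[OF lmod_homD(1)[OF d(3) x]] lmod_hom_zero[OF P.left_module_P P'.left_module_P f0(1)] by simp
  qed (rule that)
  show thesis by (rule that[OF f0(1) f1(1) f2(1) f0(2) f1(2) f2(2)])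
qed

text \<open>
  An endomorphism of a resolution over the identity is homotopic to the identity. The
  homotopy is built degree by degree, by lifting what the previous component leaves
  over, and the conclusion is its equation in degree two.
\<close>

lemma resolution_homotopy:
  fixes P :: "nat \<Rightarrow> ('r, 'p) module"
  assumes P: "projective_resolution R N P d \<eta>"
    and f: "f0 \<in> lmod_hom R (P 0) (P 0)" "f1 \<in> lmod_hom R (P 1) (P 1)" "f2 \<in> lmod_hom R (P 2) (P 2)"
    and f0: "\<And>x. x \<in> carrier (P 0) \<Longrightarrow> \<eta> (f0 x) = \<eta> x"
    and f1: "\<And>x. x \<in> carrier (P 1) \<Longrightarrow> d 0 (f1 x) = f0 (d 0 x)"
    and f2: "\<And>x. x \<in> carrier (P 2) \<Longrightarrow> d 1 (f2 x) = f1 (d 1 x)"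
  obtains h1 h2 where "h1 \<in> lmod_hom R (P 1) (P 2)" "h2 \<in> lmod_hom R (P 2) (P 3)"
    "\<And>x. x \<in> carrier (P 2) \<Longrightarrow> d 2 (h2 x) = (f2 x \<ominus>\<^bsub>P 2\<^esub> x) \<ominus>\<^bsub>P 2\<^esub> h1 (d 1 x)"
proof -
  interpret P: projective_resolution R N P d \<eta> by fact
  have S: "\<exists>S. free_summand R (P n) (S :: 'p set)" for n by (rule free_summand_if_projective[OF P.projective])
  obtain S0 S1 S2 :: "'p set" where S: "free_summand R (P 0) S0" "free_summand R (P 1) S1" "free_summand R (P 2) S2"
    using S[of 0] S[of 1] S[of 2] by blast
  have d: "d 0 \<in> lmod_hom R (P 1) (P 0)" "d 1 \<in> lmod_hom R (P 2) (P 1)" "d 2 \<in> lmod_hom R (P 3) (P 2)"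
    using P.differential[of 0] P.differential[of 1] P.differential[of 2]
    by (simp_all add: numeral_2_eq_2 numeral_3_eq_3)
  have ex: "a_kernel (P 1) (P 0) (d 0) = d 1 ` carrier (P 2)" "a_kernel (P 2) (P 1) (d 1) = d 2 ` carrier (P 3)"
    using P.exact_Suc[of 0] P.exact_Suc[of 1] by (simp_all add: numeral_2_eq_2 numeral_3_eq_3)
  have d01: "d 0 (d 1 x) = \<zero>\<^bsub>P 0\<^esub>" if "x \<in> carrier (P 2)" for x
    using P.d_d[of x 0] that by (simp add: numeral_2_eq_2)
  interpret P0: left_module R "P 0" by (rule P.left_module_P)
  interpret P1: left_module R "P 1" by (rule P.left_module_P)
  interpret P2: left_module R "P 2" by (rule P.left_module_P)
  note lm = P.left_module_P
  have self: "x \<ominus>\<^bsub>M\<^esub> x = \<zero>\<^bsub>M\<^esub>" if "left_module R M" "x \<in> carrier M" for x and M :: "('r, 'q, 'y) module_scheme"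
  proof -
    interpret left_module R M by (rule that)
    show ?thesis using that(2) by (simp add: a_minus_def M.r_neg)
  qed
  define u0 where "u0 = (\<lambda>x. f0 x \<ominus>\<^bsub>P 0\<^esub> x)"
  have u0: "u0 \<in> lmod_hom R (P 0) (P 0)"
    unfolding u0_def by (rule lmod_hom_diff[OF lm f(1) lmod_hom_id])
  obtain h0 where h0: "h0 \<in> lmod_hom R (P 0) (P 1)" "\<And>x. x \<in> carrier (P 0) \<Longrightarrow> d 0 (h0 x) = u0 x"
  proof (rule lift_into_kernel[OF S(1) lm lm u0 d(1) P.exact_0])
    fix x assume x: "x \<in> carrier (P 0)"
    have "\<eta> x \<in> carrier N" by (rule lmod_homD(1)[OF P.augmentation x])
    then show "\<eta> (u0 x) = \<zero>\<^bsub>N\<^esub>"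
      using lmod_hom_minus[OF lm P.left_module_axioms P.augmentation lmod_homD(1)[OF f(1) x] x]
      by (simp add: u0_def f0[OF x] self[OF P.left_module_axioms])
  qed (rule that)
  define u1 where "u1 = (\<lambda>x. (f1 x \<ominus>\<^bsub>P 1\<^esub> x) \<ominus>\<^bsub>P 1\<^esub> h0 (d 0 x))"
  have u1': "(\<lambda>x. f1 x \<ominus>\<^bsub>P 1\<^esub> x) \<in> lmod_hom R (P 1) (P 1)"
    by (rule lmod_hom_diff[OF lm f(2) lmod_hom_id])
  have u1: "u1 \<in> lmod_hom R (P 1) (P 1)"
    unfolding u1_def by (rule lmod_hom_diff[OF lm u1' lmod_hom_comp[OF d(1) h0(1)]])
  obtain h1 where h1: "h1 \<in> lmod_hom R (P 1) (P 2)" "\<And>x. x \<in> carrier (P 1) \<Longrightarrow> d 1 (h1 x) = u1 x"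
  proof (rule lift_into_kernel[OF S(2) lm lm u1 d(2) ex(1)])
    fix x assume x: "x \<in> carrier (P 1)"
    note dx = lmod_homD(1)[OF d(1) x]
    have "d 0 (u1 x) = (d 0 (f1 x) \<ominus>\<^bsub>P 0\<^esub> d 0 x) \<ominus>\<^bsub>P 0\<^esub> d 0 (h0 (d 0 x))"
      unfolding u1_def
      by (simp only: lmod_hom_minus[OF lm lm d(1) lmod_homD(1)[OF u1' x] lmod_homD(1)[OF h0(1) dx]]
        lmod_hom_minus[OF lm lm d(1) lmod_homD(1)[OF f(2) x] x])
    also have "\<dots> = u0 (d 0 x) \<ominus>\<^bsub>P 0\<^esub> u0 (d 0 x)"
      by (simp add: h0(2)[OF dx] u0_def f1[OF x])
    also have "\<dots> = \<zero>\<^bsub>P 0\<^esub>" by (rule self[OF lm lmod_homD(1)[OF u0 dx]])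
    finally show "d 0 (u1 x) = \<zero>\<^bsub>P 0\<^esub>" .
  qed (rule that)
  define u2 where "u2 = (\<lambda>x. (f2 x \<ominus>\<^bsub>P 2\<^esub> x) \<ominus>\<^bsub>P 2\<^esub> h1 (d 1 x))"
  have u2': "(\<lambda>x. f2 x \<ominus>\<^bsub>P 2\<^esub> x) \<in> lmod_hom R (P 2) (P 2)"
    by (rule lmod_hom_diff[OF lm f(3) lmod_hom_id])
  have u2: "u2 \<in> lmod_hom R (P 2) (P 2)"
    unfolding u2_def by (rule lmod_hom_diff[OF lm u2' lmod_hom_comp[OF d(2) h1(1)]])
  obtain h2 where h2: "h2 \<in> lmod_hom R (P 2) (P 3)" "\<And>x. x \<in> carrier (P 2) \<Longrightarrow> d 2 (h2 x) = u2 x"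
  proof (rule lift_into_kernel[OF S(3) lm lm u2 d(3) ex(2)])
    fix x assume x: "x \<in> carrier (P 2)"
    note dx = lmod_homD(1)[OF d(2) x]
    have "d 1 (u2 x) = (d 1 (f2 x) \<ominus>\<^bsub>P 1\<^esub> d 1 x) \<ominus>\<^bsub>P 1\<^esub> d 1 (h1 (d 1 x))"
      unfolding u2_def
      by (simp only: lmod_hom_minus[OF lm lm d(2) lmod_homD(1)[OF u2' x] lmod_homD(1)[OF h1(1) dx]]
        lmod_hom_minus[OF lm lm d(2) lmod_homD(1)[OF f(3) x] x])
    also have "d 1 (h1 (d 1 x)) = f1 (d 1 x) \<ominus>\<^bsub>P 1\<^esub> d 1 x"
    proof -
      have "d 1 (h1 (d 1 x)) = (f1 (d 1 x) \<ominus>\<^bsub>P 1\<^esub> d 1 x) \<ominus>\<^bsub>P 1\<^esub> h0 (\<zero>\<^bsub>P 0\<^esub>)"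
        by (simp only: h1(2)[OF dx] u1_def d01[OF x])
      also have "h0 (\<zero>\<^bsub>P 0\<^esub>) = \<zero>\<^bsub>P 1\<^esub>" by (rule lmod_hom_zero[OF lm lm h0(1)])
      finally show ?thesis
        using P1.minus_zero_right[OF lmod_homD(1)[OF u1' dx]] by simp
    qed
    also have "(d 1 (f2 x) \<ominus>\<^bsub>P 1\<^esub> d 1 x) \<ominus>\<^bsub>P 1\<^esub> (f1 (d 1 x) \<ominus>\<^bsub>P 1\<^esub> d 1 x) = \<zero>\<^bsub>P 1\<^esub>"
      unfolding f2[OF x] by (rule self[OF lm lmod_homD(1)[OF u1' dx]])
    finally show "d 1 (u2 x) = \<zero>\<^bsub>P 1\<^esub>" .
  qed (rule that)
  show thesis by (rule that[OF h1(1) h2(1)]) (simp only: h2(2) u2_def)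
qed


section \<open>Tensor products with the trivial module\<close>

lemma ground_simps [simp]:
  "carrier ground = UNIV" "mult ground = (*)" "one ground = 1" "zero ground = 0"
  "add ground = (+)" "smult ground = (*)"
  by (simp_all add: ground_def)

lemma ring_ground: "ring ground"
  using cring_ground by (rule cring.axioms)

lemma delta_eq_basis_vec: "delta s = basis_vec ground s"
  by (auto simp: delta_def basis_vec_def)

lemma free_ground_minus:
  assumes "u \<in> carrier (free_lmodule ground S)" "v \<in> carrier (free_lmodule ground S)"
  shows "u \<ominus>\<^bsub>free_lmodule ground S\<^esub> v = (\<lambda>t. u t - v t :: 'k::field)"
proof -
  interpret G: ring "ground :: ('k, 'k) module" by (rule ring_ground)
  interpret F: left_module "ground :: ('k, 'k) module" "free_lmodule ground S" by (rule G.left_module_free)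
  have "(\<lambda>t. - 1 * v t) \<in> carrier (free_lmodule ground S)"
    using F.smult_closed[OF _ assms(2), of "- 1"] by (simp add: free_lmodule_simps(4))
  then have "\<ominus>\<^bsub>free_lmodule ground S\<^esub> v = (\<lambda>t. - v t)"
    using assms(2) by (intro F.M.minus_equality) (simp_all add: free_lmodule_simps(2,3))
  then show ?thesis by (simp add: a_minus_def free_lmodule_simps(3))
qed

lemma submodule_span:
  assumes M: "left_module R M" and X: "X \<subseteq> carrier M"
  shows "submodule (submodule_span R M X) R M" and "X \<subseteq> submodule_span R M X"
    and "submodule H R M \<Longrightarrow> X \<subseteq> H \<Longrightarrow> submodule_span R M X \<subseteq> H"
proof -
  interpret M: left_module R M by fact
  have c: "submodule (carrier M) R M" unfolding submodule_iff[OF M] by (auto intro: M.smult_closed)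
  show "submodule (submodule_span R M X) R M"
    unfolding submodule_iff[OF M]
  proof (intro conjI ballI)
    show "submodule_span R M X \<subseteq> carrier M" using c X by (auto simp: submodule_span_def)
  qed (auto simp: submodule_span_def submodule_iff[OF M])
  show "X \<subseteq> submodule_span R M X" by (auto simp: submodule_span_def)
  show "submodule H R M \<Longrightarrow> X \<subseteq> H \<Longrightarrow> submodule_span R M X \<subseteq> H" by (auto simp: submodule_span_def)
qed

lemma aug_module_simps [simp]:
  "carrier (aug_module \<epsilon>) = UNIV" "zero (aug_module \<epsilon>) = 0" "add (aug_module \<epsilon>) = (+)"
  "smult (aug_module \<epsilon>) = (\<lambda>b c. \<epsilon> b * c)"
  by (simp_all add: aug_module_def)

text \<open>
  The tensor product of the trivial right module with a left module \<open>N\<close>.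
\<close>

locale aug_tensor = augmented_algebra B \<epsilon> + N: left_module B N
  for B :: "('k::field, 'b, 'z) module_scheme" and \<epsilon> :: "'b \<Rightarrow> 'k" and N :: "('b, 'n) module"
begin

abbreviation pairs :: "('k, 'k \<times> 'n \<Rightarrow> 'k) module"
  where "pairs \<equiv> free_lmodule ground (UNIV \<times> carrier N)"

abbreviation tensor_null :: "('k \<times> 'n \<Rightarrow> 'k) set"
  where "tensor_null \<equiv> tensor_zero B (aug_module \<epsilon>) N"

abbreviation pure :: "'k \<Rightarrow> 'n \<Rightarrow> ('k \<times> 'n \<Rightarrow> 'k) set"
  where "pure \<equiv> pure_tensor B (aug_module \<epsilon>) N"

lemma aug_scalar: "\<epsilon> (c \<odot>\<^bsub>B\<^esub> \<one>\<^bsub>B\<^esub>) = c"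
proof -
  have "\<epsilon> \<in> ring_hom B ground" "\<epsilon> \<in> lmod_hom ground B ground" using augmentation by (auto simp: alg_hom_def)
  then show ?thesis by (simp add: lmod_homD(3) ring_hom_one)
qed

lemma left_module_pairs: "left_module ground pairs"
  by (rule ring.left_module_free[OF ring_ground])

lemma tensor_relations_closed: "tensor_relations B (aug_module \<epsilon>) N \<subseteq> carrier pairs"
proof -
  interpret F: left_module ground pairs by (rule left_module_pairs)
  have b: "basis_vec ground (m, n) \<in> carrier pairs" if "n \<in> carrier N" for m n
    by (rule ring.basis_vec_closed[OF ring_ground]) (use that in simp)
  have diff: "(\<lambda>t. u t - v t) \<in> carrier pairs" if "u \<in> carrier pairs" "v \<in> carrier pairs" for u v
    using F.M.minus_closed[OF that] free_ground_minus[OF that] by simp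
  have sm: "(\<lambda>t. c * u t) \<in> carrier pairs" if "u \<in> carrier pairs" for c u
    using F.smult_closed[OF _ that, of c] by (simp add: free_lmodule_simps(4))
  show ?thesis unfolding tensor_relations_def delta_eq_basis_vec
    by (auto intro!: diff sm b N.smult_closed)
qed

sublocale T: submodule_quotient ground pairs tensor_null
  by (intro submodule_quotient.intro submodule_quotient_axioms.intro left_module_pairs)
     (simp add: tensor_zero_def submodule_span(1)[OF left_module_pairs tensor_relations_closed])

lemma tensor_eq: "tensor B (aug_module \<epsilon>) N = quot pairs tensor_null"
  by (simp add: tensor_def)

lemma left_module_tensor: "left_module ground (tensor B (aug_module \<epsilon>) N)"
  unfolding tensor_eq by (rule T.left_module_quot)

lemma basis_pair_closed: "n \<in> carrier N \<Longrightarrow> basis_vec ground (m, n) \<in> carrier pairs"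
  by (rule ring.basis_vec_closed[OF ring_ground]) simp

lemma pure_eq: "pure m n = tensor_null +>\<^bsub>pairs\<^esub> basis_vec ground (m, n)"
  by (simp add: pure_tensor_def delta_eq_basis_vec)

text \<open>
  The maps on pairs that factor through the tensor product.
\<close>

definition balanced :: "('k, 'v, 'y) module_scheme \<Rightarrow> ('k \<times> 'n \<Rightarrow> 'v) \<Rightarrow> bool"
  where "balanced V \<beta> \<longleftrightarrow> (\<forall>m. \<forall>n\<in>carrier N. \<beta> (m, n) \<in> carrier V) \<and>
    (\<forall>m m'. \<forall>n\<in>carrier N. \<beta> (m + m', n) = \<beta> (m, n) \<oplus>\<^bsub>V\<^esub> \<beta> (m', n)) \<and>
    (\<forall>m. \<forall>n\<in>carrier N. \<forall>n'\<in>carrier N. \<beta> (m, n \<oplus>\<^bsub>N\<^esub> n') = \<beta> (m, n) \<oplus>\<^bsub>V\<^esub> \<beta> (m, n')) \<and>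
    (\<forall>b\<in>carrier B. \<forall>m. \<forall>n\<in>carrier N. \<beta> (\<epsilon> b * m, n) = \<beta> (m, b \<odot>\<^bsub>N\<^esub> n)) \<and>
    (\<forall>c m. \<forall>n\<in>carrier N. \<beta> (c * m, n) = c \<odot>\<^bsub>V\<^esub> \<beta> (m, n))"

lemma balancedD:
  assumes "balanced V \<beta>"
  shows "n \<in> carrier N \<Longrightarrow> \<beta> (m, n) \<in> carrier V"
    "n \<in> carrier N \<Longrightarrow> \<beta> (m + m', n) = \<beta> (m, n) \<oplus>\<^bsub>V\<^esub> \<beta> (m', n)"
    "n \<in> carrier N \<Longrightarrow> n' \<in> carrier N \<Longrightarrow> \<beta> (m, n \<oplus>\<^bsub>N\<^esub> n') = \<beta> (m, n) \<oplus>\<^bsub>V\<^esub> \<beta> (m, n')"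
    "b \<in> carrier B \<Longrightarrow> n \<in> carrier N \<Longrightarrow> \<beta> (\<epsilon> b * m, n) = \<beta> (m, b \<odot>\<^bsub>N\<^esub> n)"
    "n \<in> carrier N \<Longrightarrow> \<beta> (c * m, n) = c \<odot>\<^bsub>V\<^esub> \<beta> (m, n)"
proof -
  note a = assms[unfolded balanced_def]
  show "n \<in> carrier N \<Longrightarrow> \<beta> (m, n) \<in> carrier V"
    using a[THEN conjunct1] by simp
  show "n \<in> carrier N \<Longrightarrow> \<beta> (m + m', n) = \<beta> (m, n) \<oplus>\<^bsub>V\<^esub> \<beta> (m', n)"
    using a[THEN conjunct2, THEN conjunct1] by simp
  show "n \<in> carrier N \<Longrightarrow> n' \<in> carrier N \<Longrightarrow> \<beta> (m, n \<oplus>\<^bsub>N\<^esub> n') = \<beta> (m, n) \<oplus>\<^bsub>V\<^esub> \<beta> (m, n')"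
    using a[THEN conjunct2, THEN conjunct2, THEN conjunct1] by simp
  show "b \<in> carrier B \<Longrightarrow> n \<in> carrier N \<Longrightarrow> \<beta> (\<epsilon> b * m, n) = \<beta> (m, b \<odot>\<^bsub>N\<^esub> n)"
    using a[THEN conjunct2, THEN conjunct2, THEN conjunct2, THEN conjunct1] by simp
  show "n \<in> carrier N \<Longrightarrow> \<beta> (c * m, n) = c \<odot>\<^bsub>V\<^esub> \<beta> (m, n)"
    using a[THEN conjunct2, THEN conjunct2, THEN conjunct2, THEN conjunct2] by simp
qed

lemma lin_ext_tensor_null:
  assumes V: "left_module ground V" and \<beta>: "balanced V \<beta>" and u: "u \<in> tensor_null"
  shows "lin_ext ground V \<beta> u = \<zero>\<^bsub>V\<^esub>"
proof -
  interpret V: left_module ground V by fact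
  have \<beta>c: "\<And>s. s \<in> UNIV \<times> carrier N \<Longrightarrow> \<beta> s \<in> carrier V" using balancedD(1)[OF \<beta>] by auto
  note hom = V.lin_ext_hom(1)[of "UNIV \<times> carrier N" \<beta>, OF \<beta>c]
  note base = V.lin_ext_hom(2)[of "UNIV \<times> carrier N" \<beta>, OF \<beta>c]
  let ?F = "lin_ext ground V \<beta>"
  let ?H = "{u \<in> carrier pairs. ?F u = \<zero>\<^bsub>V\<^esub>}"
  have b: "basis_vec ground (m, n) \<in> carrier pairs" "?F (basis_vec ground (m, n)) = \<beta> (m, n)"
    if "n \<in> carrier N" for m n
    using basis_pair_closed[OF that] base[of "(m, n)"] that by simp_all
  have diff: "(\<lambda>t. u t - v t) \<in> carrier pairs" "?F (\<lambda>t. u t - v t) = ?F u \<ominus>\<^bsub>V\<^esub> ?F v"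
    if "u \<in> carrier pairs" "v \<in> carrier pairs" for u v
    using T.M.minus_closed[OF that] free_ground_minus[OF that]
      lmod_hom_minus[OF left_module_pairs V hom that] by simp_all
  have sm: "(\<lambda>t. c * u t) \<in> carrier pairs" "?F (\<lambda>t. c * u t) = c \<odot>\<^bsub>V\<^esub> ?F u" if "u \<in> carrier pairs" for c u
    using T.smult_closed[OF _ that, of c] lmod_homD(3)[OF hom _ that, of c] by (simp_all add: free_lmodule_simps(4))
  have cancel2: "x \<ominus>\<^bsub>V\<^esub> x = \<zero>\<^bsub>V\<^esub>" if "x \<in> carrier V" for x
    using that by (simp add: a_minus_def V.M.r_neg)
  have cancel: "x \<oplus>\<^bsub>V\<^esub> y \<ominus>\<^bsub>V\<^esub> x \<ominus>\<^bsub>V\<^esub> y = \<zero>\<^bsub>V\<^esub>"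
    if "x \<in> carrier V" "y \<in> carrier V" for x y
  proof -
    have "x \<oplus>\<^bsub>V\<^esub> y \<ominus>\<^bsub>V\<^esub> x = y"
      using that V.M.a_comm[of "x \<oplus>\<^bsub>V\<^esub> y" "\<ominus>\<^bsub>V\<^esub> x"] by (simp add: a_minus_def V.M.r_neg1)
    then show "x \<oplus>\<^bsub>V\<^esub> y \<ominus>\<^bsub>V\<^esub> x \<ominus>\<^bsub>V\<^esub> y = \<zero>\<^bsub>V\<^esub>"
      using that by (simp_all add: a_minus_def V.M.r_neg)
  qed
  have H: "submodule ?H ground pairs"
    unfolding submodule_iff[OF left_module_pairs]
    using lmod_hom_zero[OF left_module_pairs V hom] lmod_homD[OF hom] T.smult_closed by auto
  have "tensor_relations B (aug_module \<epsilon>) N \<subseteq> ?H"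
    unfolding tensor_relations_def delta_eq_basis_vec
    by (auto simp: diff sm b N.smult_closed aug_scalar balancedD(1,2,3,5)[OF \<beta>]
        balancedD(4)[OF \<beta>, symmetric] V.smult_closed cancel cancel2)
  then show ?thesis
    using submodule_span(3)[OF left_module_pairs tensor_relations_closed H] u by (auto simp: tensor_zero_def)
qed

lemma lin_ext_coset:
  assumes V: "left_module ground V" and \<beta>: "balanced V \<beta>" and x: "x \<in> carrier pairs"
  shows "the_elem (lin_ext ground V \<beta> ` (tensor_null +>\<^bsub>pairs\<^esub> x)) = lin_ext ground V \<beta> x"
proof -
  interpret V: left_module ground V by fact
  have \<beta>c: "\<And>s. s \<in> UNIV \<times> carrier N \<Longrightarrow> \<beta> s \<in> carrier V" using balancedD(1)[OF \<beta>] by auto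
  note hom = V.lin_ext_hom(1)[of "UNIV \<times> carrier N" \<beta>, OF \<beta>c]
  have "lin_ext ground V \<beta> y = lin_ext ground V \<beta> x" if "y \<in> tensor_null +>\<^bsub>pairs\<^esub> x" for y
  proof -
    obtain z where z: "z \<in> tensor_null" "y = z \<oplus>\<^bsub>pairs\<^esub> x" using \<open>y \<in> _\<close> by (auto simp: a_r_coset_def')
    have "z \<in> carrier pairs" using z T.submodule_closed by auto
    then show ?thesis using lmod_homD(2)[OF hom _ x] lmod_homD(1)[OF hom x] lin_ext_tensor_null[OF V \<beta> z(1)] z(2)
      by simp
  qed
  moreover have "tensor_null +>\<^bsub>pairs\<^esub> x \<noteq> {}"
    using T.N.a_rcos_self[OF x] by (rule ex_in_conv[THEN iffD1, OF exI])
  ultimately show ?thesis by (rule the_elem_image_unique[rotated])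
qed

text \<open>
  The universal property of the tensor product, in the form in which \<open>tensor_map\<close> uses
  it.
\<close>

lemma tensor_ext:
  assumes V: "left_module ground V" and \<beta>: "balanced V \<beta>"
  shows "(\<lambda>X. the_elem (lin_ext ground V \<beta> ` X)) \<in> lmod_hom ground (tensor B (aug_module \<epsilon>) N) V"
    and "n \<in> carrier N \<Longrightarrow> the_elem (lin_ext ground V \<beta> ` pure m n) = \<beta> (m, n)"
proof -
  interpret V: left_module ground V by fact
  have \<beta>c: "\<And>s. s \<in> UNIV \<times> carrier N \<Longrightarrow> \<beta> s \<in> carrier V" using balancedD(1)[OF \<beta>] by auto
  note hom = V.lin_ext_hom(1)[of "UNIV \<times> carrier N" \<beta>, OF \<beta>c]
  note base = V.lin_ext_hom(2)[of "UNIV \<times> carrier N" \<beta>, OF \<beta>c]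
  note c = lin_ext_coset[OF V \<beta>]
  show "(\<lambda>X. the_elem (lin_ext ground V \<beta> ` X)) \<in> lmod_hom ground (tensor B (aug_module \<epsilon>) N) V"
    unfolding tensor_eq
  proof (rule lmod_homI)
    fix X Y assume "X \<in> carrier (quot pairs tensor_null)" "Y \<in> carrier (quot pairs tensor_null)"
    then show "the_elem (lin_ext ground V \<beta> ` (X \<oplus>\<^bsub>quot pairs tensor_null\<^esub> Y)) =
      the_elem (lin_ext ground V \<beta> ` X) \<oplus>\<^bsub>V\<^esub> the_elem (lin_ext ground V \<beta> ` Y)"
      by (elim T.quot_cases) (simp add: T.quot_add c lmod_homD[OF hom])
  next
    fix X assume "X \<in> carrier (quot pairs tensor_null)"
    then show "the_elem (lin_ext ground V \<beta> ` X) \<in> carrier V"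
      by (elim T.quot_cases) (simp add: c lmod_homD[OF hom])
  next
    fix a :: 'k and X assume "X \<in> carrier (quot pairs tensor_null)"
    then show "the_elem (lin_ext ground V \<beta> ` (a \<odot>\<^bsub>quot pairs tensor_null\<^esub> X)) =
      a \<odot>\<^bsub>V\<^esub> the_elem (lin_ext ground V \<beta> ` X)"
      by (elim T.quot_cases) (simp add: T.quot_smult c lmod_homD[OF hom] T.smult_closed)
  qed
  show "n \<in> carrier N \<Longrightarrow> the_elem (lin_ext ground V \<beta> ` pure m n) = \<beta> (m, n)"
    unfolding pure_eq by (simp add: c basis_pair_closed base)
qed

lemma pure_closed: "n \<in> carrier N \<Longrightarrow> pure m n \<in> carrier (tensor B (aug_module \<epsilon>) N)"
  unfolding pure_eq tensor_eq by (rule T.coset_in_quot) (rule basis_pair_closed)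

lemma tensor_nullI:
  assumes "n \<in> carrier N"
  shows "(\<lambda>t. basis_vec ground (m + m', n) t - basis_vec ground (m, n) t - basis_vec ground (m', n) t) \<in> tensor_null"
    "n' \<in> carrier N \<Longrightarrow>
      (\<lambda>t. basis_vec ground (m, n \<oplus>\<^bsub>N\<^esub> n') t - basis_vec ground (m, n) t - basis_vec ground (m, n') t) \<in> tensor_null"
    "b \<in> carrier B \<Longrightarrow>
      (\<lambda>t. basis_vec ground (\<epsilon> b * m, n) t - basis_vec ground (m, b \<odot>\<^bsub>N\<^esub> n) t) \<in> tensor_null"
    "(\<lambda>t. basis_vec ground (c * m, n) t - c * basis_vec ground (m, n) t) \<in> tensor_null"
proof -
  let ?R = "tensor_relations B (aug_module \<epsilon>) N"
  have null: "u \<in> tensor_null" if "u \<in> ?R" for u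
    unfolding tensor_zero_def aug_module_simps
    by (rule subsetD[OF submodule_span(2)[OF left_module_pairs tensor_relations_closed] that])
  show "(\<lambda>t. basis_vec ground (m + m', n) t - basis_vec ground (m, n) t - basis_vec ground (m', n) t) \<in> tensor_null"
    by (rule null, unfold tensor_relations_def delta_eq_basis_vec aug_module_simps,
        rule UnI1, rule UnI1, rule UnI1, rule CollectI,
        rule exI[of _ m], rule exI[of _ m'], rule exI[of _ n]) (use assms in simp)
  show "(\<lambda>t. basis_vec ground (m, n \<oplus>\<^bsub>N\<^esub> n') t - basis_vec ground (m, n) t - basis_vec ground (m, n') t) \<in> tensor_null"
    if "n' \<in> carrier N"
    by (rule null, unfold tensor_relations_def delta_eq_basis_vec aug_module_simps,
        rule UnI1, rule UnI1, rule UnI2, rule CollectI,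
        rule exI[of _ m], rule exI[of _ n], rule exI[of _ n']) (use assms that in simp)
  show "(\<lambda>t. basis_vec ground (\<epsilon> b * m, n) t - basis_vec ground (m, b \<odot>\<^bsub>N\<^esub> n) t) \<in> tensor_null"
    if "b \<in> carrier B"
    by (rule null, unfold tensor_relations_def delta_eq_basis_vec aug_module_simps,
        rule UnI1, rule UnI2, rule CollectI,
        rule exI[of _ b], rule exI[of _ m], rule exI[of _ n]) (use assms that in simp)
  show "(\<lambda>t. basis_vec ground (c * m, n) t - c * basis_vec ground (m, n) t) \<in> tensor_null"
    by (rule null, unfold tensor_relations_def delta_eq_basis_vec aug_module_simps,
        rule UnI2, rule CollectI,
        rule exI[of _ c], rule exI[of _ m], rule exI[of _ n]) (use assms in \<open>simp add: aug_scalar\<close>)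
qed

lemma pure_simps:
  assumes n: "n \<in> carrier N"
  shows "pure (m + m') n = pure m n \<oplus>\<^bsub>tensor B (aug_module \<epsilon>) N\<^esub> pure m' n"
    "n' \<in> carrier N \<Longrightarrow>
      pure m (n \<oplus>\<^bsub>N\<^esub> n') = pure m n \<oplus>\<^bsub>tensor B (aug_module \<epsilon>) N\<^esub> pure m n'"
    "b \<in> carrier B \<Longrightarrow> pure m (b \<odot>\<^bsub>N\<^esub> n) = pure (\<epsilon> b * m) n"
    "pure (c * m) n = c \<odot>\<^bsub>tensor B (aug_module \<epsilon>) N\<^esub> pure m n"
proof -
  note b = basis_pair_closed
  have sum: "tensor_null +>\<^bsub>pairs\<^esub> u = (tensor_null +>\<^bsub>pairs\<^esub> v) \<oplus>\<^bsub>quot pairs tensor_null\<^esub> (tensor_null +>\<^bsub>pairs\<^esub> w)"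
    if uvw: "(\<lambda>t. u t - v t - w t) \<in> tensor_null" "u \<in> carrier pairs"
      "v \<in> carrier pairs" "w \<in> carrier pairs" for u v w
  proof -
    have "u \<ominus>\<^bsub>pairs\<^esub> (v \<oplus>\<^bsub>pairs\<^esub> w) = (\<lambda>t. u t - (v \<oplus>\<^bsub>pairs\<^esub> w) t)"
      by (rule free_ground_minus[OF uvw(2) T.M.a_closed[OF uvw(3,4)]])
    also have "\<dots> = (\<lambda>t. u t - v t - w t)"
      by (simp add: free_lmodule_simps(3) algebra_simps)
    finally have "u \<ominus>\<^bsub>pairs\<^esub> (v \<oplus>\<^bsub>pairs\<^esub> w) = (\<lambda>t. u t - v t - w t)" .
    with uvw show ?thesis by (simp add: T.quot_add T.coset_eq_iff)
  qed
  show "pure (m + m') n = pure m n \<oplus>\<^bsub>tensor B (aug_module \<epsilon>) N\<^esub> pure m' n"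
    unfolding pure_eq tensor_eq by (rule sum[OF tensor_nullI(1)[OF n] b[OF n] b[OF n] b[OF n]])
  show "pure m (n \<oplus>\<^bsub>N\<^esub> n') = pure m n \<oplus>\<^bsub>tensor B (aug_module \<epsilon>) N\<^esub> pure m n'"
    if n': "n' \<in> carrier N"
    unfolding pure_eq tensor_eq
    by (rule sum[OF tensor_nullI(2)[OF n n'] b[OF N.M.a_closed[OF n n']] b[OF n] b[OF n']])
  show "pure m (b \<odot>\<^bsub>N\<^esub> n) = pure (\<epsilon> b * m) n" if "b \<in> carrier B"
    using tensor_nullI(3)[OF n that, of m] N.smult_closed[OF that n]
    by (subst eq_commute) (simp add: pure_eq T.coset_eq_iff b n free_ground_minus)
  show "pure (c * m) n = c \<odot>\<^bsub>tensor B (aug_module \<epsilon>) N\<^esub> pure m n"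
  proof -
    have sm: "c \<odot>\<^bsub>pairs\<^esub> basis_vec ground (m, n) \<in> carrier pairs" by (rule T.smult_closed) (simp_all add: b n)
    have "basis_vec ground (c * m, n) \<ominus>\<^bsub>pairs\<^esub> (c \<odot>\<^bsub>pairs\<^esub> basis_vec ground (m, n)) \<in> tensor_null"
      using tensor_nullI(4)[OF n, of c m] unfolding free_ground_minus[OF b[OF n] sm] by (simp add: free_lmodule_simps(4))
    then show ?thesis
      unfolding pure_eq tensor_eq using b[OF n] sm by (simp add: T.quot_smult T.coset_eq_iff)
  qed
qed

text \<open>
  Every \<open>m \<otimes> n\<close> is \<open>1 \<otimes> (m n)\<close>, and tensors of this form are closed
  under addition.
\<close>

lemma tensor_cases:
  assumes "z \<in> carrier (tensor B (aug_module \<epsilon>) N)"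
  obtains n where "n \<in> carrier N" "z = pure 1 n"
proof -
  interpret C: left_module ground "tensor B (aug_module \<epsilon>) N" by (rule left_module_tensor)
  obtain u where u: "u \<in> carrier pairs" "z = tensor_null +>\<^bsub>pairs\<^esub> u"
    using assms unfolding tensor_eq by (rule T.quot_cases)
  have "\<exists>n\<in>carrier N. tensor_null +>\<^bsub>pairs\<^esub> u = pure 1 n" if "u \<in> carrier pairs" for u
    using that
  proof (induction u rule: ring.free_lmodule_induct[OF ring_ground, consumes 1, case_names zero add])
    case zero
    have "pure 1 \<zero>\<^bsub>N\<^esub> \<oplus>\<^bsub>tensor B (aug_module \<epsilon>) N\<^esub> pure 1 \<zero>\<^bsub>N\<^esub> = pure 1 \<zero>\<^bsub>N\<^esub>"
      using pure_simps(2)[of "\<zero>\<^bsub>N\<^esub>" "\<zero>\<^bsub>N\<^esub>" 1] by simp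
    then have "pure 1 \<zero>\<^bsub>N\<^esub> = \<zero>\<^bsub>tensor B (aug_module \<epsilon>) N\<^esub>"
      using C.M.add.r_cancel_one'[of "pure 1 \<zero>\<^bsub>N\<^esub>" "pure 1 \<zero>\<^bsub>N\<^esub>"] pure_closed by simp
    then have "tensor_null +>\<^bsub>pairs\<^esub> \<zero>\<^bsub>pairs\<^esub> = pure 1 \<zero>\<^bsub>N\<^esub>"
      by (simp add: T.coset_zero tensor_eq T.quot_zero)
    then show ?case by (intro bexI[of _ "\<zero>\<^bsub>N\<^esub>"]) (simp_all add: free_lmodule_simps(2))
  next
    case (add u a s)
    obtain m n where s: "s = (m, n)" "n \<in> carrier N" using add.hyps by auto
    obtain n0 where n0: "n0 \<in> carrier N" "tensor_null +>\<^bsub>pairs\<^esub> u = pure 1 n0" using add.IH by blast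
    let ?b = "(a * m) \<odot>\<^bsub>B\<^esub> \<one>\<^bsub>B\<^esub>"
    have b: "?b \<in> carrier B" by simp
    have "tensor_null +>\<^bsub>pairs\<^esub> (u \<oplus>\<^bsub>pairs\<^esub> a \<odot>\<^bsub>pairs\<^esub> basis_vec ground s) =
      (tensor_null +>\<^bsub>pairs\<^esub> u) \<oplus>\<^bsub>tensor B (aug_module \<epsilon>) N\<^esub> a \<odot>\<^bsub>tensor B (aug_module \<epsilon>) N\<^esub> pure m n"
      using T.smult_closed[OF _ basis_pair_closed[OF s(2), of m], of a] basis_pair_closed[OF s(2), of m] add.hyps(1)
      by (simp add: s(1) tensor_eq pure_eq T.quot_add T.quot_smult)
    also have "tensor_null +>\<^bsub>pairs\<^esub> u = pure 1 n0" by (rule n0(2))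
    also have "a \<odot>\<^bsub>tensor B (aug_module \<epsilon>) N\<^esub> pure m n = pure 1 (?b \<odot>\<^bsub>N\<^esub> n)"
      using s(2) b by (simp add: pure_simps(3) aug_scalar flip: pure_simps(4))
    also have "pure 1 n0 \<oplus>\<^bsub>tensor B (aug_module \<epsilon>) N\<^esub> \<dots> = pure 1 (n0 \<oplus>\<^bsub>N\<^esub> ?b \<odot>\<^bsub>N\<^esub> n)"
      by (rule pure_simps(2)[symmetric, OF n0(1) N.smult_closed[OF b s(2)]])
    finally show ?case using n0(1) N.smult_closed[OF b s(2)] by (intro bexI[of _ "n0 \<oplus>\<^bsub>N\<^esub> ?b \<odot>\<^bsub>N\<^esub> n"]) simp_all
  qed
  from this[OF u(1)] obtain n where "n \<in> carrier N" "tensor_null +>\<^bsub>pairs\<^esub> u = pure 1 n" by (rule bexE)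
  with that[of n] u(2) show thesis by simp
qed

end

text \<open>
  Additive maps \<open>N \<rightarrow> V\<close> that are linear along \<open>\<epsilon>\<close>. By the
  universal property these correspond to the linear maps from the tensor product to
  \<open>V\<close>, by composition with \<open>n \<mapsto> 1 \<otimes> n\<close>.
\<close>

definition aug_hom ::
  "('k::field, 'b, 'y) module_scheme \<Rightarrow> ('b \<Rightarrow> 'k) \<Rightarrow> ('b, 'n, 'x) module_scheme \<Rightarrow> ('k, 'v, 'z) module_scheme \<Rightarrow> ('n \<Rightarrow> 'v) set"
  where "aug_hom B \<epsilon> N V = {h. (\<forall>x\<in>carrier N. h x \<in> carrier V) \<and>
    (\<forall>x\<in>carrier N. \<forall>y\<in>carrier N. h (x \<oplus>\<^bsub>N\<^esub> y) = h x \<oplus>\<^bsub>V\<^esub> h y) \<and>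
    (\<forall>b\<in>carrier B. \<forall>x\<in>carrier N. h (b \<odot>\<^bsub>N\<^esub> x) = \<epsilon> b \<odot>\<^bsub>V\<^esub> h x)}"

lemma aug_homI:
  assumes "\<And>x. x \<in> carrier N \<Longrightarrow> h x \<in> carrier V"
    and "\<And>x y. x \<in> carrier N \<Longrightarrow> y \<in> carrier N \<Longrightarrow> h (x \<oplus>\<^bsub>N\<^esub> y) = h x \<oplus>\<^bsub>V\<^esub> h y"
    and "\<And>b x. b \<in> carrier B \<Longrightarrow> x \<in> carrier N \<Longrightarrow> h (b \<odot>\<^bsub>N\<^esub> x) = \<epsilon> b \<odot>\<^bsub>V\<^esub> h x"
  shows "h \<in> aug_hom B \<epsilon> N V"
  using assms by (simp add: aug_hom_def)

lemma aug_homD: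
  assumes "h \<in> aug_hom B \<epsilon> N V"
  shows "x \<in> carrier N \<Longrightarrow> h x \<in> carrier V"
    and "x \<in> carrier N \<Longrightarrow> y \<in> carrier N \<Longrightarrow> h (x \<oplus>\<^bsub>N\<^esub> y) = h x \<oplus>\<^bsub>V\<^esub> h y"
    and "b \<in> carrier B \<Longrightarrow> x \<in> carrier N \<Longrightarrow> h (b \<odot>\<^bsub>N\<^esub> x) = \<epsilon> b \<odot>\<^bsub>V\<^esub> h x"
  using assms by (simp_all add: aug_hom_def)

lemma aug_hom_comp: "f \<in> lmod_hom B M N \<Longrightarrow> h \<in> aug_hom B \<epsilon> N V \<Longrightarrow> (\<lambda>x. h (f x)) \<in> aug_hom B \<epsilon> M V"
  by (rule aug_homI) (simp_all add: aug_homD lmod_homD)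

lemma aug_hom_minus:
  assumes "left_module B N" "left_module ground V" and h: "h \<in> aug_hom B \<epsilon> N V"
    and x: "x \<in> carrier N" and y: "y \<in> carrier N"
  shows "h \<zero>\<^bsub>N\<^esub> = \<zero>\<^bsub>V\<^esub>" "h (\<ominus>\<^bsub>N\<^esub> x) = \<ominus>\<^bsub>V\<^esub> h x" "h (x \<ominus>\<^bsub>N\<^esub> y) = h x \<ominus>\<^bsub>V\<^esub> h y"
proof -
  interpret N: left_module B N by fact
  interpret V: left_module ground V by fact
  have "h \<zero>\<^bsub>N\<^esub> \<oplus>\<^bsub>V\<^esub> h \<zero>\<^bsub>N\<^esub> = h \<zero>\<^bsub>N\<^esub>"
    using aug_homD(2)[OF h, of "\<zero>\<^bsub>N\<^esub>" "\<zero>\<^bsub>N\<^esub>"] by simp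
  then show z: "h \<zero>\<^bsub>N\<^esub> = \<zero>\<^bsub>V\<^esub>"
    using V.M.add.r_cancel_one'[of "h \<zero>\<^bsub>N\<^esub>" "h \<zero>\<^bsub>N\<^esub>"] aug_homD(1)[OF h N.M.zero_closed] by simp
  have m: "h (\<ominus>\<^bsub>N\<^esub> x) = \<ominus>\<^bsub>V\<^esub> h x" if "x \<in> carrier N" for x
  proof (rule V.M.minus_equality[symmetric])
    show "h (\<ominus>\<^bsub>N\<^esub> x) \<oplus>\<^bsub>V\<^esub> h x = \<zero>\<^bsub>V\<^esub>"
      using aug_homD(2)[OF h, of "\<ominus>\<^bsub>N\<^esub> x" x] that by (simp add: N.M.l_neg z)
  qed (use that aug_homD(1)[OF h] in auto)
  show "h (\<ominus>\<^bsub>N\<^esub> x) = \<ominus>\<^bsub>V\<^esub> h x" by (rule m[OF x])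
  show "h (x \<ominus>\<^bsub>N\<^esub> y) = h x \<ominus>\<^bsub>V\<^esub> h y"
    using x y by (simp add: a_minus_def aug_homD(2)[OF h] m)
qed

context aug_tensor
begin

lemma balanced_aug_hom:
  assumes V: "left_module ground V" and h: "h \<in> aug_hom B \<epsilon> N V"
  shows "balanced V (\<lambda>(m, n). m \<odot>\<^bsub>V\<^esub> h n)"
proof -
  interpret V: left_module ground V by fact
  note l = V.smult_l_distr[simplified] and r = V.smult_r_distr[simplified] and a = V.smult_assoc[simplified]
    and c = V.smult_closed[simplified]
  show ?thesis unfolding balanced_def
  proof (intro conjI allI ballI)
    fix b m n assume "b \<in> carrier B" "n \<in> carrier N"
    then show "(case (\<epsilon> b * m, n) of (m, n) \<Rightarrow> m \<odot>\<^bsub>V\<^esub> h n) = (case (m, b \<odot>\<^bsub>N\<^esub> n) of (m, n) \<Rightarrow> m \<odot>\<^bsub>V\<^esub> h n)"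
      using a[of "h n" m "\<epsilon> b"] by (simp add: aug_homD[OF h] mult.commute)
  qed (simp_all add: aug_homD[OF h] l r a c)
qed

lemma pure_one_aug_hom: "pure 1 \<in> aug_hom B \<epsilon> N (tensor B (aug_module \<epsilon>) N)"
  by (rule aug_homI) (simp_all add: pure_closed pure_simps(2,3) flip: pure_simps(4))

lemma aug_hom_eq_zero:
  assumes V: "left_module ground V" and h: "h \<in> aug_hom B \<epsilon> N V" and n: "n \<in> carrier N"
    and z: "pure 1 n = \<zero>\<^bsub>tensor B (aug_module \<epsilon>) N\<^esub>"
  shows "h n = \<zero>\<^bsub>V\<^esub>"
proof -
  interpret V: left_module ground V by fact
  note te = tensor_ext[OF V balanced_aug_hom[OF V h]]
  have "h n = (case (1, n) of (m, n) \<Rightarrow> m \<odot>\<^bsub>V\<^esub> h n)"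
    using V.smult_one[OF aug_homD(1)[OF h n]] by simp
  also have "\<dots> = \<zero>\<^bsub>V\<^esub>"
    unfolding te(2)[OF n, symmetric] z by (rule lmod_hom_zero[OF left_module_tensor V te(1)])
  finally show ?thesis .
qed

end

lemma tensor_map_hom:
  fixes N' :: "('b, 'm) module"
  assumes N: "aug_tensor B \<epsilon> N" and N': "aug_tensor B \<epsilon> N'" and f: "f \<in> lmod_hom B N N'"
  shows "tensor_map B (aug_module \<epsilon>) N' f \<in>
      lmod_hom ground (tensor B (aug_module \<epsilon>) N) (tensor B (aug_module \<epsilon>) N')"
    and "n \<in> carrier N \<Longrightarrow> tensor_map B (aug_module \<epsilon>) N' f (pure_tensor B (aug_module \<epsilon>) N m n) =
      pure_tensor B (aug_module \<epsilon>) N' m (f n)"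
proof -
  interpret N: aug_tensor B \<epsilon> N by fact
  interpret N': aug_tensor B \<epsilon> N' by fact
  have bal: "N.balanced (tensor B (aug_module \<epsilon>) N') (\<lambda>(m, n). N'.pure m (f n))"
    unfolding N.balanced_def
    by (intro conjI allI ballI)
      (simp_all add: lmod_homD[OF f] N'.pure_closed N'.pure_simps(1,2,3) flip: N'.pure_simps(4))
  show "tensor_map B (aug_module \<epsilon>) N' f \<in>
      lmod_hom ground (tensor B (aug_module \<epsilon>) N) (tensor B (aug_module \<epsilon>) N')"
    unfolding tensor_map_def by (rule N.tensor_ext(1)[OF N'.left_module_tensor bal])
  show "n \<in> carrier N \<Longrightarrow> tensor_map B (aug_module \<epsilon>) N' f (N.pure m n) = N'.pure m (f n)"
    unfolding tensor_map_def using N.tensor_ext(2)[OF N'.left_module_tensor bal, of n m] by simp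
qed

text \<open>
  On a free module over \<open>B\<close> this is the map \<open>u \<mapsto> 1 \<otimes> u\<close>, when the
  tensor product of the trivial module with it is identified with the vector space on
  the same basis.
\<close>

definition reduce :: "('b \<Rightarrow> 'k) \<Rightarrow> ('s \<Rightarrow> 'b) \<Rightarrow> 's \<Rightarrow> 'k"
  where "reduce \<epsilon> u = (\<lambda>s. \<epsilon> (u s))"

context augmented_algebra
begin

lemma eps_hom: "x \<in> carrier B \<Longrightarrow> y \<in> carrier B \<Longrightarrow> \<epsilon> (x \<oplus> y) = \<epsilon> x + \<epsilon> y"
    "x \<in> carrier B \<Longrightarrow> y \<in> carrier B \<Longrightarrow> \<epsilon> (x \<otimes> y) = \<epsilon> x * \<epsilon> y"
    "\<epsilon> \<one> = 1" "\<epsilon> \<zero> = 0"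
proof -
  have e: "\<epsilon> \<in> ring_hom B ground" "\<epsilon> \<in> lmod_hom ground B ground" using augmentation by (auto simp: alg_hom_def)
  show "x \<in> carrier B \<Longrightarrow> y \<in> carrier B \<Longrightarrow> \<epsilon> (x \<oplus> y) = \<epsilon> x + \<epsilon> y"
    "x \<in> carrier B \<Longrightarrow> y \<in> carrier B \<Longrightarrow> \<epsilon> (x \<otimes> y) = \<epsilon> x * \<epsilon> y" "\<epsilon> \<one> = 1"
    using ring_hom_add[OF e(1), of x y] ring_hom_mult[OF e(1), of x y] ring_hom_one[OF e(1)] by simp_all
  have "\<epsilon> \<zero> + \<epsilon> \<zero> = \<epsilon> (\<zero> \<oplus> \<zero>)" using ring_hom_add[OF e(1), of \<zero> \<zero>] by simp
  also have "\<dots> = \<epsilon> \<zero> + 0" by simp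
  finally show "\<epsilon> \<zero> = 0" by (rule add_left_imp_eq)
qed

lemma reduce_aug_hom: "reduce \<epsilon> \<in> aug_hom B \<epsilon> (free_lmodule B S) (free_lmodule ground S)"
proof (rule aug_homI)
  fix u assume u: "u \<in> carrier (free_lmodule B S)"
  have "{s. \<epsilon> (u s) \<noteq> 0} \<subseteq> {s. u s \<noteq> \<zero>}" using eps_hom(4) by auto
  then have "finite {s. \<epsilon> (u s) \<noteq> 0}" using u finite_subset by (auto simp: free_lmodule_simps(1))
  then show "reduce \<epsilon> u \<in> carrier (free_lmodule ground S)"
    using u by (simp add: free_lmodule_simps(1) reduce_def eps_hom(4))
qed (simp_all add: free_lmodule_simps(3,4) reduce_def eps_hom(1,2) free_coeff_closed[where S = S])

text \<open>
  \<open>reduce\<close> is the universal map linear along \<open>\<epsilon>\<close> on a free module, as both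
  sides agree on the basis.
\<close>

lemma aug_hom_free_factors:
  assumes V: "left_module ground V" and h: "h \<in> aug_hom B \<epsilon> (free_lmodule B S) V"
    and u: "u \<in> carrier (free_lmodule B S)"
  shows "h u = lin_ext ground V (\<lambda>s. h (basis_vec B s)) (reduce \<epsilon> u)"
proof -
  interpret V: left_module ground V by fact
  interpret F: left_module B "free_lmodule B S" by (rule left_module_free)
  have c: "h (basis_vec B s) \<in> carrier V" if "s \<in> S" for s
    by (rule aug_homD(1)[OF h basis_vec_closed[OF that]])
  note k = V.lin_ext_hom[of S "\<lambda>s. h (basis_vec B s)", OF c]
  note r = aug_homD[OF reduce_aug_hom[of S]]
  let ?k = "lin_ext ground V (\<lambda>s. h (basis_vec B s))"
  have rb: "reduce \<epsilon> (basis_vec B s) = basis_vec ground s" for s :: 's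
    by (auto simp: reduce_def basis_vec_def eps_hom)
  have kr: "(\<lambda>u. ?k (reduce \<epsilon> u)) \<in> aug_hom B \<epsilon> (free_lmodule B S) V"
    by (rule aug_homI) (simp_all add: r lmod_homD[OF k(1)])
  show ?thesis using u
  proof (induction u rule: free_lmodule_induct)
    case zero
    show ?case
      using aug_hom_minus(1)[OF F.left_module_axioms V h F.M.zero_closed F.M.zero_closed]
        aug_hom_minus(1)[OF F.left_module_axioms V kr F.M.zero_closed F.M.zero_closed]
      by (simp add: free_lmodule_simps(2))
  next
    case (add u a s)
    note b = basis_vec_closed[OF add.hyps(3)]
    note ab = F.smult_closed[OF add.hyps(2) b]
    show ?case
      unfolding aug_homD(2)[OF h add.hyps(1) ab] aug_homD(2)[OF kr add.hyps(1) ab]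
        aug_homD(3)[OF h add.hyps(2) b] aug_homD(3)[OF kr add.hyps(2) b] add.IH[symmetric]
      by (simp add: rb k(2)[OF _ add.hyps(3)])
  qed
qed

lemma aug_hom_free_zero:
  assumes V: "left_module ground V" and h: "h \<in> aug_hom B \<epsilon> (free_lmodule B S) V"
    and u: "u \<in> carrier (free_lmodule B S)" and z: "reduce \<epsilon> u = (\<lambda>_. 0)"
  shows "h u = \<zero>\<^bsub>V\<^esub>"
proof -
  interpret F: left_module B "free_lmodule B S" by (rule left_module_free)
  have z': "reduce \<epsilon> (\<zero>\<^bsub>free_lmodule B S\<^esub>) = (\<lambda>_. 0)"
    by (simp add: reduce_def free_lmodule_simps(2) eps_hom)
  have "h u = h \<zero>\<^bsub>free_lmodule B S\<^esub>"
    unfolding aug_hom_free_factors[OF V h u] aug_hom_free_factors[OF V h F.M.zero_closed] z z' ..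
  also have "\<dots> = \<zero>\<^bsub>V\<^esub>" by (rule aug_hom_minus(1)[OF F.left_module_axioms V h F.M.zero_closed F.M.zero_closed])
  finally show ?thesis .
qed

end


section \<open>The second Tor group from a free resolution of length two\<close>

lemma (in left_module) minus_eq_zero_iff:
  assumes "x \<in> carrier M" "y \<in> carrier M"
  shows "x \<ominus>\<^bsub>M\<^esub> y = \<zero>\<^bsub>M\<^esub> \<longleftrightarrow> x = y"
proof
  assume "x \<ominus>\<^bsub>M\<^esub> y = \<zero>\<^bsub>M\<^esub>"
  then have "x \<oplus>\<^bsub>M\<^esub> \<ominus>\<^bsub>M\<^esub> y \<oplus>\<^bsub>M\<^esub> y = y" using assms by (simp add: a_minus_def)
  then show "x = y" using assms by (simp add: M.a_assoc M.l_neg)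
qed (use assms in \<open>simp add: a_minus_def M.r_neg\<close>)

lemma submodule_restrict:
  assumes M: "left_module R M" and H: "submodule H R M"
  shows "left_module R (M\<lparr>carrier := H\<rparr>)"
proof -
  interpret M: left_module R M by fact
  note h = H[unfolded submodule_iff[OF M]]
  have hc: "x \<in> carrier M" if "x \<in> H" for x using h that by auto
  have ag: "abelian_group (M\<lparr>carrier := H\<rparr>)"
  proof (rule abelian_groupI)
    fix x assume x: "x \<in> carrier (M\<lparr>carrier := H\<rparr>)"
    have "\<ominus>\<^bsub>M\<^esub> x \<in> H" using subgroup.m_inv_closed[OF submodule.axioms(1)[OF H], of x] x by (simp add: a_inv_def)
    then show "\<exists>y\<in>carrier (M\<lparr>carrier := H\<rparr>). y \<oplus>\<^bsub>M\<lparr>carrier := H\<rparr>\<^esub> x = \<zero>\<^bsub>M\<lparr>carrier := H\<rparr>\<^esub>"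
      using x hc by (intro bexI[of _ "\<ominus>\<^bsub>M\<^esub> x"]) (simp_all add: M.M.l_neg)
  qed (use h hc in \<open>simp_all add: M.M.a_ac\<close>)
  show ?thesis
    by (intro left_module.intro M.R.ring_axioms ag left_module_axioms.intro)
      (use h hc in \<open>simp_all add: M.smult_l_distr M.smult_r_distr M.smult_assoc M.smult_one\<close>)
qed

text \<open>
  The first isomorphism theorem.
\<close>

lemma lmod_isomorphic_quot:
  assumes M: "left_module R M" and N: "submodule N R M" and Z: "left_module R Z"
    and \<tau>: "\<tau> \<in> lmod_hom R M Z" and surj: "\<tau> ` carrier M = carrier Z"
    and ker: "\<And>x. x \<in> carrier M \<Longrightarrow> \<tau> x = \<zero>\<^bsub>Z\<^esub> \<longleftrightarrow> x \<in> N"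
  shows "lmod_isomorphic R (quot M N) Z"
proof -
  interpret submodule_quotient R M N
    by (intro submodule_quotient.intro M submodule_quotient_axioms.intro N)
  interpret Z: left_module R Z by fact
  have eq: "\<tau> x = \<tau> y \<longleftrightarrow> N +>\<^bsub>M\<^esub> x = N +>\<^bsub>M\<^esub> y" if "x \<in> carrier M" "y \<in> carrier M" for x y
  proof -
    have "\<tau> x = \<tau> y \<longleftrightarrow> \<tau> x \<ominus>\<^bsub>Z\<^esub> \<tau> y = \<zero>\<^bsub>Z\<^esub>"
      by (rule Z.minus_eq_zero_iff[symmetric]; rule lmod_homD(1)[OF \<tau>]; rule that)
    also have "\<dots> \<longleftrightarrow> x \<ominus>\<^bsub>M\<^esub> y \<in> N"
      using that ker[of "x \<ominus>\<^bsub>M\<^esub> y"] by (simp add: lmod_hom_minus[OF M Z \<tau>])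
    finally show ?thesis using coset_eq_iff[OF that] by simp
  qed
  have ex: "\<exists>x\<in>carrier M. X = N +>\<^bsub>M\<^esub> x" if "X \<in> carrier (quot M N)" for X
    using that by (rule quot_cases) (rule bexI)
  define \<phi> where "\<phi> X = \<tau> (SOME x. x \<in> carrier M \<and> X = N +>\<^bsub>M\<^esub> x)" for X
  have \<phi>: "\<phi> (N +>\<^bsub>M\<^esub> x) = \<tau> x" if "x \<in> carrier M" for x
  proof -
    have "\<exists>y. y \<in> carrier M \<and> N +>\<^bsub>M\<^esub> x = N +>\<^bsub>M\<^esub> y" using that by (intro exI[of _ x]) simp
    note s = someI_ex[OF this]
    from eq[OF that conjunct1[OF s]] conjunct2[OF s] show ?thesis by (simp add: \<phi>_def)
  qed
  have "\<phi> \<in> lmod_hom R (quot M N) Z"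
  proof (rule lmod_homI)
    fix X Y assume "X \<in> carrier (quot M N)" "Y \<in> carrier (quot M N)"
    then show "\<phi> (X \<oplus>\<^bsub>quot M N\<^esub> Y) = \<phi> X \<oplus>\<^bsub>Z\<^esub> \<phi> Y"
      by (elim quot_cases) (simp add: quot_add \<phi> lmod_homD(2)[OF \<tau>])
  next
    fix X assume "X \<in> carrier (quot M N)"
    then show "\<phi> X \<in> carrier Z"
      by (elim quot_cases) (simp add: \<phi> lmod_homD(1)[OF \<tau>])
  next
    fix a X assume "a \<in> carrier R" "X \<in> carrier (quot M N)"
    then show "\<phi> (a \<odot>\<^bsub>quot M N\<^esub> X) = a \<odot>\<^bsub>Z\<^esub> \<phi> X"
      by (elim quot_cases) (simp add: quot_smult \<phi> smult_closed lmod_homD(3)[OF \<tau>])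
  qed
  moreover have "bij_betw \<phi> (carrier (quot M N)) (carrier Z)"
  proof (rule bij_betwI')
    fix X Y assume "X \<in> carrier (quot M N)" "Y \<in> carrier (quot M N)"
    then show "(\<phi> X = \<phi> Y) = (X = Y)" by (elim quot_cases) (simp add: \<phi> eq)
  next
    fix X assume "X \<in> carrier (quot M N)"
    then show "\<phi> X \<in> carrier Z" by (elim quot_cases) (simp add: \<phi> lmod_homD(1)[OF \<tau>])
  next
    fix z assume "z \<in> carrier Z"
    then obtain x where "x \<in> carrier M" "z = \<tau> x" using surj by auto
    then show "\<exists>X\<in>carrier (quot M N). z = \<phi> X"
      by (intro bexI[of _ "N +>\<^bsub>M\<^esub> x"]) (simp_all add: \<phi> coset_in_quot)
  qed
  ultimately show ?thesis unfolding lmod_isomorphic_def by (intro bexI)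
qed


text \<open>
  \<open>Q\<close> is an arbitrary projective resolution of the trivial module, and \<open>E\<close> a free one
  without generators in degree three, so that distinct reduced cycles of \<open>E\<close> in degree
  two represent distinct classes.
\<close>

locale resolution_pair = augmented_algebra B \<epsilon> +
  Q: projective_resolution B "aug_module \<epsilon>" Q d \<eta> +
  E: projective_resolution B "aug_module \<epsilon>" "\<lambda>n. free_lmodule B (S n)" \<delta> \<eta>'
  for B :: "('k::field, 'b, 'z) module_scheme" and \<epsilon> :: "'b \<Rightarrow> 'k"
    and Q :: "nat \<Rightarrow> ('b, 'p) module" and d \<eta> and S :: "nat \<Rightarrow> 's set" and \<delta> \<eta>' +
  assumes S3: "S 3 = {}"
begin

abbreviation "E n \<equiv> free_lmodule B (S n)"
abbreviation "K \<equiv> aug_module \<epsilon>"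

lemma aug_tensor_Q: "aug_tensor B \<epsilon> (Q n)"
  by (intro aug_tensor.intro augmented_algebra_axioms Q.left_module_P)

lemma E3_zero: "u \<in> carrier (E 3) \<Longrightarrow> u = \<zero>\<^bsub>E 3\<^esub>"
  by (simp add: free_lmodule_simps S3 fun_eq_iff)

text \<open>
  The kernel of the map from degree two to degree one of the complex \<open>E\<close> tensored with
  the trivial module.
\<close>

definition reduced_cycles :: "('s \<Rightarrow> 'k) set"
  where "reduced_cycles = {reduce \<epsilon> u | u. u \<in> carrier (E 2) \<and> reduce \<epsilon> (\<delta> 1 u) = (\<lambda>_. 0)}"

text \<open>
  Let \<open>f\<close> and \<open>g\<close> be comparison maps between \<open>Q\<close> and \<open>E\<close> in both directions. The
  isomorphism is induced by the map \<open>T\<close> that sends \<open>1 \<otimes> q\<close> to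
  \<open>reduce (f\<^sub>2 q)\<close>, followed by \<open>\<sigma>\<close>. A homotopy on \<open>Q\<close> between \<open>g f\<close> and
  the identity shows that a cycle killed by \<open>T\<close> is a boundary, and a homotopy on \<open>E\<close>
  between \<open>f g\<close> and the identity shows that every reduced cycle is the value of \<open>T\<close> at
  a cycle. The map \<open>\<sigma>\<close> lets the target be any space that parametrizes the
  reduced cycles.
\<close>

lemma tor_2_isomorphic:
  assumes Z: "left_module ground Z" and \<sigma>: "\<sigma> \<in> lmod_hom ground (free_lmodule ground (S 2)) Z"
    and \<sigma>_bij: "bij_betw \<sigma> reduced_cycles (carrier Z)"
  shows "lmod_isomorphic ground (tor_by B K Q d 2) Z"
proof -
  obtain f0 f1 f2 where f: "f0 \<in> lmod_hom B (Q 0) (E 0)" "f1 \<in> lmod_hom B (Q 1) (E 1)" "f2 \<in> lmod_hom B (Q 2) (E 2)"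
    and f_comm: "\<And>x. x \<in> carrier (Q 0) \<Longrightarrow> \<eta>' (f0 x) = \<eta> x"
    "\<And>x. x \<in> carrier (Q 1) \<Longrightarrow> \<delta> 0 (f1 x) = f0 (d 0 x)"
    "\<And>x. x \<in> carrier (Q 2) \<Longrightarrow> \<delta> 1 (f2 x) = f1 (d 1 x)"
    by (rule resolution_chain_map[OF Q.projective_resolution_axioms E.projective_resolution_axioms]) (rule that)
  obtain g0 g1 g2 where g: "g0 \<in> lmod_hom B (E 0) (Q 0)" "g1 \<in> lmod_hom B (E 1) (Q 1)" "g2 \<in> lmod_hom B (E 2) (Q 2)"
    and g_comm: "\<And>x. x \<in> carrier (E 0) \<Longrightarrow> \<eta> (g0 x) = \<eta>' x"
    "\<And>x. x \<in> carrier (E 1) \<Longrightarrow> d 0 (g1 x) = g0 (\<delta> 0 x)"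
    "\<And>x. x \<in> carrier (E 2) \<Longrightarrow> d 1 (g2 x) = g1 (\<delta> 1 x)"
    by (rule resolution_chain_map[OF E.projective_resolution_axioms Q.projective_resolution_axioms]) (rule that)
  \<comment> \<open>The numerals 1, 2 and 3 are not unfolded, as the hypotheses are about
    these degrees.\<close>
  have num: "Suc 0 = 1" "Suc 1 = 2" "Suc 2 = 3" by simp_all
  note One_nat_def [simp del]
  have dQ: "d 0 \<in> lmod_hom B (Q 1) (Q 0)" "d 1 \<in> lmod_hom B (Q 2) (Q 1)" "d 2 \<in> lmod_hom B (Q 3) (Q 2)"
    using Q.differential[of 0] Q.differential[of 1] Q.differential[of 2] unfolding num .
  have dE: "\<delta> 0 \<in> lmod_hom B (E 1) (E 0)" "\<delta> 1 \<in> lmod_hom B (E 2) (E 1)" "\<delta> 2 \<in> lmod_hom B (E 3) (E 2)"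
    using E.differential[of 0] E.differential[of 1] E.differential[of 2] unfolding num .
  obtain hQ1 hQ2 where hQ: "hQ1 \<in> lmod_hom B (Q 1) (Q 2)" "hQ2 \<in> lmod_hom B (Q 2) (Q 3)"
    and hQ_eq: "\<And>x. x \<in> carrier (Q 2) \<Longrightarrow> d 2 (hQ2 x) = (g2 (f2 x) \<ominus>\<^bsub>Q 2\<^esub> x) \<ominus>\<^bsub>Q 2\<^esub> hQ1 (d 1 x)"
  proof (rule resolution_homotopy[OF Q.projective_resolution_axioms lmod_hom_comp[OF f(1) g(1)]
      lmod_hom_comp[OF f(2) g(2)] lmod_hom_comp[OF f(3) g(3)]])
    show "\<eta> (g0 (f0 x)) = \<eta> x" if "x \<in> carrier (Q 0)" for x
      using that by (simp add: g_comm f_comm lmod_homD(1)[OF f(1)])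
    show "d 0 (g1 (f1 x)) = g0 (f0 (d 0 x))" if "x \<in> carrier (Q 1)" for x
      using g_comm(2)[OF lmod_homD(1)[OF f(2) that]] f_comm(2)[OF that] by simp
    show "d 1 (g2 (f2 x)) = g1 (f1 (d 1 x))" if "x \<in> carrier (Q 2)" for x
      using g_comm(3)[OF lmod_homD(1)[OF f(3) that]] f_comm(3)[OF that] by simp
  qed (rule that)
  obtain hE1 hE2 where hE: "hE1 \<in> lmod_hom B (E 1) (E 2)" "hE2 \<in> lmod_hom B (E 2) (E 3)"
    and hE_eq: "\<And>x. x \<in> carrier (E 2) \<Longrightarrow> \<delta> 2 (hE2 x) = (f2 (g2 x) \<ominus>\<^bsub>E 2\<^esub> x) \<ominus>\<^bsub>E 2\<^esub> hE1 (\<delta> 1 x)"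
  proof (rule resolution_homotopy[OF E.projective_resolution_axioms lmod_hom_comp[OF g(1) f(1)]
      lmod_hom_comp[OF g(2) f(2)] lmod_hom_comp[OF g(3) f(3)]])
    show "\<eta>' (f0 (g0 x)) = \<eta>' x" if "x \<in> carrier (E 0)" for x
      using that by (simp add: g_comm f_comm lmod_homD(1)[OF g(1)])
    show "\<delta> 0 (f1 (g1 x)) = f0 (g0 (\<delta> 0 x))" if "x \<in> carrier (E 1)" for x
      using f_comm(2)[OF lmod_homD(1)[OF g(2) that]] g_comm(2)[OF that] by simp
    show "\<delta> 1 (f2 (g2 x)) = f1 (g1 (\<delta> 1 x))" if "x \<in> carrier (E 2)" for x
      using f_comm(3)[OF lmod_homD(1)[OF g(3) that]] g_comm(3)[OF that] by simp
  qed (rule that)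
  have \<delta>2: "\<delta> 2 u = \<zero>\<^bsub>E 2\<^esub>" if "u \<in> carrier (E 3)" for u
    using lmod_hom_zero[OF E.left_module_P E.left_module_P dE(3)] E3_zero[OF that] by simp
  interpret Q1: aug_tensor B \<epsilon> "Q 1" by (rule aug_tensor_Q)
  interpret Q2: aug_tensor B \<epsilon> "Q 2" by (rule aug_tensor_Q)
  interpret Q3: aug_tensor B \<epsilon> "Q 3" by (rule aug_tensor_Q)
  have lmQ: "left_module B (Q n)" and lmE: "left_module B (E n)" for n
    by (rule Q.left_module_P, rule E.left_module_P)
  have lmV: "left_module ground (free_lmodule ground (S 2))" "left_module ground (free_lmodule ground (S 1))"
    by (rule ring.left_module_free[OF ring_ground])+
  let ?C1 = "tensor B K (Q 1)" and ?C2 = "tensor B K (Q 2)" and ?C3 = "tensor B K (Q 3)"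
  define D1 where "D1 = tensor_map B K (Q 1) (d 1)"
  define D2 where "D2 = tensor_map B K (Q 2) (d 2)"
  note t1 = tensor_map_hom[OF Q2.aug_tensor_axioms Q1.aug_tensor_axioms dQ(2), folded D1_def]
  note t2 = tensor_map_hom[OF Q3.aug_tensor_axioms Q2.aug_tensor_axioms dQ(3), folded D2_def]
  define T where "T = (\<lambda>X. the_elem (lin_ext ground (free_lmodule ground (S 2))
      (\<lambda>(m, n). m \<odot>\<^bsub>free_lmodule ground (S 2)\<^esub> reduce \<epsilon> (f2 n)) ` X))"
  have rf2: "(\<lambda>q. reduce \<epsilon> (f2 q)) \<in> aug_hom B \<epsilon> (Q 2) (free_lmodule ground (S 2))"
    by (rule aug_hom_comp[OF f(3) reduce_aug_hom])
  note te = Q2.tensor_ext[OF lmV(1) Q2.balanced_aug_hom[OF lmV(1) rf2], folded T_def]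
  have T: "T \<in> lmod_hom ground ?C2 (free_lmodule ground (S 2))" by (rule te(1))
  have T_pure: "T (Q2.pure 1 q) = reduce \<epsilon> (f2 q)" if "q \<in> carrier (Q 2)" for q
    using te(2)[OF that, of 1] unfolding T_def by (simp add: free_lmodule_simps(4))
  have zeroV: "\<zero>\<^bsub>free_lmodule ground X\<^esub> = (\<lambda>_. 0 :: 'k)" for X by (simp add: free_lmodule_simps(2))
  let ?Z2 = "a_kernel ?C2 ?C1 D1"
  \<comment> \<open>\<open>f\<close> is a chain map, so \<open>T\<close> sends cycles to reduced cycles.\<close>
  have Z2: "T z \<in> reduced_cycles" if z: "z \<in> ?Z2" for z
  proof -
    obtain q where q: "q \<in> carrier (Q 2)" "z = Q2.pure 1 q"
      using z by (auto simp: a_kernel_iff intro: Q2.tensor_cases)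
    have "Q1.pure 1 (d 1 q) = \<zero>\<^bsub>?C1\<^esub>" using z t1(2)[OF q(1), of 1] by (simp add: q(2) a_kernel_iff)
    then have "reduce \<epsilon> (f1 (d 1 q)) = \<zero>\<^bsub>free_lmodule ground (S 1)\<^esub>"
      by (rule Q1.aug_hom_eq_zero[OF lmV(2) aug_hom_comp[OF f(2) reduce_aug_hom] lmod_homD(1)[OF dQ(2) q(1)]])
    then have "reduce \<epsilon> (\<delta> 1 (f2 q)) = (\<lambda>_. 0)" by (simp add: f_comm(3)[OF q(1)] zeroV)
    with lmod_homD(1)[OF f(3) q(1)] show ?thesis
      unfolding q(2) T_pure[OF q(1)] reduced_cycles_def by (intro CollectI exI[of _ "f2 q"]) simp
  qed
  \<comment> \<open>The image under \<open>f\<close> of a boundary is a boundary of \<open>E\<close>, and \<open>E\<close> has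
    nothing in degree three.\<close>
  have f2d2: "f2 (d 2 q) = \<zero>\<^bsub>E 2\<^esub>" if q: "q \<in> carrier (Q 3)" for q
  proof -
    note dq = lmod_homD(1)[OF dQ(3) q]
    have "d 1 (d 2 q) = \<zero>\<^bsub>Q 1\<^esub>" using Q.d_d[of q 1] q unfolding num by simp
    then have "\<delta> 1 (f2 (d 2 q)) = \<zero>\<^bsub>E 1\<^esub>"
      using f_comm(3)[OF dq] lmod_hom_zero[OF lmQ lmE f(2)] by simp
    then have "f2 (d 2 q) \<in> a_kernel (E 2) (E 1) (\<delta> 1)"
      by (simp add: a_kernel_iff lmod_homD(1)[OF f(3) dq])
    then have "f2 (d 2 q) \<in> \<delta> 2 ` carrier (E 3)" using E.exact_Suc[of 1] unfolding num by simp
    then obtain u where u: "u \<in> carrier (E 3)" "f2 (d 2 q) = \<delta> 2 u" by (elim imageE)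
    show ?thesis unfolding u(2) by (rule \<delta>2[OF u(1)])
  qed
  have B2: "z \<in> ?Z2" "T z = (\<lambda>_. 0)" if z: "z \<in> D2 ` carrier ?C3" for z
  proof -
    obtain w where w: "w \<in> carrier ?C3" "z = D2 w" using z by (elim imageE)
    obtain q where q: "q \<in> carrier (Q 3)" "w = Q3.pure 1 q" using w(1) by (rule Q3.tensor_cases)
    note dq = lmod_homD(1)[OF dQ(3) q(1)]
    have zq: "z = Q2.pure 1 (d 2 q)" using t2(2)[OF q(1), of 1] by (simp add: w q)
    have "d 1 (d 2 q) = \<zero>\<^bsub>Q 1\<^esub>" using Q.d_d[of q 1] q unfolding num by simp
    then have "D1 z = Q1.pure 1 \<zero>\<^bsub>Q 1\<^esub>" using t1(2)[OF dq, of 1] by (simp add: zq)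
    also have "\<dots> = \<zero>\<^bsub>?C1\<^esub>"
      by (rule aug_hom_minus(1)[OF lmQ Q1.left_module_tensor Q1.pure_one_aug_hom Q1.N.M.zero_closed Q1.N.M.zero_closed])
    finally show "z \<in> ?Z2" by (simp add: a_kernel_iff zq Q2.pure_closed[OF dq])
    show "T z = (\<lambda>_. 0)"
      unfolding zq T_pure[OF dq] f2d2[OF q(1)] by (simp add: reduce_def free_lmodule_simps(2) eps_hom)
  qed
  \<comment> \<open>By the homotopy on \<open>Q\<close>, applying \<open>1 \<otimes> _\<close> to
    \<open>g (f q) - q - h (d q)\<close> gives a boundary; here the terms with \<open>g (f q)\<close> and \<open>h (d q)\<close>
    vanish because they depend only on \<open>reduce (f q)\<close> and on \<open>1 \<otimes> d q\<close>.\<close>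
  have B2': "z \<in> D2 ` carrier ?C3" if z: "z \<in> ?Z2" "T z = (\<lambda>_. 0)" for z
  proof -
    obtain q where q: "q \<in> carrier (Q 2)" "z = Q2.pure 1 q"
      using z by (auto simp: a_kernel_iff intro: Q2.tensor_cases)
    note P = aug_homD[OF Q2.pure_one_aug_hom]
    note Pm = aug_hom_minus[OF lmQ Q2.left_module_tensor Q2.pure_one_aug_hom]
    note dq = lmod_homD(1)[OF dQ(2) q(1)] and hq = lmod_homD(1)[OF hQ(2) q(1)]
    note fq = lmod_homD(1)[OF f(3) q(1)]
    note gfq = lmod_homD(1)[OF g(3) fq] and hdq = lmod_homD(1)[OF hQ(1) dq]
    have 1: "Q2.pure 1 (g2 (f2 q)) = \<zero>\<^bsub>?C2\<^esub>"
      by (rule aug_hom_free_zero[OF Q2.left_module_tensor aug_hom_comp[OF g(3) Q2.pure_one_aug_hom] fq])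
        (use z(2) in \<open>simp add: q T_pure\<close>)
    have "Q1.pure 1 (d 1 q) = \<zero>\<^bsub>?C1\<^esub>" using z t1(2)[OF q(1), of 1] by (simp add: q(2) a_kernel_iff)
    then have 2: "Q2.pure 1 (hQ1 (d 1 q)) = \<zero>\<^bsub>?C2\<^esub>"
      by (rule Q1.aug_hom_eq_zero[OF Q2.left_module_tensor aug_hom_comp[OF hQ(1) Q2.pure_one_aug_hom] dq])
    have zc: "z \<in> carrier ?C2" using z by (simp add: a_kernel_iff)
    have gfq': "g2 (f2 q) \<ominus>\<^bsub>Q 2\<^esub> q \<in> carrier (Q 2)" using gfq q(1) by (simp add: a_minus_def)
    have "Q2.pure 1 (d 2 (hQ2 q)) = (\<zero>\<^bsub>?C2\<^esub> \<ominus>\<^bsub>?C2\<^esub> z) \<ominus>\<^bsub>?C2\<^esub> \<zero>\<^bsub>?C2\<^esub>"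
      unfolding hQ_eq[OF q(1)] Pm(3)[OF gfq' hdq] Pm(3)[OF gfq q(1)] 1 2 q(2) ..
    interpret C2: left_module ground ?C2 by (rule Q2.left_module_tensor)
    interpret C3: left_module ground ?C3 by (rule Q3.left_module_tensor)
    from \<open>Q2.pure 1 (d 2 (hQ2 q)) = _\<close> have e: "D2 (Q3.pure 1 (hQ2 q)) = \<ominus>\<^bsub>?C2\<^esub> z"
      using zc C2.minus_zero_right by (simp add: t2(2)[OF hq] a_minus_def)
    have pc: "Q3.pure 1 (hQ2 q) \<in> carrier ?C3" by (rule Q3.pure_closed[OF hq])
    have "D2 (\<ominus>\<^bsub>?C3\<^esub> Q3.pure 1 (hQ2 q)) = z"
      using lmod_hom_uminus[OF Q3.left_module_tensor Q2.left_module_tensor t2(1) pc] e zc by simp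
    then show ?thesis using pc by (intro image_eqI[of _ _ "\<ominus>\<^bsub>?C3\<^esub> Q3.pure 1 (hQ2 q)"]) simp_all
  qed
  \<comment> \<open>As \<open>E\<close> has nothing in degree three, its homotopy says
    \<open>f (g u) - u = h (\<delta> u)\<close>, and \<open>reduce\<close> kills the right-hand side if \<open>u\<close> reduces
    to a cycle.\<close>
  have surj: "\<exists>z\<in>?Z2. T z = v" if v: "v \<in> reduced_cycles" for v
  proof -
    obtain u where u: "u \<in> carrier (E 2)" "reduce \<epsilon> (\<delta> 1 u) = (\<lambda>_. 0)" "v = reduce \<epsilon> u"
      using v by (auto simp: reduced_cycles_def)
    note gu = lmod_homD(1)[OF g(3) u(1)] and du = lmod_homD(1)[OF dE(2) u(1)]
    note fgu = lmod_homD(1)[OF f(3) gu] and hdu = lmod_homD(1)[OF hE(1) du]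
    have "Q1.pure 1 (g1 (\<delta> 1 u)) = \<zero>\<^bsub>?C1\<^esub>"
      by (rule aug_hom_free_zero[OF Q1.left_module_tensor aug_hom_comp[OF g(2) Q1.pure_one_aug_hom] du u(2)])
    then have cyc: "Q2.pure 1 (g2 u) \<in> ?Z2"
      by (simp add: a_kernel_iff Q2.pure_closed[OF gu] t1(2)[OF gu] g_comm(3)[OF u(1)])
    note rh = reduce_aug_hom[of "S 2"]
    note rm = aug_hom_minus[OF lmE lmV(1) rh]
    have "reduce \<epsilon> (hE1 (\<delta> 1 u)) = \<zero>\<^bsub>free_lmodule ground (S 2)\<^esub>"
      by (rule aug_hom_free_zero[OF lmV(1) aug_hom_comp[OF hE(1) rh] du u(2)])
    moreover have "f2 (g2 u) \<ominus>\<^bsub>E 2\<^esub> u = hE1 (\<delta> 1 u)"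
    proof -
      interpret E2: left_module B "E 2" by (rule lmE)
      have c: "f2 (g2 u) \<ominus>\<^bsub>E 2\<^esub> u \<in> carrier (E 2)" using fgu u(1) by (simp add: a_minus_def)
      show ?thesis
        using hE_eq[OF u(1)] \<delta>2[OF lmod_homD(1)[OF hE(2) u(1)]] E2.minus_eq_zero_iff[OF c hdu] by simp
    qed
    ultimately have "reduce \<epsilon> (f2 (g2 u)) \<ominus>\<^bsub>free_lmodule ground (S 2)\<^esub> reduce \<epsilon> u = \<zero>\<^bsub>free_lmodule ground (S 2)\<^esub>"
      using rm(3)[OF fgu u(1)] by simp
    then have "reduce \<epsilon> (f2 (g2 u)) = v"
      using left_module.minus_eq_zero_iff[OF lmV(1) aug_homD(1)[OF rh fgu] aug_homD(1)[OF rh u(1)]] u(3) by simp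
    then show ?thesis using cyc by (intro bexI[of _ "Q2.pure 1 (g2 u)"]) (simp_all add: T_pure[OF gu])
  qed
  interpret C1: left_module ground ?C1 by (rule Q1.left_module_tensor)
  interpret C2: left_module ground ?C2 by (rule Q2.left_module_tensor)
  interpret C3: left_module ground ?C3 by (rule Q3.left_module_tensor)
  have subZ: "submodule ?Z2 ground ?C2"
    unfolding submodule_iff[OF C2.left_module_axioms]
    using lmod_hom_zero[OF C2.left_module_axioms C1.left_module_axioms t1(1)]
    by (auto simp: a_kernel_iff lmod_homD[OF t1(1)] C2.smult_closed)
  let ?M = "?C2\<lparr>carrier := ?Z2\<rparr>"
  have lmM: "left_module ground ?M" by (rule submodule_restrict[OF C2.left_module_axioms subZ])
  have subB: "submodule (D2 ` carrier ?C3) ground ?M"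
    unfolding submodule_iff[OF lmM]
  proof (intro conjI ballI)
    show "D2 ` carrier ?C3 \<subseteq> carrier ?M" using B2(1) by auto
    show "\<zero>\<^bsub>?M\<^esub> \<in> D2 ` carrier ?C3"
      using lmod_hom_zero[OF C3.left_module_axioms C2.left_module_axioms t2(1)]
      by (intro image_eqI[of _ _ "\<zero>\<^bsub>?C3\<^esub>"]) simp_all
    show "x \<oplus>\<^bsub>?M\<^esub> y \<in> D2 ` carrier ?C3" if "x \<in> D2 ` carrier ?C3" "y \<in> D2 ` carrier ?C3" for x y
      using that by (elim imageE) (simp flip: lmod_homD(2)[OF t2(1)])
    show "a \<odot>\<^bsub>?M\<^esub> x \<in> D2 ` carrier ?C3" if "x \<in> D2 ` carrier ?C3" for a x
      using that by (elim imageE) (simp add: C3.smult_closed flip: lmod_homD(3)[OF t2(1)])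
  qed
  let ?\<tau> = "\<lambda>z. \<sigma> (T z)"
  have \<tau>: "?\<tau> \<in> lmod_hom ground ?M Z"
    by (rule lmod_homI) (use lmod_homD[OF lmod_hom_comp[OF T \<sigma>]] in \<open>simp_all add: a_kernel_iff\<close>)
  have img: "?\<tau> ` carrier ?M = carrier Z"
  proof -
    have "T ` ?Z2 = reduced_cycles" using Z2 surj by (auto simp: image_iff)
    then show ?thesis using \<sigma>_bij by (simp add: bij_betw_def flip: image_image)
  qed
  have zero_cyc: "(\<lambda>_. 0) \<in> reduced_cycles"
    using Z2[of "\<zero>\<^bsub>?C2\<^esub>"] subZ[unfolded submodule_iff[OF C2.left_module_axioms]]
      lmod_hom_zero[OF C2.left_module_axioms lmV(1) T] by (simp add: zeroV)
  have \<sigma>0: "\<sigma> (\<lambda>_. 0) = \<zero>\<^bsub>Z\<^esub>" using lmod_hom_zero[OF lmV(1) Z \<sigma>] by (simp add: zeroV)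
  have ker: "?\<tau> z = \<zero>\<^bsub>Z\<^esub> \<longleftrightarrow> z \<in> D2 ` carrier ?C3" if "z \<in> carrier ?M" for z
  proof
    have zZ: "z \<in> ?Z2" using that by simp
    { assume "?\<tau> z = \<zero>\<^bsub>Z\<^esub>"
      then have "T z = (\<lambda>_. 0)"
        using inj_onD[OF bij_betw_imp_inj_on[OF \<sigma>_bij] _ Z2[OF zZ] zero_cyc] \<sigma>0 by simp
      then show "z \<in> D2 ` carrier ?C3" by (rule B2'[OF zZ]) }
    assume "z \<in> D2 ` carrier ?C3"
    then show "?\<tau> z = \<zero>\<^bsub>Z\<^esub>" using B2(2) \<sigma>0 by simp
  qed
  have "tor_by B K Q d 2 = quot ?M (D2 ` carrier ?C3)"
    unfolding tor_by_def homology_def cycles_def D1_def D2_def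
    by (simp add: numeral_2_eq_2 numeral_3_eq_3 One_nat_def)
  then show ?thesis using lmod_isomorphic_quot[OF lmM subB Z \<tau> img ker] by simp
qed

end


section \<open>Quotients of free algebras\<close>

abbreviation free_alg :: "('k::field, 'x word \<Rightarrow>\<^sub>0 'k) module"
  where "free_alg \<equiv> free_algebra UNIV"

lemma a_inv_free_algebra:
  assumes "p \<in> carrier (free_algebra X)" shows "\<ominus>\<^bsub>free_algebra X\<^esub> p = - p"
proof -
  interpret ring "free_algebra X :: ('b, 'a word \<Rightarrow>\<^sub>0 'b) module" by (rule ring_free_algebra)
  show ?thesis using assms by (intro minus_equality) (simp_all add: free_algebra_closed)
qed

lemma left_module_free_algebra: "left_module ground (free_algebra X)"
  by (rule left_module_if_module[OF k_algebra.axioms(1)[OF k_algebra_free_algebra]])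

lemma ideal_if_two_sided:
  fixes K :: "('x word \<Rightarrow>\<^sub>0 'k::field) set"
  assumes K: "two_sided K" shows "ideal (K \<inter> carrier (free_algebra X)) (free_algebra X)"
proof (rule idealI[OF ring_free_algebra])
  show "subgroup (K \<inter> carrier (free_algebra X)) (add_monoid (free_algebra X))"
  proof
    fix x assume x: "x \<in> K \<inter> carrier (free_algebra X)"
    then have "inv\<^bsub>add_monoid (free_algebra X)\<^esub> x = - x"
      using a_inv_free_algebra[of x X] by (simp add: a_inv_def)
    then show "inv\<^bsub>add_monoid (free_algebra X)\<^esub> x \<in> K \<inter> carrier (free_algebra X)"
      using x K free_algebra_closed(3)[of x X x] by (simp add: two_sidedD)
  qed (use K in \<open>auto simp: two_sidedD free_algebra_closed\<close>)
qed (use K in \<open>simp_all add: two_sidedD free_algebra_closed\<close>)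

lemma two_sided_if_ideal:
  fixes K :: "('x word \<Rightarrow>\<^sub>0 'k::field) set"
  assumes "ideal K free_alg" shows "two_sided K"
proof -
  interpret ideal K free_alg by fact
  show ?thesis unfolding two_sided_def
    using additive_subgroup.zero_closed[OF ideal.axioms(1)[OF assms]]
      additive_subgroup.a_closed[OF ideal.axioms(1)[OF assms]] I_l_closed I_r_closed by simp
qed

lemma genideal_eq_ideal_gen: "Idl\<^bsub>free_alg\<^esub> S = ideal_gen (S :: ('x word \<Rightarrow>\<^sub>0 'k::field) set)"
proof -
  have "ideal K free_alg \<longleftrightarrow> two_sided K" for K :: "('x word \<Rightarrow>\<^sub>0 'k) set"
    using ideal_if_two_sided[of K UNIV] two_sided_if_ideal[of K] by auto
  then show ?thesis by (simp add: genideal_def ideal_gen_def)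
qed

text \<open>
  The augmentation vanishes on \<open>K\<close>, hence induces an augmentation of the quotient.
\<close>

locale free_quotient =
  fixes K :: "('x word \<Rightarrow>\<^sub>0 'k::field) set"
  assumes two_sided_K: "two_sided K" and aug_K: "K \<subseteq> length_ge 1"
begin

abbreviation A :: "('k, ('x word \<Rightarrow>\<^sub>0 'k) set) module" where "A \<equiv> quot free_alg K"

definition proj :: "('x word \<Rightarrow>\<^sub>0 'k) \<Rightarrow> ('x word \<Rightarrow>\<^sub>0 'k) set"
  where "proj p = K +>\<^bsub>free_alg\<^esub> p"

lemma ideal_K: "ideal K free_alg"
  using ideal_if_two_sided[OF two_sided_K, of UNIV] by simp

sublocale L: submodule_quotient ground free_alg K
  by (intro submodule_quotient.intro left_module_free_algebra submodule_quotient_axioms.intro)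
    (simp add: submodule_iff[OF left_module_free_algebra] two_sidedD[OF two_sided_K])

lemma A_carrier: "carrier A = range proj"
  using L.quot_carrier by (simp add: proj_def)

lemma A_cases:
  assumes "a \<in> carrier A" obtains p where "a = proj p"
  using assms unfolding A_carrier by (elim rangeE)

lemma proj_closed [simp]: "proj p \<in> carrier A"
  by (simp add: A_carrier)

lemma proj_eq_iff: "proj p = proj q \<longleftrightarrow> p - q \<in> K"
  using L.coset_eq_iff[of p q] a_inv_free_algebra[of q UNIV] by (simp add: proj_def a_minus_def)

lemma A_simps:
  "proj p \<oplus>\<^bsub>A\<^esub> proj q = proj (p + q)"
  "proj p \<otimes>\<^bsub>A\<^esub> proj q = proj (p * q)"
  "\<zero>\<^bsub>A\<^esub> = proj 0" "\<one>\<^bsub>A\<^esub> = proj 1"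
  "c \<odot>\<^bsub>A\<^esub> proj p = proj (scal c * p)"
proof -
  interpret I: ideal K free_alg by (rule ideal_K)
  show "proj p \<oplus>\<^bsub>A\<^esub> proj q = proj (p + q)" "\<zero>\<^bsub>A\<^esub> = proj 0" "c \<odot>\<^bsub>A\<^esub> proj p = proj (scal c * p)"
    using L.quot_add[of p q] L.quot_zero L.coset_zero L.quot_smult[of c p] by (simp_all add: proj_def)
  show "proj p \<otimes>\<^bsub>A\<^esub> proj q = proj (p * q)"
    using I.rcoset_mult_add[of p q] by (simp add: proj_def quot_def FactRing_def)
  show "\<one>\<^bsub>A\<^esub> = proj 1" by (simp add: proj_def quot_def FactRing_def)
qed

lemma ring_A: "ring A"
proof (rule ringI)
  show "abelian_group A" using L.left_module_quot by (simp add: left_module_def)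
  show "Group.monoid A"
    by unfold_locales (auto elim!: A_cases simp: A_simps mult.assoc)
qed (auto elim!: A_cases simp: A_simps algebra_simps)

lemma k_algebra_A: "k_algebra A"
proof -
  have "module ground A" by (rule module_if_left_module[OF L.left_module_quot cring_ground])
  moreover have "k_algebra_axioms A"
    by unfold_locales (auto elim!: A_cases simp: A_simps mult.assoc scal_left_commute)
  ultimately show ?thesis by (simp add: k_algebra_def ring_A)
qed

lemma quot_aug_proj: "quot_aug free_aug (proj p) = free_aug p"
proof -
  have "free_aug q = free_aug p" if q: "q \<in> proj p" for q
  proof -
    obtain k where "k \<in> K" "q = k + p" using q by (auto simp: proj_def a_r_coset_def')
    then show ?thesis using aug_K length_ge_1_iff[of k] by auto
  qed
  moreover have "proj p \<noteq> {}"
    using L.N.a_rcos_self[of p] by (auto simp: proj_def)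
  ultimately show ?thesis unfolding quot_aug_def by (rule the_elem_image_unique[rotated])
qed

abbreviation eps where "eps \<equiv> quot_aug free_aug"

lemma augmented_A: "augmented_algebra A eps"
proof (intro augmented_algebra.intro k_algebra_A augmented_algebra_axioms.intro)
  have "eps \<in> ring_hom A ground"
    by (rule ring_hom_memI) (auto elim!: A_cases simp: A_simps quot_aug_proj)
  moreover have "eps \<in> lmod_hom ground A ground"
    by (rule lmod_homI) (auto elim!: A_cases simp: A_simps quot_aug_proj)
  ultimately show "eps \<in> alg_hom A ground" by (simp add: alg_hom_def)
qed

lemma aug_ideal_A: "aug_ideal A eps = proj ` length_ge 1"
proof -
  have "a \<in> aug_ideal A eps \<longleftrightarrow> a \<in> proj ` length_ge 1" for a
  proof
    assume "a \<in> aug_ideal A eps"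
    then have "a \<in> carrier A" "eps a = 0" by (simp_all add: aug_ideal_def a_kernel_iff)
    then obtain p where "a = proj p" "free_aug p = 0" by (metis A_cases quot_aug_proj)
    then show "a \<in> proj ` length_ge 1" using length_ge_1_iff[of p] by simp
  next
    assume "a \<in> proj ` length_ge 1"
    then obtain p where "a = proj p" "p \<in> length_ge 1" by (elim imageE)
    then show "a \<in> aug_ideal A eps" using length_ge_1_iff[of p]
      by (simp add: aug_ideal_def a_kernel_iff quot_aug_proj)
  qed
  then show ?thesis by blast
qed

end

text \<open>
  Covers the free algebra itself (for the identity) and its quotients (for the
  projection). A monomial of length \<open>n + 1\<close> is a monomial of length \<open>n\<close> times a
  letter.
\<close>

lemma ideal_power_image:
  fixes B :: "('k::field, 'b, 'z) module_scheme" and X :: "'x set"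
  assumes add: "\<And>p q. p \<in> carrier (free_algebra X) \<Longrightarrow> q \<in> carrier (free_algebra X) \<Longrightarrow> f (p + q) = f p \<oplus>\<^bsub>B\<^esub> f q"
    and mult: "\<And>p q. p \<in> carrier (free_algebra X) \<Longrightarrow> q \<in> carrier (free_algebra X) \<Longrightarrow> f (p * q) = f p \<otimes>\<^bsub>B\<^esub> f q"
    and surj: "carrier B = f ` carrier (free_algebra X)"
    and I: "I = f ` (length_ge 1 \<inter> carrier (free_algebra X))"
  shows "ideal_power B I n = f ` (length_ge n \<inter> carrier (free_algebra X :: ('k, 'x word \<Rightarrow>\<^sub>0 'k) module))"
proof (induction n)
  case 0
  show ?case by (simp add: surj)
next
  case (Suc n)
  let ?F = "free_algebra X :: ('k, 'x word \<Rightarrow>\<^sub>0 'k) module"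
  show ?case
  proof
    show "ideal_power B I (Suc n) \<subseteq> f ` (length_ge (Suc n) \<inter> carrier ?F)"
    proof
      fix s assume "s \<in> ideal_power B I (Suc n)"
      then have "s \<in> ideal_prod B (ideal_power B I n) I" by simp
      then show "s \<in> f ` (length_ge (Suc n) \<inter> carrier ?F)"
      proof induction
        case (prod i j)
        have "i \<in> f ` (length_ge n \<inter> carrier ?F)" "j \<in> f ` (length_ge 1 \<inter> carrier ?F)"
          using prod by (simp_all only: Suc) (simp only: I)
        then obtain p q where "p \<in> length_ge n" "p \<in> carrier ?F" "i = f p" "q \<in> length_ge 1" "q \<in> carrier ?F" "j = f q"
          by (elim imageE IntE)
        then show ?case using length_ge_mult[of p n q 1]
          by (intro image_eqI[of _ _ "p * q"]) (simp_all add: mult free_algebra_closed)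
      next
        case (sum s1 s2)
        obtain p q where "p \<in> length_ge (Suc n)" "p \<in> carrier ?F" "s1 = f p" "q \<in> length_ge (Suc n)" "q \<in> carrier ?F" "s2 = f q"
          using sum.IH by (elim imageE IntE)
        then show ?case
          by (intro image_eqI[of _ _ "p + q"]) (simp_all add: add free_algebra_closed length_ge_add)
      qed
    qed
    show "f ` (length_ge (Suc n) \<inter> carrier ?F) \<subseteq> ideal_power B I (Suc n)"
    proof (rule image_subsetI)
      fix p :: "'x word \<Rightarrow>\<^sub>0 'k" assume p: "p \<in> length_ge (Suc n) \<inter> carrier ?F"
      have prod: "f q \<otimes>\<^bsub>B\<^esub> f r \<in> ideal_power B I (Suc n)"
        if "q \<in> length_ge n \<inter> carrier ?F" "r \<in> length_ge 1 \<inter> carrier ?F" for q r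
      proof -
        have "f q \<in> ideal_power B I n" unfolding Suc using that(1) by (rule imageI)
        moreover have "f r \<in> I" unfolding I using that(2) by (rule imageI)
        ultimately show ?thesis unfolding ideal_power.simps(2) by (rule ideal_prod.prod)
      qed
      have mono: "f (Poly_Mapping.single w c) \<in> ideal_power B I (Suc n)"
        if w: "Suc n \<le> length (letters w)" "set (letters w) \<subseteq> X" for w and c :: 'k
      proof -
        define u x where "u = butlast (letters w)" and "x = last (letters w)"
        have l: "letters w = u @ [x]" using w by (simp add: u_def x_def) (metis append_butlast_last_id list.size(3) not_less_eq_eq zero_le)
        then have ux: "w = Word (u @ [x])" by (metis word.collapse)
        have "Poly_Mapping.single w c = Poly_Mapping.single (Word u) c * gen x"
          by (simp add: ux gen_def mult_single plus_word_def)
        moreover have "Poly_Mapping.single (Word u) c \<in> length_ge n \<inter> carrier ?F"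
          using w l by (simp add: length_ge_def carrier_free_algebra_iff)
        moreover have "gen x \<in> length_ge 1 \<inter> carrier ?F"
          using w l gen_length_ge by simp
        ultimately show ?thesis using prod mult by simp
      qed
      have "f (\<Sum>w\<in>S. Poly_Mapping.single w (Poly_Mapping.lookup p w)) \<in> ideal_power B I (Suc n) \<and>
          (\<Sum>w\<in>S. Poly_Mapping.single w (Poly_Mapping.lookup p w)) \<in> carrier ?F"
        if "finite S" "S \<subseteq> Poly_Mapping.keys p" for S
        using that
      proof (induction S)
        case empty
        have "f (0 * 0) \<in> ideal_power B I (Suc n)"
          unfolding mult[OF free_algebra_zero free_algebra_zero]
          by (intro prod IntI two_sidedD(1)[OF two_sided_length_ge] free_algebra_zero)
        then show ?case by (simp del: ideal_power.simps)
      next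
        case (insert w S)
        have w: "Suc n \<le> length (letters w)" "set (letters w) \<subseteq> X"
          using insert.prems p by (auto simp: length_ge_def carrier_free_algebra_iff)
        have c: "Poly_Mapping.single w (Poly_Mapping.lookup p w) \<in> carrier ?F"
          using w by (simp add: carrier_free_algebra_iff)
        have IH: "f (\<Sum>w\<in>S. Poly_Mapping.single w (Poly_Mapping.lookup p w)) \<in> ideal_power B I (Suc n)"
          "(\<Sum>w\<in>S. Poly_Mapping.single w (Poly_Mapping.lookup p w)) \<in> carrier ?F"
          using insert by simp_all
        show ?case
          unfolding sum.insert[OF insert.hyps] add[OF c IH(2)]
          using ideal_prod.sum[OF mono[OF w, of "Poly_Mapping.lookup p w", unfolded ideal_power.simps(2)]
            IH(1)[unfolded ideal_power.simps(2)]]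
          by (simp add: free_algebra_closed(1)[OF c IH(2)])
      qed
      from this[OF finite_keys subset_refl] show "f p \<in> ideal_power B I (Suc n)"
        using linext_id[of p] by (simp add: linext_def scal_mult_single del: ideal_power.simps)
    qed
  qed
qed

context free_quotient
begin

lemma ideal_power_A: "ideal_power A (aug_ideal A eps) n = proj ` length_ge n"
  using ideal_power_image[of UNIV proj A "aug_ideal A eps" n] by (simp add: A_simps A_carrier aug_ideal_A)

lemma proj_in_ideal_power_iff:
  "proj p \<in> ideal_power A (aug_ideal A eps) n \<longleftrightarrow> (\<exists>q\<in>length_ge n. eqmod K p q)"
  by (auto simp: ideal_power_A image_iff proj_eq_iff eqmod_def)

lemma residually_nilpotent_A:
  assumes "\<And>p. (\<And>n. \<exists>q\<in>length_ge n. eqmod K p q) \<Longrightarrow> p \<in> K"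
  shows "residually_nilpotent A eps"
  unfolding residually_nilpotent_def
proof (intro equalityI subsetI)
  fix a assume a: "a \<in> (\<Inter>n\<in>{1..}. ideal_power A (aug_ideal A eps) n)"
  then have "a \<in> ideal_power A (aug_ideal A eps) 1" by blast
  then obtain p where p: "a = proj p" unfolding ideal_power_A by (elim imageE)
  have "\<exists>q\<in>length_ge n. eqmod K p q" for n
  proof (cases "n = 0")
    case True
    then show ?thesis by (auto intro: eqmod_refl[OF two_sided_K])
  next
    case False
    then have "proj p \<in> ideal_power A (aug_ideal A eps) n" using a p by auto
    then show ?thesis unfolding proj_in_ideal_power_iff .
  qed
  then have "p \<in> K" by (rule assms)
  then show "a \<in> {\<zero>\<^bsub>A\<^esub>}" by (simp add: p A_simps proj_eq_iff)
next
  fix a assume "a \<in> {\<zero>\<^bsub>A\<^esub>}"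
  then show "a \<in> (\<Inter>n\<in>{1..}. ideal_power A (aug_ideal A eps) n)"
    using two_sidedD(1)[OF two_sided_length_ge] by (auto simp: A_simps ideal_power_A)
qed

lemma subalg_contains_A:
  assumes H: "subalg H A" and gen: "\<And>x. proj (gen x) \<in> H" shows "carrier A \<subseteq> H"
proof -
  have sr: "subring H A" and sm: "submodule H ground A" using H by (simp_all add: subalg_def)
  note c = sm[unfolded submodule_iff[OF L.left_module_quot]]
  have one: "proj 1 \<in> H" using subringE(3)[OF sr] by (simp add: A_simps)
  have "proj p \<in> H" if "p \<in> carrier free_alg" for p
    using that
  proof (induction p rule: free_algebra_induct)
    case (scal c)
    have "c \<odot>\<^bsub>A\<^esub> proj 1 \<in> H" using one c by simp
    then show ?case by (simp add: A_simps)
  next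
    case (add p q)
    then have "proj p \<oplus>\<^bsub>A\<^esub> proj q \<in> H" using subringE(7)[OF sr] by simp
    then show ?case by (simp add: A_simps)
  next
    case (mult p q)
    then have "proj p \<otimes>\<^bsub>A\<^esub> proj q \<in> H" using subringE(6)[OF sr] by simp
    then show ?case by (simp add: A_simps)
  qed (simp_all add: gen)
  then show ?thesis by (auto simp: A_carrier)
qed

lemma subalg_carrier: "subalg (carrier A) A"
proof -
  interpret R: ring A by (rule ring_A)
  have "subring (carrier A) A" by (rule R.carrier_is_subring)
  moreover have "submodule (carrier A) ground A"
    unfolding submodule_iff[OF L.left_module_quot] by (auto elim!: A_cases simp: A_simps)
  ultimately show ?thesis by (simp add: subalg_def)
qed

lemma finitely_generated_A:
  assumes "finite (UNIV :: 'x set)" shows "finitely_generated A"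
  unfolding finitely_generated_def
proof (intro exI conjI)
  show "finite (range (\<lambda>x :: 'x. proj (gen x)))" using assms by simp
  show "range (\<lambda>x. proj (gen x)) \<subseteq> carrier A" by auto
  show "\<Inter>{H. subalg H A \<and> range (\<lambda>x. proj (gen x)) \<subseteq> H} = carrier A"
  proof
    show "\<Inter>{H. subalg H A \<and> range (\<lambda>x. proj (gen x)) \<subseteq> H} \<subseteq> carrier A"
      using subalg_carrier by (intro Inter_lower) auto
    show "carrier A \<subseteq> \<Inter>{H. subalg H A \<and> range (\<lambda>x. proj (gen x)) \<subseteq> H}"
      by (intro Inter_greatest) (auto dest!: subalg_contains_A)
  qed
qed

end

lemma (in free_quotient) ideal_proj_image:
  assumes L: "two_sided L" shows "ideal (proj ` L) A"
proof (rule idealI[OF ring_A])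
  have "submodule (proj ` L) ground A"
    unfolding submodule_iff[OF L.left_module_quot]
  proof (intro conjI ballI)
    show "proj ` L \<subseteq> carrier A" by (simp add: image_subset_iff)
    show "\<zero>\<^bsub>A\<^esub> \<in> proj ` L" unfolding A_simps by (intro imageI two_sidedD(1)[OF L])
    show "x \<oplus>\<^bsub>A\<^esub> y \<in> proj ` L" if "x \<in> proj ` L" "y \<in> proj ` L" for x y
      using that by (elim imageE) (simp only: A_simps imageI two_sidedD(2)[OF L])
    show "c \<odot>\<^bsub>A\<^esub> x \<in> proj ` L" if "x \<in> proj ` L" for c x
      using that by (elim imageE) (simp only: A_simps imageI two_sidedD(3)[OF L])
  qed
  then show "subgroup (proj ` L) (add_monoid A)" by (rule submodule.axioms)
next
  fix a x assume "a \<in> proj ` L" "x \<in> carrier A"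
  then show "x \<otimes>\<^bsub>A\<^esub> a \<in> proj ` L" "a \<otimes>\<^bsub>A\<^esub> x \<in> proj ` L"
    by (elim imageE A_cases, simp only: A_simps imageI two_sidedD(3,4)[OF L])+
qed


section \<open>The algebra is parafree\<close>

lemma relator_aug: "free_aug (relator l) = 0"
  by (simp add: relator_def)

lemma J_subset_length_ge: "J \<subseteq> length_ge 1"
  by (rule ideal_gen_minimal[OF two_sided_length_ge]) (simp add: image_subset_iff length_ge_1_iff[simplified] relator_aug)

text \<open>
  The algebra with the given relators is \<open>Q.A\<close>, and \<open>Q.proj\<close> is the projection onto
  it.
\<close>

interpretation Q: free_quotient "J :: 'k::field presalg set"
  by unfold_locales (simp_all add: two_sided_J J_subset_length_ge[simplified])

text \<open>
  The truncated geometric series inverts \<open>1 + p\<close> modulo \<open>p ^ n\<close>.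
\<close>

definition trunc_inv :: "nat \<Rightarrow> 'a::ring_1 \<Rightarrow> 'a"
  where "trunc_inv n p = (\<Sum>i<n. (- p) ^ i)"

lemma trunc_inv_right: "(1 + p) * trunc_inv n p = 1 - (- p) ^ n"
  by (induction n) (simp_all add: trunc_inv_def algebra_simps)

lemma trunc_inv_left: "trunc_inv n p * (1 + p) = 1 - (- p) ^ n"
proof (induction n)
  case (Suc n)
  have "(- p) ^ n * (- p) = (- p) * (- p) ^ n" by (rule power_commutes)
  then have "(- p) ^ n * p = p * (- p) ^ n" by simp
  with Suc show ?case by (simp add: trunc_inv_def algebra_simps)
qed (simp add: trunc_inv_def)

lemma trunc_inv_eqmod:
  assumes "p \<in> length_ge 1" and K: "two_sided K" "length_ge n \<subseteq> K"
  shows "eqmod K ((1 + p) * trunc_inv n p) 1" "eqmod K (trunc_inv n p * (1 + p)) 1"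
proof -
  have "- p \<in> length_ge 1" by (rule two_sidedD(5)[OF two_sided_length_ge assms(1)])
  from subsetD[OF K(2) length_ge_power[OF this]] have "(- p) ^ n \<in> K" .
  then have "- ((- p) ^ n) \<in> K" by (rule two_sidedD(5)[OF K(1)])
  then show "eqmod K ((1 + p) * trunc_inv n p) 1" "eqmod K (trunc_inv n p * (1 + p)) 1"
    unfolding eqmod_def trunc_inv_left trunc_inv_right by simp_all
qed

lemma alg_map_trunc_inv: "alg_map f \<Longrightarrow> f (trunc_inv n p) = trunc_inv n (f p)"
  by (simp add: trunc_inv_def alg_map.sum alg_map.power alg_map.uminus)

lemma free_aug_trunc_inv: "free_aug p = 0 \<Longrightarrow> 0 < n \<Longrightarrow> free_aug (trunc_inv n p) = 1"
  by (cases n) (simp_all add: trunc_inv_def free_aug_sum sum.lessThan_Suc_shift del: sum.lessThan_Suc)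

text \<open>
  The identity \<open>D (g B g^-1)^l g C = A B^l C\<close> for \<open>D g = A\<close>, modulo an ideal and with
  \<open>g'\<close> in the place of \<open>g^-1\<close>.
\<close>

lemma conjugate_relators:
  fixes a b c d g g' :: "'a::ring_1"
  assumes K: "two_sided K" and dg: "eqmod K (d * g) a" and g'g: "eqmod K (g' * g) 1"
  shows "eqmod K (d * (g * b * g') ^ l * (g * c)) (a * b ^ l * c)"
proof -
  note r = eqmod_refl[OF K] and m = eqmod_mult[OF K] and t = eqmod_trans[OF K]
  have 1: "eqmod K ((g * b * g') ^ l * g) (g * b ^ l)"
  proof (induction l)
    case (Suc l)
    have "eqmod K ((g * b * g') ^ Suc l * g) (g * b * g' * (g * b ^ l))"
      using m[OF r Suc, of "g * b * g'"] by (simp add: mult.assoc)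
    moreover have "eqmod K (g * b * g' * (g * b ^ l)) (g * b ^ Suc l)"
      using m[OF m[OF r[of "g * b"] g'g] r[of "b ^ l"]] by (simp add: mult.assoc)
    ultimately show ?case by (rule t)
  qed (simp add: r)
  have "eqmod K (d * (g * b * g') ^ l * (g * c)) (d * (g * b ^ l) * c)"
    using m[OF m[OF r[of d] 1] r[of c]] by (simp add: mult.assoc)
  moreover have "eqmod K (d * (g * b ^ l) * c) (a * b ^ l * c)"
    using m[OF dg r[of "b ^ l * c"]] by (simp add: mult.assoc)
  ultimately show ?thesis by (rule t)
qed

abbreviation rank_four :: "nat set" where "rank_four \<equiv> {0, 1, 2, 3}"

definition incl :: "(nat word \<Rightarrow>\<^sub>0 'k::field) \<Rightarrow> 'k presalg"
  where "incl = free_hom (\<lambda>i. gen ([La, Lb, Lc, Ld] ! i))"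

text \<open>
  The element \<open>g = (1 + d)^-1 (1 + a)\<close> up to degree \<open>n\<close>; its inverse is obtained by
  exchanging \<open>a\<close> and \<open>d\<close>.
\<close>

definition cofactor :: "nat \<Rightarrow> 'a::ring_1 \<Rightarrow> 'a \<Rightarrow> 'a"
  where "cofactor n a d = trunc_inv n d * (1 + a)"

text \<open>
  The solution of the relations for \<open>x\<close> and \<open>y\<close> in terms of \<open>a\<close>, \<open>b\<close>, \<open>c\<close>, \<open>d\<close> up to
  degree \<open>n\<close>. It defines a homomorphism inverse to \<open>incl\<close> modulo \<open>n\<close>-th powers of the
  augmentation ideals.
\<close>

fun approx_gen :: "nat \<Rightarrow> letter \<Rightarrow> nat word \<Rightarrow>\<^sub>0 'k::field" where
  "approx_gen n La = gen 0"
| "approx_gen n Lb = gen 1"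
| "approx_gen n Lc = gen 2"
| "approx_gen n Ld = gen 3"
| "approx_gen n Lx = cofactor n (gen 0) (gen 3) * (1 + gen 1) * cofactor n (gen 3) (gen 0) - 1"
| "approx_gen n Ly = cofactor n (gen 0) (gen 3) * (1 + gen 2) - 1"

definition approx :: "nat \<Rightarrow> 'k::field presalg \<Rightarrow> nat word \<Rightarrow>\<^sub>0 'k"
  where "approx n = free_hom (approx_gen n)"

interpretation incl: alg_map incl
  unfolding incl_def by (rule alg_map_free_hom)

interpretation approx: alg_map "approx n" for n
  unfolding approx_def by (rule alg_map_free_hom)

lemma incl_gen: "incl (gen 0) = gen La" "incl (gen 1) = gen Lb" "incl (gen (Suc 0)) = gen Lb"
  "incl (gen 2) = gen Lc" "incl (gen 3) = gen Ld"
  by (simp_all add: incl_def numeral_2_eq_2 numeral_3_eq_3)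

lemma approx_gen_eq: "approx n (gen s) = approx_gen n s"
  by (simp add: approx_def)

lemma incl_length_ge: "p \<in> length_ge n \<Longrightarrow> incl p \<in> length_ge n"
  unfolding incl_def by (rule free_hom_length_ge) simp

lemma cofactor_eqmod:
  assumes a: "a \<in> length_ge 1" and d: "d \<in> length_ge 1" and K: "two_sided K" "length_ge n \<subseteq> K"
  shows "eqmod K ((1 + d) * cofactor n a d) (1 + a)" "eqmod K (cofactor n d a * cofactor n a d) 1"
proof -
  note r = eqmod_refl[OF K(1)] and m = eqmod_mult[OF K(1)] and t = eqmod_trans[OF K(1)]
  have "eqmod K ((1 + d) * trunc_inv n d * (1 + a)) (1 * (1 + a))"
    by (intro m r trunc_inv_eqmod[OF d K])
  then show "eqmod K ((1 + d) * cofactor n a d) (1 + a)" by (simp add: cofactor_def mult.assoc)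
  have "eqmod K (trunc_inv n a * ((1 + d) * trunc_inv n d) * (1 + a)) (trunc_inv n a * 1 * (1 + a))"
    by (intro m r trunc_inv_eqmod[OF d K])
  from t[OF this, of 1] show "eqmod K (cofactor n d a * cofactor n a d) 1"
    using trunc_inv_eqmod(2)[OF a K] by (simp add: cofactor_def mult.assoc)
qed

lemma approx_length_ge:
  assumes n: "0 < n" and p: "p \<in> length_ge m"
  shows "approx n p \<in> length_ge m"
  unfolding approx_def
proof (rule free_hom_length_ge[OF _ p])
  show "free_aug (approx_gen n s) = 0" for s
    by (cases s) (simp_all add: cofactor_def free_aug_trunc_inv n)
qed

lemma approx_relator: "approx n (relator l :: 'k::field presalg) \<in> length_ge n"
proof -
  let ?g = "cofactor n (gen 0) (gen 3) :: nat word \<Rightarrow>\<^sub>0 'k" and ?g' = "cofactor n (gen 3) (gen 0) :: nat word \<Rightarrow>\<^sub>0 'k"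
  let ?a = "1 + gen 0 :: nat word \<Rightarrow>\<^sub>0 'k" and ?b = "1 + gen 1 :: nat word \<Rightarrow>\<^sub>0 'k"
    and ?c = "1 + gen 2 :: nat word \<Rightarrow>\<^sub>0 'k" and ?d = "1 + gen 3 :: nat word \<Rightarrow>\<^sub>0 'k"
  have L: "two_sided (length_ge n :: (nat word \<Rightarrow>\<^sub>0 'k) set)" by (rule two_sided_length_ge)
  have "eqmod (length_ge n) (?d * (?g * ?b * ?g') ^ l * (?g * ?c)) (?a * ?b ^ l * ?c)"
    by (intro conjugate_relators[OF L] cofactor_eqmod[OF gen_length_ge gen_length_ge L subset_refl])
  then have "?a * ?b ^ l * ?c - ?d * (?g * ?b * ?g') ^ l * (?g * ?c) \<in> length_ge n"
    using eqmod_sym[OF L] by (simp add: eqmod_def)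
  then show ?thesis
    by (simp add: relator_def approx.simps approx_gen_eq)
qed

lemma approx_J: "p \<in> J \<Longrightarrow> approx n p \<in> length_ge n"
proof -
  have "J \<subseteq> {p :: 'a presalg. approx n p \<in> length_ge n}"
    by (rule ideal_gen_minimal[OF two_sided_vimage[OF approx.alg_map_axioms two_sided_length_ge]])
      (simp add: image_subset_iff approx_relator)
  from subsetD[OF this] show "p \<in> J \<Longrightarrow> approx n p \<in> length_ge n" by simp
qed

lemma approx_incl:
  assumes "p \<in> carrier (free_algebra rank_four)" shows "approx n (incl p) = p"
  using assms
  by (rule alg_maps_eq[OF alg_map_comp[OF incl.alg_map_axioms approx.alg_map_axioms] alg_map_id, rotated])
    (auto simp: incl_gen approx_gen_eq)

lemma trunc_inv_closed:
  "p \<in> carrier (free_algebra X) \<Longrightarrow> trunc_inv n p \<in> carrier (free_algebra X)"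
proof (induction n)
  case (Suc n)
  have "(- p) ^ n \<in> carrier (free_algebra X)"
    using Suc.prems by (rule free_algebra_closed(5)[OF free_algebra_closed(3)]) (use Suc.prems in simp_all)
  with Suc show ?case by (simp add: trunc_inv_def free_algebra_closed(1))
qed (simp add: trunc_inv_def)

lemma approx_closed: "approx n p \<in> carrier (free_algebra rank_four)"
  unfolding approx_def
proof (rule free_hom_carrier[where Y = UNIV])
  show "approx_gen n s \<in> carrier (free_algebra rank_four)" for s
    by (cases s) (simp_all add: cofactor_def free_algebra_closed trunc_inv_closed)
qed simp

text \<open>
  Modulo \<open>J\<close> the relation for \<open>l = 0\<close> gives \<open>1 + y = g (1 + c)\<close>. Then the relation for
  \<open>l = 1\<close> gives \<open>(1 + x) g (1 + c) = g (1 + b) (1 + c)\<close>, and \<open>1 + c\<close> and \<open>g\<close> can be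
  cancelled up to degree \<open>n\<close>.
\<close>

lemma incl_approx:
  fixes K :: "'k::field presalg set"
  assumes K: "two_sided K" "length_ge n \<subseteq> K" "J \<subseteq> K"
  shows "eqmod K (incl (approx n p)) p"
proof (rule alg_maps_eqmod[OF alg_map_comp[OF approx.alg_map_axioms incl.alg_map_axioms] alg_map_id K(1)])
  note r = eqmod_refl[OF K(1)] and m = eqmod_mult[OF K(1)] and s = eqmod_sym[OF K(1)]
  note [trans] = eqmod_trans[OF K(1)]
  let ?L = "\<lambda>s. 1 + gen s :: 'k presalg" and ?i = "\<lambda>s. trunc_inv n (gen s) :: 'k presalg"
  let ?g = "cofactor n (gen La) (gen Ld) :: 'k presalg" and ?g' = "cofactor n (gen Ld) (gen La) :: 'k presalg"
  note inv = trunc_inv_eqmod[OF gen_length_ge K(1,2)]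
  note cof = cofactor_eqmod[OF gen_length_ge gen_length_ge K(1,2)]
  note inv' = inv[THEN s] and cof' = cof[THEN s]
  have e: "eqmod K (?L Ld * ?L Lx ^ l * ?L Ly) (?L La * ?L Lb ^ l * ?L Lc)" for l
    using s[of "?L La * ?L Lb ^ l * ?L Lc"] relator_in_J[of l] K(3) by (auto simp: eqmod_def relator_def)
  have y: "eqmod K (?L Ly) (?g * ?L Lc)"
  proof -
    have "eqmod K (1 * ?L Ly) (?i Ld * ?L Ld * ?L Ly)" by (intro m r inv')
    also have "?i Ld * ?L Ld * ?L Ly = ?i Ld * (?L Ld * ?L Lx ^ 0 * ?L Ly)" by (simp add: mult.assoc)
    also have "eqmod K \<dots> (?i Ld * (?L La * ?L Lb ^ 0 * ?L Lc))" by (intro m r e)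
    also have "?i Ld * (?L La * ?L Lb ^ 0 * ?L Lc) = ?g * ?L Lc" by (simp add: cofactor_def mult.assoc)
    finally show ?thesis by simp
  qed
  have x: "eqmod K (?L Lx) (?g * ?L Lb * ?g')"
  proof -
    have 1: "eqmod K (?L Lx * (?g * ?L Lc)) (?g * ?L Lb * ?L Lc)"
    proof -
      have "eqmod K (1 * ?L Lx * (?g * ?L Lc)) (?i Ld * ?L Ld * ?L Lx * ?L Ly)" by (intro m r inv' s[OF y])
      also have "?i Ld * ?L Ld * ?L Lx * ?L Ly = ?i Ld * (?L Ld * ?L Lx ^ 1 * ?L Ly)" by (simp add: mult.assoc)
      also have "eqmod K \<dots> (?i Ld * (?L La * ?L Lb ^ 1 * ?L Lc))" by (intro m r e)
      also have "?i Ld * (?L La * ?L Lb ^ 1 * ?L Lc) = ?g * ?L Lb * ?L Lc" by (simp add: cofactor_def mult.assoc)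
      finally show ?thesis by simp
    qed
    have "eqmod K (?L Lx * 1 * 1) (?L Lx * (?g * ?g') * 1)" by (intro m r cof')
    also have "eqmod K \<dots> (?L Lx * (?g * 1 * ?g'))" by (simp add: r)
    also have "eqmod K \<dots> (?L Lx * (?g * (?L Lc * ?i Lc) * ?g'))" by (intro m r inv')
    also have "?L Lx * (?g * (?L Lc * ?i Lc) * ?g') = ?L Lx * (?g * ?L Lc) * (?i Lc * ?g')" by (simp add: mult.assoc)
    also have "eqmod K \<dots> (?g * ?L Lb * ?L Lc * (?i Lc * ?g'))" by (intro m r 1)
    also have "?g * ?L Lb * ?L Lc * (?i Lc * ?g') = ?g * ?L Lb * (?L Lc * ?i Lc) * ?g'" by (simp add: mult.assoc)
    also have "eqmod K \<dots> (?g * ?L Lb * 1 * ?g')" by (intro m r inv)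
    finally show ?thesis by simp
  qed
  have map: "incl (cofactor n u v) = cofactor n (incl u) (incl v)" for u v :: "nat word \<Rightarrow>\<^sub>0 'k"
    by (simp add: cofactor_def incl.simps alg_map_trunc_inv[OF incl.alg_map_axioms])
  have sub: "eqmod K (u - 1) v" if "eqmod K (1 + v) u" for u v
    using s[OF that] by (simp add: eqmod_def algebra_simps)
  show "eqmod K (incl (approx n (gen t))) (gen t)" if "t \<in> UNIV" for t
    by (cases t) (simp_all add: approx_gen_eq incl.simps incl_gen map r sub[OF x] sub[OF y])
qed simp

lemma two_sided_J_plus: "two_sided {x + y | x y. x \<in> J \<and> y \<in> length_ge n}"
  by (rule two_sided_sum_set[OF two_sided_J two_sided_length_ge])

text \<open>
  The induced map on the quotients by \<open>n\<close>-th powers is injective because \<open>approx n\<close> is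
  a left inverse of \<open>incl\<close> and maps \<open>J\<close> to elements of length at least \<open>n\<close>, and
  surjective because \<open>incl (approx n p)\<close> differs from \<open>p\<close> by an element of \<open>J + I^n\<close>.
\<close>

theorem para_equivalence_incl:
  "para_equivalence (free_algebra rank_four :: ('k::field, nat word \<Rightarrow>\<^sub>0 'k) module) free_aug Q.A Q.eps (\<lambda>p. Q.proj (incl p))"
proof -
  let ?F = "free_algebra rank_four :: ('k, nat word \<Rightarrow>\<^sub>0 'k) module"
  let ?A = "Q.A :: ('k, 'k presalg set) module"
  let ?f = "\<lambda>p :: nat word \<Rightarrow>\<^sub>0 'k. Q.proj (incl p)"
  interpret A: augmented_algebra ?A Q.eps by (rule Q.augmented_A)
  interpret F: ring ?F by (rule ring_free_algebra)
  have rh: "?f \<in> ring_hom ?F ?A"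
    by (rule ring_hom_memI) (simp_all add: incl.simps Q.A_simps)
  have lh: "?f \<in> lmod_hom ground ?F ?A"
    by (rule lmod_homI) (simp_all add: incl.simps Q.A_simps)
  have fa: "free_aug (incl p) = free_aug p" for p :: "nat word \<Rightarrow>\<^sub>0 'k"
  proof -
    have "p - scal (free_aug p) \<in> length_ge 1" using length_ge_1_iff[of "p - scal (free_aug p)"] by simp
    from incl_length_ge[OF this] show ?thesis
      using length_ge_1_iff[of "incl (p - scal (free_aug p))"] by (simp add: incl.simps)
  qed
  have ideal_F: "ideal_power ?F (aug_ideal ?F free_aug) n = length_ge n \<inter> carrier ?F" for n
  proof -
    have "aug_ideal ?F free_aug = length_ge 1 \<inter> carrier ?F"
      by (rule Set.set_eqI) (unfold Int_iff length_ge_1_iff aug_ideal_def a_kernel_iff, simp add: conj_commute)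
    then show ?thesis using ideal_power_image[of rank_four "\<lambda>p. p" ?F "aug_ideal ?F free_aug" n] by simp
  qed
  have iso: "\<exists>\<phi>\<in>ring_iso (?F Quot ideal_power ?F (aug_ideal ?F free_aug) n)
        (?A Quot ideal_power ?A (aug_ideal ?A Q.eps) n).
      \<forall>x\<in>carrier ?F. \<phi> (ideal_power ?F (aug_ideal ?F free_aug) n +>\<^bsub>?F\<^esub> x) =
        ideal_power ?A (aug_ideal ?A Q.eps) n +>\<^bsub>?A\<^esub> ?f x" if n: "1 \<le> n" for n
  proof -
    define I where "I = ideal_power ?F (aug_ideal ?F free_aug) n"
    define I' where "I' = ideal_power ?A (aug_ideal ?A Q.eps) n"
    have I': "ideal I' ?A"
      unfolding I'_def Q.ideal_power_A by (rule Q.ideal_proj_image[OF two_sided_length_ge])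
    interpret I': ideal I' ?A by (rule I')
    have I'_proj: "Q.proj p \<in> I' \<longleftrightarrow> (\<exists>q\<in>length_ge n. eqmod J p q)" for p
      unfolding I'_def by (rule Q.proj_in_ideal_power_iff)
    define h where "h = (\<lambda>x. I' +>\<^bsub>?A\<^esub> ?f x)"
    have "ring_hom_ring ?F (?A Quot I') h"
    proof (rule ring_hom_ringI2[OF F.ring_axioms I'.quotient_is_ring])
      show "h \<in> ring_hom ?F (?A Quot I')"
        using ring_hom_trans[OF rh I'.rcos_ring_hom] by (simp add: h_def comp_def)
    qed
    then interpret h: ring_hom_ring ?F "?A Quot I'" h .
    have zero: "\<zero>\<^bsub>?A Quot I'\<^esub> = I'" by (simp add: FactRing_def)
    have coset0: "I' +>\<^bsub>?A\<^esub> a = I' \<longleftrightarrow> a \<in> I'" if "a \<in> carrier ?A" for a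
      using I'.a_rcos_const[of a] I'.a_rcos_self[OF that] by auto
    have ker: "a_kernel ?F (?A Quot I') h = I"
    proof -
      have "h x = I' \<longleftrightarrow> x \<in> length_ge n" if x: "x \<in> carrier ?F" for x
      proof -
        have "h x = I' \<longleftrightarrow> (\<exists>q\<in>length_ge n. eqmod J (incl x) q)"
          by (simp add: h_def coset0 I'_proj)
        also have "\<dots> \<longleftrightarrow> x \<in> length_ge n"
        proof
          assume "\<exists>q\<in>length_ge n. eqmod J (incl x) q"
          then obtain q where q: "q \<in> length_ge n" "eqmod J (incl x) q" by blast
          then have "approx n (incl x - q) + approx n q \<in> length_ge n"
            using n by (intro length_ge_add[OF approx_J approx_length_ge]) (simp_all add: eqmod_def)
          then show "x \<in> length_ge n" by (simp add: approx.simps approx_incl[OF x])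
        next
          assume "x \<in> length_ge n"
          then show "\<exists>q\<in>length_ge n. eqmod J (incl x) q"
            by (intro bexI[of _ "incl x"] incl_length_ge eqmod_refl[OF two_sided_J])
        qed
        finally show ?thesis .
      qed
      note iff = this
      show ?thesis
      proof (rule Set.set_eqI)
        show "x \<in> a_kernel ?F (?A Quot I') h \<longleftrightarrow> x \<in> I" for x
          unfolding I_def ideal_F a_kernel_iff zero Int_iff
          by (cases "x \<in> carrier ?F") (simp_all only: iff simp_thms)
      qed
    qed
    have surj: "h ` carrier ?F = carrier (?A Quot I')"
    proof
      show "h ` carrier ?F \<subseteq> carrier (?A Quot I')" by (rule image_subsetI) (rule h.hom_closed)
      show "carrier (?A Quot I') \<subseteq> h ` carrier ?F"
      proof
        fix X assume "X \<in> carrier (?A Quot I')"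
        then have "X \<in> (\<Union>a\<in>carrier ?A. {I' +>\<^bsub>?A\<^esub> a})"
          by (simp add: FactRing_def A_RCOSETS_def')
        then obtain a where a: "a \<in> carrier ?A" "X = I' +>\<^bsub>?A\<^esub> a" by (elim UN_E singletonE)
        obtain p where "a = Q.proj p" using a(1) by (rule Q.A_cases)
        with a have X: "X = I' +>\<^bsub>?A\<^esub> Q.proj p" by simp
        have "x \<in> {x + y | x y. x \<in> J \<and> y \<in> length_ge n}"
          if "x \<in> J \<or> x \<in> length_ge n" for x :: "'k presalg"
        proof -
          have "\<exists>u v. x = u + v \<and> u \<in> J \<and> v \<in> length_ge n"
            using that
          proof
            assume "x \<in> J"
            then show ?thesis by (intro exI[of _ x] exI[of _ 0]) (simp add: two_sidedD(1)[OF two_sided_length_ge])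
          next
            assume "x \<in> length_ge n"
            then show ?thesis by (intro exI[of _ 0] exI[of _ x]) (simp add: two_sidedD(1)[OF two_sided_J])
          qed
          then show ?thesis by (rule CollectI)
        qed
        then have "eqmod {x + y | x y. x \<in> J \<and> y \<in> length_ge n} (incl (approx n p)) p"
          by (intro incl_approx two_sided_J_plus subsetI) simp_all
        then obtain y z where "incl (approx n p) - p = y + z" "y \<in> J" "z \<in> length_ge n"
          unfolding eqmod_def[of "{x + y | x y. x \<in> J \<and> y \<in> length_ge n}"] by (elim CollectE exE conjE)
        then have z: "z \<in> length_ge n" "eqmod J (incl (approx n p) - p) z"
          by (simp_all add: eqmod_def)
        then have "Q.proj (incl (approx n p)) = Q.proj z \<oplus>\<^bsub>?A\<^esub> Q.proj p"
          by (simp add: Q.A_simps Q.proj_eq_iff eqmod_def algebra_simps)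
        moreover have "Q.proj z \<in> I'" by (intro I'_proj[THEN iffD2] bexI[of _ z] eqmod_refl[OF two_sided_J] z(1))
        ultimately have "Q.proj (incl (approx n p)) \<in> I' +>\<^bsub>?A\<^esub> Q.proj p"
          unfolding a_r_coset_def' by (intro UN_I[of "Q.proj z"]) simp_all
        then have "X = h (approx n p)"
          unfolding X h_def by (rule A.a_repr_independence[OF _ Q.proj_closed I'.a_subgroup])
        then show "X \<in> h ` carrier ?F" by (rule image_eqI) (rule approx_closed)
      qed
    qed
    have "(\<lambda>X. the_elem (h ` X)) \<in> ring_iso (?F Quot I) (?A Quot I')"
      using h.FactRing_iso_set[OF surj] unfolding ker .
    moreover have "the_elem (h ` (I +>\<^bsub>?F\<^esub> x)) = I' +>\<^bsub>?A\<^esub> ?f x" if "x \<in> carrier ?F" for x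
      using h.the_elem_simp[OF that] unfolding ker by (simp only: h_def)
    ultimately show ?thesis unfolding I_def[symmetric] I'_def[symmetric]
      by (intro bexI[of _ "\<lambda>X. the_elem (h ` X)"]) simp_all
  qed
  show ?thesis
    unfolding para_equivalence_def Let_def using rh lh fa iso
    by (simp add: alg_hom_def Q.quot_aug_proj)
qed

theorem parafree_A: "parafree_of_rank 4 (Q.A :: ('k::field, 'k presalg set) module) Q.eps"
  unfolding parafree_of_rank_def
proof (intro conjI exI)
  show "augmented_algebra (Q.A :: ('k, 'k presalg set) module) Q.eps" by (rule Q.augmented_A)
  show "residually_nilpotent (Q.A :: ('k, 'k presalg set) module) Q.eps"
    by (rule Q.residually_nilpotent_A[OF J_separated])
  show "para_equivalence (free_algebra rank_four) free_aug (Q.A :: ('k, 'k presalg set) module) Q.eps (\<lambda>p. Q.proj (incl p))"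
    by (rule para_equivalence_incl)
qed simp_all


section \<open>The algebra is not finitely presented\<close>

text \<open>
  \<open>J\<close> is the union of the chain of these ideals, which turns out to be strictly
  increasing.
\<close>

definition partial_J :: "nat \<Rightarrow> 'k::field presalg set"
  where "partial_J N = ideal_gen (relator ` {..N})"

lemma partial_J_mono: "M \<le> N \<Longrightarrow> partial_J M \<subseteq> partial_J N"
  unfolding partial_J_def
  by (rule ideal_gen_minimal[OF two_sided_ideal_gen], rule order_trans[OF _ ideal_gen_superset])
    (auto intro!: imageI)

lemma J_eq_Union:
  fixes p :: "'k::field presalg"
  assumes "p \<in> J" shows "\<exists>N. p \<in> partial_J N"
proof -
  have ts: "two_sided (partial_J N :: 'k presalg set)" for N unfolding partial_J_def by (rule two_sided_ideal_gen)
  have "two_sided {p :: 'k presalg. \<exists>N. p \<in> partial_J N}"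
    unfolding two_sided_def mem_Collect_eq
  proof (intro conjI ballI allI)
    show "\<exists>N. (0 :: 'k presalg) \<in> partial_J N" using two_sidedD(1)[OF ts] by (rule exI)
    fix x a :: "'k presalg" assume "x \<in> {p. \<exists>N. p \<in> partial_J N}"
    then obtain M where M: "x \<in> partial_J M" by (elim CollectE exE)
    show "\<exists>N. a * x \<in> partial_J N" using two_sidedD(3)[OF ts M] by (rule exI)
    show "\<exists>N. x * a \<in> partial_J N" using two_sidedD(4)[OF ts M] by (rule exI)
    fix y :: "'k presalg" assume "y \<in> {p. \<exists>N. p \<in> partial_J N}"
    then obtain N where N: "y \<in> partial_J N" by (elim CollectE exE)
    have "x \<in> partial_J (max M N)" "y \<in> partial_J (max M N)"
      using subsetD[OF partial_J_mono M] subsetD[OF partial_J_mono N] by simp_all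
    then have "x + y \<in> partial_J (max M N)" by (rule two_sidedD(2)[OF ts])
    then show "\<exists>N. x + y \<in> partial_J N" by (rule exI)
  qed
  moreover have "range relator \<subseteq> {p :: 'k presalg. \<exists>N. p \<in> partial_J N}"
  proof (rule image_subsetI, rule CollectI, rule exI)
    show "(relator l :: 'k presalg) \<in> partial_J l" for l
      unfolding partial_J_def by (rule subsetD[OF ideal_gen_superset]) simp
  qed
  ultimately have "J \<subseteq> {p :: 'k presalg. \<exists>N. p \<in> partial_J N}" by (rule ideal_gen_minimal)
  from subsetD[OF this assms] show ?thesis by simp
qed

lemma finite_subset_J:
  assumes "finite T" "T \<subseteq> J" shows "\<exists>N. T \<subseteq> partial_J N"
  using assms
proof (induction T)
  case (insert x T)
  then obtain N where N: "T \<subseteq> partial_J N" by auto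
  obtain M where M: "x \<in> partial_J M" using J_eq_Union insert.prems by auto
  have "insert x T \<subseteq> partial_J (max M N)"
    using M N partial_J_mono[of M "max M N"] partial_J_mono[of N "max M N"] by auto
  then show ?case by (rule exI)
qed simp

lemma replicate_append_eq:
  "replicate l x @ y # u = replicate m x @ y # v \<Longrightarrow> x \<noteq> y \<Longrightarrow> l = m \<and> u = v"
proof (induction l arbitrary: m)
  case 0
  then show ?case by (cases m) auto
next
  case (Suc l)
  then show ?case by (cases m) auto
qed

lemma relator_not_in_partial_J: "(relator (Suc N) :: 'k::field presalg) \<notin> partial_J N"
proof
  assume mem: "(relator (Suc N) :: 'k presalg) \<in> partial_J N"
  define \<tau> :: "'k presalg \<Rightarrow> 'k presalg" where "\<tau> = free_hom (\<lambda>s. gen s - 1)"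
  interpret \<tau>: alg_map \<tau> unfolding \<tau>_def by (rule alg_map_free_hom)
  have \<tau>_gen: "\<tau> (1 + gen s) = gen s" for s by (simp only: \<tau>.add \<tau>.one) (simp add: \<tau>_def)
  let ?m = "\<lambda>w. Poly_Mapping.single (Word w) (1 :: 'k)"
  have \<tau>_rel: "\<tau> (relator l) = ?m (La # replicate l Lb @ [Lc]) - ?m (Ld # replicate l Lx @ [Ly])" for l
    by (simp only: relator_def \<tau>.diff \<tau>.mult \<tau>.power \<tau>_gen single_word_simps mult.assoc mult_1_right)
  \<comment> \<open>\<open>\<tau>\<close> turns relators into differences of two words, and \<open>w0\<close> is the
    second word of the relator with index \<open>N + 1\<close>. It has no word of a previous relator as
    a factor, so \<open>K\<close> contains the previous relators.\<close>
  define w0 where "w0 = Ld # replicate (Suc N) Lx @ [Ly]"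
  let ?c = "\<lambda>p :: 'k presalg. Poly_Mapping.lookup p (Word w0)"
  define K where "K = {p. \<forall>u v. ?c (u * \<tau> p * v) = 0}"
  have "two_sided K"
    unfolding two_sided_def
  proof (intro conjI ballI allI)
    show "0 \<in> K" by (simp add: K_def)
    show "x + y \<in> K" if "x \<in> K" "y \<in> K" for x y
      using that by (simp add: K_def \<tau>.add distrib_left distrib_right lookup_add)
    fix x a assume x: "x \<in> K"
    have "?c (u * \<tau> (a * x) * v) = 0" for u v
      using x[unfolded K_def, THEN CollectD, rule_format, of "u * \<tau> a" v] by (simp add: \<tau>.mult mult.assoc)
    then show "a * x \<in> K" by (simp add: K_def)
    have "?c (u * \<tau> (x * a) * v) = 0" for u v
      using x[unfolded K_def, THEN CollectD, rule_format, of u "\<tau> a * v"] by (simp add: \<tau>.mult mult.assoc)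
    then show "x * a \<in> K" by (simp add: K_def)
  qed
  moreover have "relator ` {..N} \<subseteq> K"
  proof (rule image_subsetI)
    fix l assume "l \<in> {..N}"
    then have l: "l \<le> N" by simp
    have ne: "u @ (La # replicate l Lb @ [Lc]) @ v \<noteq> w0" "u @ (Ld # replicate l Lx @ [Ly]) @ v \<noteq> w0" for u v
    proof -
      have "La \<in> set (u @ (La # replicate l Lb @ [Lc]) @ v)" "La \<notin> set w0" by (auto simp: w0_def)
      then show "u @ (La # replicate l Lb @ [Lc]) @ v \<noteq> w0" by auto
      show "u @ (Ld # replicate l Lx @ [Ly]) @ v \<noteq> w0"
      proof
        assume e: "u @ (Ld # replicate l Lx @ [Ly]) @ v = w0"
        show False
        proof (cases u)
          case Nil
          then show False using e replicate_append_eq[of l Lx Ly v "Suc N" "[]"] l by (simp add: w0_def)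
        next
          case (Cons s u')
          then have "u' @ (Ld # replicate l Lx @ [Ly]) @ v = replicate (Suc N) Lx @ [Ly]" using e by (simp add: w0_def)
          then have "Ld \<in> set (replicate (Suc N) Lx @ [Ly])" by (metis in_set_conv_decomp append_Cons)
          then show False by simp
        qed
      qed
    qed
    have "?c (u * \<tau> (relator l) * v) = 0" for u v
    proof (induction u rule: poly_mapping_single_induct)
      case (single u c)
      show ?case
      proof (induction v rule: poly_mapping_single_induct)
        case (single v d)
        show ?case using ne[of "letters u" "letters v"]
          by (simp add: \<tau>_rel right_diff_distrib left_diff_distrib mult_single plus_word_def lookup_minus
              lookup_single when_def)
      next
        case (add v v')
        then show ?case by (simp add: distrib_left lookup_add)
      qed
    next
      case (add u u')
      then show ?case by (simp add: distrib_right lookup_add)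
    qed
    then show "relator l \<in> K" by (simp add: K_def)
  qed
  ultimately have "partial_J N \<subseteq> K" unfolding partial_J_def by (rule ideal_gen_minimal)
  then have "relator (Suc N) \<in> K" using mem by (rule subsetD)
  then have "?c (1 * \<tau> (relator (Suc N)) * 1) = 0" unfolding K_def by blast
  then show False by (simp add: \<tau>_rel lookup_minus lookup_single w0_def when_def)
qed

lemma J_not_finitely_generated:
  assumes T: "finite T" "T \<subseteq> J" shows "\<not> (J :: 'k::field presalg set) \<subseteq> ideal_gen T"
proof
  assume J: "(J :: 'k presalg set) \<subseteq> ideal_gen T"
  obtain N where "T \<subseteq> partial_J N" using finite_subset_J[OF T] by (elim exE)
  then have "ideal_gen T \<subseteq> partial_J N"
    unfolding partial_J_def by (rule ideal_gen_minimal[OF two_sided_ideal_gen])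
  with J have "(J :: 'k presalg set) \<subseteq> partial_J N" by (rule order_trans)
  from subsetD[OF this relator_in_J[of "Suc N"]] show False using relator_not_in_partial_J by (rule notE[rotated])
qed

text \<open>
  Finite presentability does not depend on the finite generating set. Given a
  presentation with generators \<open>X\<close> and relators \<open>S\<close>, lift the isomorphism and its
  inverse to homomorphisms \<open>p\<close> and \<open>q\<close> between the free algebras. Then \<open>K\<close> is
  generated by \<open>p S\<close> and the elements \<open>s - p (q s)\<close> for generators \<open>s\<close>: modulo these
  every \<open>f\<close> is congruent to \<open>p (q f)\<close>, and if \<open>f \<in> K\<close> then \<open>q f\<close> lies in the ideal
  generated by \<open>S\<close>.
\<close>

lemma (in free_quotient) finitely_presented_imp:
  assumes fp: "finitely_presented A" and fin: "finite (UNIV :: 'x set)"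
  obtains T where "finite T" "T \<subseteq> K" "K \<subseteq> ideal_gen T"
proof -
  obtain X :: "nat set" and S :: "(nat word \<Rightarrow>\<^sub>0 'k) set" where X: "finite X" and S: "finite S" "S \<subseteq> carrier (free_algebra X)"
    and iso: "alg_isomorphic (quot (free_algebra X) (Idl\<^bsub>free_algebra X\<^esub> S)) A"
    using fp unfolding finitely_presented_def by (elim exE conjE)
  define F where "F = (free_algebra X :: ('k, nat word \<Rightarrow>\<^sub>0 'k) module)"
  define G where "G = Idl\<^bsub>F\<^esub> S"
  obtain \<theta> where \<theta>: "\<theta> \<in> alg_hom (quot F G) A" "bij_betw \<theta> (carrier (quot F G)) (carrier A)"
    using iso unfolding alg_isomorphic_def F_def[symmetric] G_def[symmetric] by (elim bexE)
  interpret F: ring F unfolding F_def by (rule ring_free_algebra)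
  have SF: "S \<subseteq> carrier F" using S by (simp add: F_def)
  interpret G: ideal G F unfolding G_def by (rule F.genideal_ideal[OF SF])
  have lmF: "left_module ground F" unfolding F_def by (rule left_module_free_algebra)
  have sG: "submodule G ground F"
    unfolding submodule_iff[OF lmF]
  proof (intro conjI ballI)
    show "G \<subseteq> carrier F" by (rule G.a_subset)
    show "\<zero>\<^bsub>F\<^esub> \<in> G" by (rule additive_subgroup.zero_closed[OF G.additive_subgroup_axioms])
    show "x \<oplus>\<^bsub>F\<^esub> y \<in> G" if "x \<in> G" "y \<in> G" for x y
      by (rule additive_subgroup.a_closed[OF G.additive_subgroup_axioms that])
    show "c \<odot>\<^bsub>F\<^esub> x \<in> G" if "x \<in> G" for c x
      using G.I_l_closed[OF that, of "scal c"] by (simp add: F_def)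
  qed
  interpret G': submodule_quotient ground F G
    by (intro submodule_quotient.intro lmF submodule_quotient_axioms.intro sG)
  define \<kappa> where "\<kappa> u = G +>\<^bsub>F\<^esub> u" for u
  have \<kappa>_closed: "\<kappa> u \<in> carrier (quot F G)" if "u \<in> carrier F" for u
    using G'.coset_in_quot[OF that] by (simp add: \<kappa>_def)
  define \<alpha> where "\<alpha> u = \<theta> (\<kappa> u)" for u
  have \<theta>r: "\<theta> \<in> ring_hom (quot F G) A" and \<theta>l: "\<theta> \<in> lmod_hom ground (quot F G) A"
    using \<theta>(1) by (simp_all add: alg_hom_def)
  have \<alpha>_closed: "\<alpha> u \<in> carrier A" if "u \<in> carrier F" for u
    using lmod_homD(1)[OF \<theta>l \<kappa>_closed[OF that]] by (simp add: \<alpha>_def)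
  have \<alpha>_add: "\<alpha> (u + v) = \<alpha> u \<oplus>\<^bsub>A\<^esub> \<alpha> v" if "u \<in> carrier F" "v \<in> carrier F" for u v
    using lmod_homD(2)[OF \<theta>l \<kappa>_closed[OF that(1)] \<kappa>_closed[OF that(2)]] G'.quot_add[OF that]
    by (simp add: \<alpha>_def \<kappa>_def F_def)
  have \<alpha>_mult: "\<alpha> (u * v) = \<alpha> u \<otimes>\<^bsub>A\<^esub> \<alpha> v" if "u \<in> carrier F" "v \<in> carrier F" for u v
    using ring_hom_mult[OF \<theta>r \<kappa>_closed[OF that(1)] \<kappa>_closed[OF that(2)]] G.rcoset_mult_add[OF that]
    by (simp add: \<alpha>_def \<kappa>_def quot_def FactRing_def F_def)
  have \<alpha>_one: "\<alpha> 1 = proj 1"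
    using ring_hom_one[OF \<theta>r] by (simp add: \<alpha>_def \<kappa>_def quot_def FactRing_def F_def proj_def A_simps(4)[unfolded quot_def FactRing_def])
  have scF: "scal c \<in> carrier F" "1 \<in> carrier F" for c by (simp_all add: F_def)
  have \<alpha>_scal: "\<alpha> (scal c) = proj (scal c)" for c
  proof -
    have "\<kappa> (scal c) = c \<odot>\<^bsub>quot F G\<^esub> \<kappa> 1"
      using G'.quot_smult[of c 1] scF by (simp add: \<kappa>_def F_def)
    then have "\<alpha> (scal c) = c \<odot>\<^bsub>A\<^esub> \<alpha> 1"
      using lmod_homD(3)[OF \<theta>l _ \<kappa>_closed[OF scF(2)], of c] by (simp add: \<alpha>_def)
    then show ?thesis by (simp add: \<alpha>_one A_simps)
  qed
  have \<alpha>_zero: "\<alpha> u = proj 0 \<longleftrightarrow> u \<in> G" if u: "u \<in> carrier F" for u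
  proof -
    have z: "\<theta> G = proj 0"
      using lmod_hom_zero[OF G'.left_module_quot L.left_module_quot \<theta>l] by (simp add: G'.quot_zero A_simps)
    have "G \<in> carrier (quot F G)" using G'.coset_in_quot[OF F.zero_closed] by (simp add: G'.coset_zero)
    then have "\<alpha> u = proj 0 \<longleftrightarrow> \<kappa> u = G"
      using inj_on_eq_iff[OF bij_betw_imp_inj_on[OF \<theta>(2)] \<kappa>_closed[OF u]] by (simp add: \<alpha>_def flip: z)
    also have "\<dots> \<longleftrightarrow> u \<in> G" unfolding \<kappa>_def by (rule G'.coset_eq_zero_iff[OF u])
    finally show ?thesis .
  qed
  have \<alpha>_surj: "\<exists>u. u \<in> carrier F \<and> \<alpha> u = proj p" for p
  proof -
    have "proj p \<in> \<theta> ` carrier (quot F G)" using \<theta>(2) by (simp add: bij_betw_def)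
    then obtain Y where Y: "Y \<in> carrier (quot F G)" "proj p = \<theta> Y" by (elim imageE)
    from Y(1) obtain u where "u \<in> carrier F" "Y = G +>\<^bsub>F\<^esub> u" by (rule G'.quot_cases)
    then show ?thesis using Y(2) by (intro exI[of _ u]) (simp add: \<alpha>_def \<kappa>_def)
  qed
  have "\<forall>i. \<exists>p. i \<in> X \<longrightarrow> proj p = \<alpha> (gen i)"
  proof
    fix i show "\<exists>p. i \<in> X \<longrightarrow> proj p = \<alpha> (gen i)"
    proof (cases "i \<in> X")
      case True
      then have "\<alpha> (gen i) \<in> carrier A" by (intro \<alpha>_closed) (simp add: F_def)
      then obtain p where "\<alpha> (gen i) = proj p" by (rule A_cases)
      then show ?thesis by (intro exI[of _ p]) simp
    qed simp
  qed
  from choice[OF this] obtain p0 where p0: "\<forall>i. i \<in> X \<longrightarrow> proj (p0 i) = \<alpha> (gen i)" by (elim exE)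
  have "\<forall>s. \<exists>u. u \<in> carrier F \<and> \<alpha> u = proj (gen s)" using \<alpha>_surj by (rule allI)
  from choice[OF this] obtain q0 :: "'x \<Rightarrow> _" where q0: "\<forall>s. q0 s \<in> carrier F \<and> \<alpha> (q0 s) = proj (gen s)" by (elim exE)
  define p where "p = free_hom p0"
  define q where "q = free_hom q0"
  interpret p: alg_map p unfolding p_def by (rule alg_map_free_hom)
  interpret q: alg_map q unfolding q_def by (rule alg_map_free_hom)
  have p\<alpha>': "u \<in> carrier F \<and> proj (p u) = \<alpha> u" if "u \<in> carrier (free_algebra X)" for u
    using that
  proof (induction u rule: free_algebra_induct)
    case (scal c)
    then show ?case using scF by (simp add: p.scal \<alpha>_scal)
  next
    case (gen i)
    then show ?case using p0 by (simp add: F_def p_def)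
  next
    case (add u v)
    then have "u + v \<in> carrier F" using free_algebra_closed(1)[of u X v] by (simp add: F_def)
    with add show ?case by (simp add: p.add \<alpha>_add flip: A_simps)
  next
    case (mult u v)
    then have "u * v \<in> carrier F" using free_algebra_closed(2)[of u X v] by (simp add: F_def)
    with mult show ?case by (simp add: p.mult \<alpha>_mult flip: A_simps)
  qed
  have p\<alpha>: "proj (p u) = \<alpha> u" if "u \<in> carrier F" for u using p\<alpha>'[of u] that by (simp add: F_def)
  have qF: "q f \<in> carrier F" for f
    unfolding q_def F_def by (rule free_hom_carrier[where Y = UNIV]) (use q0 in \<open>simp_all add: F_def\<close>)
  define T where "T = p ` S \<union> range (\<lambda>s. gen s - p (q (gen s)))"
  have finT: "finite T" using S(1) fin by (simp add: T_def)
  have SG: "S \<subseteq> G" unfolding G_def by (rule F.genideal_self[OF SF])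
  have TK: "T \<subseteq> K"
  proof
    fix t assume "t \<in> T"
    then consider u where "u \<in> S" "t = p u" | s where "t = gen s - p (q (gen s))"
      unfolding T_def by (elim UnE imageE) simp_all
    then show "t \<in> K"
    proof cases
      case 1
      then have "u \<in> G" "u \<in> carrier F" using SG SF by auto
      then have "proj (p u) = proj 0" by (simp add: p\<alpha> \<alpha>_zero)
      then show ?thesis using 1 by (simp add: proj_eq_iff)
    next
      case 2
      have "proj (p (q (gen s))) = proj (gen s)"
        unfolding p\<alpha>[OF qF] using q0 by (simp add: q_def)
      then have "proj (gen s) = proj (p (q (gen s)))" by (rule sym)
      then show ?thesis using 2 by (simp only: proj_eq_iff)
    qed
  qed
  note tsT = two_sided_ideal_gen[of T]
  have idK: "ideal_gen T \<subseteq> K" by (rule ideal_gen_minimal[OF two_sided_K TK])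
  have "G \<subseteq> {u. p u \<in> ideal_gen T} \<inter> carrier F"
    unfolding G_def
  proof (rule F.genideal_minimal)
    show "ideal ({u. p u \<in> ideal_gen T} \<inter> carrier F) F"
      unfolding F_def by (rule ideal_if_two_sided[OF two_sided_vimage[OF p.alg_map_axioms tsT]])
    show "S \<subseteq> {u. p u \<in> ideal_gen T} \<inter> carrier F"
      using SF subsetD[OF ideal_gen_superset, of _ T] by (auto simp: T_def)
  qed
  then have Gp: "p u \<in> ideal_gen T" if "u \<in> G" for u using that by auto
  have "K \<subseteq> ideal_gen T"
  proof
    fix f assume f: "f \<in> K"
    have "eqmod (ideal_gen T) f (p (q f))"
    proof (rule alg_maps_eqmod[OF alg_map_id alg_map_comp[OF q.alg_map_axioms p.alg_map_axioms] tsT, of UNIV])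
      show "eqmod (ideal_gen T) (gen s) (p (q (gen s)))" for s
        unfolding eqmod_def by (rule subsetD[OF ideal_gen_superset]) (simp add: T_def)
    qed simp
    then have d: "f - p (q f) \<in> ideal_gen T" by (simp add: eqmod_def)
    have "f - (f - p (q f)) \<in> K" by (rule two_sidedD(6)[OF two_sided_K f subsetD[OF idK d]])
    then have "proj (p (q f)) = proj 0" by (simp add: proj_eq_iff)
    then have "q f \<in> G" using \<alpha>_zero[OF qF] p\<alpha>[OF qF] by simp
    then have "p (q f) \<in> ideal_gen T" by (rule Gp)
    from two_sidedD(2)[OF tsT d this] show "f \<in> ideal_gen T" by simp
  qed
  with finT TK show thesis by (rule that)
qed

lemma finite_UNIV_letter: "finite (UNIV :: letter set)"
proof -
  have "UNIV = {La, Lb, Lc, Ld, Lx, Ly}" by (auto intro: letter.exhaust)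
  then show ?thesis by (metis finite.emptyI finite_insert)
qed

theorem not_finitely_presented_A: "\<not> finitely_presented (Q.A :: ('k::field, 'k presalg set) module)"
proof
  assume "finitely_presented (Q.A :: ('k, 'k presalg set) module)"
  then obtain T :: "'k presalg set" where T: "finite T" "T \<subseteq> J" "J \<subseteq> ideal_gen T"
    using finite_UNIV_letter by (rule Q.finitely_presented_imp)
  from J_not_finitely_generated[OF T(1,2)] T(3) show False by (rule notE)
qed


section \<open>A free resolution of the trivial module\<close>

text \<open>
  The definition of \<open>projective\<close> wants a basis inside the type of elements of the
  module, so the index set is replaced by the set of basis vectors.
\<close>

lemma projective_free_lmodule:
  fixes S :: "'s set" and R :: "('r, 'c) ring_scheme"
  assumes R: "ring R" shows "projective R (free_lmodule R S)"
proof -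
  interpret ring R by fact
  define B where "B = basis_vec R ` S"
  interpret F: left_module R "free_lmodule R S" by (rule left_module_free)
  interpret G: left_module R "free_lmodule R B" by (rule left_module_free)
  define i where "i = lin_ext R (free_lmodule R B) (\<lambda>s. basis_vec R (basis_vec R s :: 's \<Rightarrow> 'r))"
  define r where "r = lin_ext R (free_lmodule R S) (\<lambda>v. v)"
  have bB: "basis_vec R (basis_vec R s) \<in> carrier (free_lmodule R B)" if "s \<in> S" for s
    by (rule basis_vec_closed) (use that in \<open>simp add: B_def\<close>)
  have i: "i \<in> lmod_hom R (free_lmodule R S) (free_lmodule R B)"
    "s \<in> S \<Longrightarrow> i (basis_vec R s) = basis_vec R (basis_vec R s)" for s
    unfolding i_def by (rule G.lin_ext_hom[OF bB], assumption+)+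
  have cB: "v \<in> carrier (free_lmodule R S)" if "v \<in> B" for v
    using that by (auto simp: B_def basis_vec_closed)
  have r: "r \<in> lmod_hom R (free_lmodule R B) (free_lmodule R S)"
    "v \<in> B \<Longrightarrow> r (basis_vec R v) = v" for v
    unfolding r_def by (rule F.lin_ext_hom[OF cB], assumption+)+
  have "r (i x) = x" if "x \<in> carrier (free_lmodule R S)" for x
    by (rule free_hom_eqI[OF F.left_module_axioms lmod_hom_comp[OF i(1) r(1)] lmod_hom_id _ that])
      (simp add: i r B_def)
  then show ?thesis
    unfolding projective_def using i(1) r(1) F.left_module_axioms by (intro conjI exI ballI)
qed

lemma left_module_aug_module:
  assumes "augmented_algebra B \<epsilon>" shows "left_module B (aug_module \<epsilon>)"
proof -
  interpret augmented_algebra B \<epsilon> by fact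
  have "abelian_group (aug_module \<epsilon>)"
  proof (rule abelian_groupI)
    show "\<exists>y\<in>carrier (aug_module \<epsilon>). y \<oplus>\<^bsub>aug_module \<epsilon>\<^esub> x = \<zero>\<^bsub>aug_module \<epsilon>\<^esub>" for x
      by (intro bexI[of _ "- x"]) simp_all
  qed (simp_all add: add_ac)
  then show ?thesis
    by (intro left_module.intro ring_axioms left_module_axioms.intro)
      (simp_all add: eps_hom algebra_simps)
qed

text \<open>
  The Fox derivatives of the free algebra: the coefficients in the unique expansion
  \<open>p = \<epsilon> p + \<Sum>s. rquot s p * s\<close>.
\<close>

definition rquot :: "'x \<Rightarrow> ('x word \<Rightarrow>\<^sub>0 'k) \<Rightarrow> 'x word \<Rightarrow>\<^sub>0 'k::field"
  where "rquot s = linext (\<lambda>w. if letters w \<noteq> [] \<and> last (letters w) = s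
    then Poly_Mapping.single (Word (butlast (letters w))) 1 else 0)"

lemma rquot_add: "rquot s (p + q) = rquot s p + rquot s q"
  and rquot_diff: "rquot s (p - q) = rquot s p - rquot s q"
  and rquot_zero [simp]: "rquot s 0 = 0"
  by (simp_all add: rquot_def linext_add linext_diff)

lemma rquot_sum: "rquot s (sum f T) = (\<Sum>i\<in>T. rquot s (f i))"
  by (simp add: rquot_def linext_sum)

lemma rquot_scal [simp]: "rquot s (scal c) = 0"
  by (simp add: rquot_def zero_word_def)

lemma rquot_one [simp]: "rquot s 1 = 0"
  using rquot_scal[of s 1] by (simp del: rquot_scal)

lemma rquot_mult_gen: "rquot s (p * gen t) = (if s = t then p else 0)"
proof (induction p rule: poly_mapping_single_induct)
  case (single w c)
  obtain v where "w = Word v" by (cases w)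
  then show ?case by (simp add: rquot_def gen_def mult_single plus_word_def zero_word_def)
next
  case (add p q)
  then show ?case by (simp add: rquot_add distrib_right)
qed

lemma rquot_gen: "rquot s (gen t) = (if s = t then 1 else 0)"
  using rquot_mult_gen[of s 1 t] by simp

lemma rquot_mult: "rquot s (p * q) = p * rquot s q + scal (free_aug q) * rquot s p"
proof -
  have "q \<in> carrier (free_algebra UNIV)" by simp
  then show ?thesis
  proof (induction q arbitrary: p rule: free_algebra_induct)
    case (scal c)
    have "rquot s (p * scal c) = scal c * rquot s p"
      by (simp add: rquot_def linext_scal flip: scal_commute)
    then show ?case by simp
  next
    case (gen t)
    show ?case by (simp add: rquot_mult_gen rquot_gen)
  next
    case (add q q')
    then show ?case by (simp add: distrib_left distrib_right rquot_add scal_add)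
  next
    case (mult q q')
    have "rquot s (p * (q * q')) = (p * q) * rquot s q' + scal (free_aug q') * rquot s (p * q)"
      unfolding mult.assoc[symmetric] by (rule mult.IH(2))
    also have "\<dots> = p * (q * rquot s q') + scal (free_aug q') * (p * rquot s q) + scal (free_aug q') * (scal (free_aug q) * rquot s p)"
      unfolding mult.IH(1)[of p] by (simp only: mult.assoc distrib_left add.assoc)
    also have "scal (free_aug q') * (p * rquot s q) = p * (scal (free_aug q') * rquot s q)"
      by (rule scal_left_commute[symmetric])
    also have "scal (free_aug q') * (scal (free_aug q) * rquot s p) = scal (free_aug (q * q')) * rquot s p"
      by (simp only: free_aug_mult mult.assoc[symmetric] scal_mult[symmetric] mult.commute)
    finally show ?case
      unfolding mult.IH(2)[of q] by (simp only: distrib_left add.assoc)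
  qed
qed

lemma letter_expansion: "p = scal (free_aug p) + (\<Sum>s\<in>UNIV. rquot s p * gen s)"
  for p :: "letter word \<Rightarrow>\<^sub>0 'k::field"
proof -
  note fin = finite_UNIV_letter
  have "p \<in> carrier (free_algebra UNIV)" by simp
  then show ?thesis
  proof (induction p rule: free_algebra_induct)
    case (gen t)
    have "(\<Sum>s\<in>UNIV. rquot s (gen t) * gen s) = (\<Sum>s\<in>UNIV. if s = t then gen t else 0 :: letter word \<Rightarrow>\<^sub>0 'k)"
      by (intro sum.cong) (simp_all add: rquot_gen)
    also have "\<dots> = gen t" using fin by (simp add: sum.delta)
    finally show ?case by simp
  next
    case (add p q)
    have "p + q = (scal (free_aug p) + (\<Sum>s\<in>UNIV. rquot s p * gen s)) + (scal (free_aug q) + (\<Sum>s\<in>UNIV. rquot s q * gen s))"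
      using add by (rule arg_cong2)
    also have "\<dots> = scal (free_aug (p + q)) + (\<Sum>s\<in>UNIV. rquot s (p + q) * gen s)"
      by (simp only: rquot_add free_aug_simps(1) scal_add distrib_right sum.distrib add_ac)
    finally show ?case .
  next
    case (mult p q)
    have "p * q = p * (scal (free_aug q) + (\<Sum>s\<in>UNIV. rquot s q * gen s))"
      using mult.IH(2) by (rule arg_cong)
    also have "\<dots> = scal (free_aug q) * p + (\<Sum>s\<in>UNIV. p * rquot s q * gen s)"
      by (simp only: distrib_left scal_commute[of "free_aug q" p] sum_distrib_left mult.assoc)
    also have "scal (free_aug q) * p = scal (free_aug q) * (scal (free_aug p) + (\<Sum>s\<in>UNIV. rquot s p * gen s))"
      using mult.IH(1) by (rule arg_cong)
    also have "\<dots> = scal (free_aug (p * q)) + (\<Sum>s\<in>UNIV. scal (free_aug q) * rquot s p * gen s)"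
      by (simp only: distrib_left sum_distrib_left mult.assoc free_aug_mult scal_mult scal_commute[of "free_aug p" "scal (free_aug q)"])
    finally show ?case
      by (simp only: rquot_mult distrib_right sum.distrib add.assoc add.commute)
        (simp only: add_ac)
  qed simp
qed

lemma free_aug_rquot_power: "free_aug (rquot s ((1 + gen t) ^ l)) = (if s = t then of_nat l else 0)"
  by (induction l) (simp_all add: rquot_mult rquot_add rquot_gen)

text \<open>
  The letter \<open>c\<close> occurs in the relator only at the end of the first product.
\<close>

lemma rquot_relator_Lc: "rquot Lc (relator l :: 'k::field presalg) = cap (La # replicate l Lb)"
proof -
  have "rquot Lc ((1 + gen Lb :: 'k presalg) ^ l) = 0" by (induction l) (simp_all add: rquot_mult rquot_add rquot_gen)
  moreover have "rquot Lc ((1 + gen Lx :: 'k presalg) ^ l) = 0" by (induction l) (simp_all add: rquot_mult rquot_add rquot_gen)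
  ultimately show ?thesis by (simp add: relator_def rquot_diff rquot_mult rquot_add rquot_gen)
qed

lemma free_aug_rquot_relator:
  "free_aug (rquot s (relator l) :: 'k::field presalg) = (case s of La \<Rightarrow> 1 | Lb \<Rightarrow> of_nat l | Lc \<Rightarrow> 1
    | Ld \<Rightarrow> - 1 | Lx \<Rightarrow> - of_nat l | Ly \<Rightarrow> - 1)"
  by (cases s) (simp_all add: relator_def rquot_diff rquot_mult rquot_add rquot_gen free_aug_rquot_power)

text \<open>
  The left ideal spanned by the relators and by \<open>J I\<close>, where \<open>I\<close> is the augmentation
  ideal, the left ideal generated by the letters.
\<close>

definition relator_span :: "'k::field presalg set"
  where "relator_span = {x. \<exists>T c j. finite T \<and> (\<forall>s. j s \<in> J) \<and>
    x = (\<Sum>l\<in>T. c l * relator l) + (\<Sum>s\<in>UNIV. j s * gen s)}"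

lemma relator_spanI:
  "finite T \<Longrightarrow> (\<And>s. j s \<in> J) \<Longrightarrow> x = (\<Sum>l\<in>T. c l * relator l) + (\<Sum>s\<in>UNIV. j s * gen s) \<Longrightarrow> x \<in> relator_span"
  unfolding relator_span_def by (intro CollectI exI conjI allI)

lemma relator_spanE:
  assumes "x \<in> relator_span"
  obtains T j c where "finite T" "\<And>s. j s \<in> J" "x = (\<Sum>l\<in>T. c l * relator l) + (\<Sum>s\<in>UNIV. j s * gen s)"
proof -
  obtain T c j where "finite T" "\<forall>s. j s \<in> J" "x = (\<Sum>l\<in>T. c l * relator l) + (\<Sum>s\<in>UNIV. j s * gen s)"
    using assms unfolding relator_span_def by (elim CollectE exE conjE)
  then show thesis by (intro that[of T j c]) simp_all
qed

text \<open>
  It suffices that the span is a two-sided ideal. A product of one of its elements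
  with a letter on the right lies in \<open>J I\<close>, since the element lies in \<open>J\<close>.
\<close>

lemma J_subset_relator_span: "(J :: 'k::field presalg set) \<subseteq> relator_span"
proof (rule ideal_gen_minimal)
  note J = two_sidedD[OF two_sided_J]
  have sub: "x \<in> J" if "x \<in> relator_span" for x :: "'k presalg"
    using that
  proof (rule relator_spanE)
    fix T j c assume "\<And>s. j s \<in> (J :: 'k presalg set)" "x = (\<Sum>l\<in>T. c l * relator l) + (\<Sum>s\<in>UNIV. j s * gen s)"
    then show "x \<in> J" by (simp add: J two_sided_sum[OF two_sided_J] relator_in_J)
  qed
  have zero: "(0 :: 'k presalg) \<in> relator_span"
    by (rule relator_spanI[of "{}" "\<lambda>_. 0"]) (simp_all add: J)
  have add: "x + y \<in> relator_span" if xy: "x \<in> relator_span" "y \<in> relator_span" for x y :: "'k presalg"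
  proof -
    obtain T j c where x: "finite T" "\<And>s. j s \<in> J" "x = (\<Sum>l\<in>T. c l * relator l) + (\<Sum>s\<in>UNIV. j s * gen s)"
      using xy(1) by (rule relator_spanE) (rule that)
    obtain T' j' c' where y: "finite T'" "\<And>s. j' s \<in> J" "y = (\<Sum>l\<in>T'. c' l * relator l) + (\<Sum>s\<in>UNIV. j' s * gen s)"
      using xy(2) by (rule relator_spanE) (rule that)
    let ?c = "\<lambda>l. (if l \<in> T then c l else 0) + (if l \<in> T' then c' l else 0)"
    have "(\<Sum>l\<in>T. c l * relator l) = (\<Sum>l\<in>T \<union> T'. (if l \<in> T then c l else 0) * relator l)"
      using x(1) y(1) by (intro sum.mono_neutral_cong_left) auto
    moreover have "(\<Sum>l\<in>T'. c' l * relator l) = (\<Sum>l\<in>T \<union> T'. (if l \<in> T' then c' l else 0) * relator l)"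
      using x(1) y(1) by (intro sum.mono_neutral_cong_left) auto
    ultimately have "x + y = (\<Sum>l\<in>T \<union> T'. ?c l * relator l) + (\<Sum>s\<in>UNIV. (j s + j' s) * gen s)"
      by (simp only: x(3) y(3) distrib_right sum.distrib add_ac)
    then show ?thesis using x(1,2) y(1,2) by (intro relator_spanI[of "T \<union> T'" "\<lambda>s. j s + j' s"]) (simp_all add: J)
  qed
  note sums = add
  have left: "a * x \<in> relator_span" if x: "x \<in> relator_span" for x a :: "'k presalg"
    using x
  proof (rule relator_spanE)
    fix T j c assume "finite T" "\<And>s. j s \<in> (J :: 'k presalg set)" "x = (\<Sum>l\<in>T. c l * relator l) + (\<Sum>s\<in>UNIV. j s * gen s)"
    then show "a * x \<in> relator_span"
      by (intro relator_spanI[of T "\<lambda>s. a * j s" _ "\<lambda>l. a * c l"]) (simp_all add: J distrib_left sum_distrib_left mult.assoc)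
  qed
  have right: "x * a \<in> relator_span" if x: "x \<in> relator_span" for x a :: "'k presalg"
  proof -
    have "a \<in> carrier (free_algebra UNIV)" by simp
    then show ?thesis using x
    proof (induction a arbitrary: x rule: free_algebra_induct)
      case (scal c)
      then show ?case using left[of x "scal c"] by (simp add: scal_commute)
    next
      case (gen t)
      have "x * gen t = (\<Sum>s\<in>UNIV. (if s = t then x * gen t else 0))"
        using finite_UNIV_letter by (simp add: sum.delta)
      also have "\<dots> = (\<Sum>s\<in>UNIV. (if s = t then x else 0) * gen s)" by (intro sum.cong) simp_all
      finally show ?case
        using sub[OF gen(2)] by (intro relator_spanI[of "{}" "\<lambda>s. if s = t then x else 0"]) (simp_all add: J)
    next
      case (add a b)
      then show ?case using sums by (simp add: distrib_left)
    next
      case (mult a b)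
      then show ?case by (simp flip: mult.assoc)
    qed
  qed
  show "two_sided (relator_span :: 'k presalg set)"
    unfolding two_sided_def using zero add left right by (intro conjI ballI allI)
  show "range relator \<subseteq> (relator_span :: 'k presalg set)"
  proof (rule image_subsetI)
    show "(relator l :: 'k presalg) \<in> relator_span" for l
      by (rule relator_spanI[of "{l}" "\<lambda>_. 0" _ "\<lambda>_. 1"]) (simp_all add: J)
  qed
qed

context free_quotient
begin

lemma proj_family_closed:
  assumes "finite {w. U w \<noteq> 0}" "\<And>w. w \<notin> S \<Longrightarrow> U w = 0"
  shows "(\<lambda>w. proj (U w)) \<in> carrier (free_lmodule A S)"
proof -
  have "{w. proj (U w) \<noteq> \<zero>\<^bsub>A\<^esub>} \<subseteq> {w. U w \<noteq> 0}"
    by (rule Collect_mono, rule impI, erule contrapos_nn) (simp only: A_simps)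
  then have "finite {w. proj (U w) \<noteq> \<zero>\<^bsub>A\<^esub>}" using assms(1) by (rule finite_subset)
  then show ?thesis using assms(2) by (simp add: free_lmodule_simps(1) A_simps)
qed

text \<open>
  Chains over the quotient algebra are represented by families of polynomials, chosen
  to vanish wherever the chain does.
\<close>

lemma free_lmodule_lift:
  assumes u: "u \<in> carrier (free_lmodule A S)"
  obtains U where "u = (\<lambda>w. proj (U w))" "finite {w. U w \<noteq> 0}" "\<And>w. w \<notin> S \<Longrightarrow> U w = 0"
proof -
  interpret ring A by (rule ring_A)
  have "\<forall>w. \<exists>p. u w = proj p \<and> (u w = \<zero>\<^bsub>A\<^esub> \<longrightarrow> p = 0)"
  proof
    fix w
    obtain p where p: "u w = proj p" using free_coeff_closed[OF u, of w] by (rule A_cases)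
    show "\<exists>p. u w = proj p \<and> (u w = \<zero>\<^bsub>A\<^esub> \<longrightarrow> p = 0)"
    proof (cases "u w = \<zero>\<^bsub>A\<^esub>")
      case True
      then show ?thesis by (intro exI[of _ 0]) (simp add: A_simps)
    next
      case False
      then show ?thesis using p by (intro exI[of _ p]) simp
    qed
  qed
  from choice[OF this] obtain U where U: "\<forall>w. u w = proj (U w) \<and> (u w = \<zero>\<^bsub>A\<^esub> \<longrightarrow> U w = 0)" by (elim exE)
  have U1: "u w = proj (U w)" for w using U[THEN spec, of w] by (rule conjunct1)
  have U2: "u w = \<zero>\<^bsub>A\<^esub> \<Longrightarrow> U w = 0" for w using U[THEN spec, of w] by (elim conjE mp)
  have "{w. U w \<noteq> 0} \<subseteq> {w. u w \<noteq> \<zero>\<^bsub>A\<^esub>}" by (rule Collect_mono, rule impI, erule contrapos_nn, rule U2)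
  then have "finite {w. U w \<noteq> 0}"
    by (rule finite_subset) (use u in \<open>simp add: free_lmodule_simps(1)\<close>)
  moreover have "u = (\<lambda>w. proj (U w))" by (rule ext) (rule U1)
  moreover have "U w = 0" if "w \<notin> S" for w using u that by (intro U2) (simp add: free_lmodule_simps(1))
  ultimately show thesis by (intro that)
qed

lemma finsum_free_proj:
  assumes "finite T" "\<And>w. w \<in> T \<Longrightarrow> (\<lambda>t. proj (G w t)) \<in> carrier (free_lmodule A S)"
  shows "(\<Oplus>\<^bsub>free_lmodule A S\<^esub>w\<in>T. (\<lambda>t. proj (G w t))) = (\<lambda>t. proj (\<Sum>w\<in>T. G w t))"
proof -
  interpret F: left_module A "free_lmodule A S" by (rule ring.left_module_free[OF ring_A])
  show ?thesis using assms
  proof (induction T)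
    case empty
    show ?case by (simp add: free_lmodule_simps(2) A_simps)
  next
    case (insert w T)
    have "(\<Oplus>\<^bsub>free_lmodule A S\<^esub>w\<in>insert w T. (\<lambda>t. proj (G w t))) =
      (\<lambda>t. proj (G w t)) \<oplus>\<^bsub>free_lmodule A S\<^esub> (\<Oplus>\<^bsub>free_lmodule A S\<^esub>w\<in>T. (\<lambda>t. proj (G w t)))"
      using insert by (intro F.M.finsum_insert) auto
    also have "\<dots> = (\<lambda>t. proj (\<Sum>w\<in>insert w T. G w t))"
      using insert by (simp add: free_lmodule_simps(3) A_simps)
    finally show ?case .
  qed
qed

lemma lin_ext_proj:
  assumes \<Phi>: "\<And>w. w \<in> S \<Longrightarrow> (\<lambda>t. proj (\<Phi> w t)) \<in> carrier (free_lmodule A S')"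
    and T: "finite T" "T \<subseteq> S" "\<And>w. w \<notin> T \<Longrightarrow> U w = 0"
  shows "lin_ext A (free_lmodule A S') (\<lambda>w t. proj (\<Phi> w t)) (\<lambda>w. proj (U w)) =
    (\<lambda>t. proj (\<Sum>w\<in>T. U w * \<Phi> w t))"
proof -
  interpret F: left_module A "free_lmodule A S'" by (rule ring.left_module_free[OF ring_A])
  have fin: "finite {w. U w \<noteq> 0}" using T by (intro finite_subset[OF _ T(1)]) auto
  have u: "(\<lambda>w. proj (U w)) \<in> carrier (free_lmodule A S)"
    using T by (intro proj_family_closed fin) auto
  have sm: "proj (U w) \<odot>\<^bsub>free_lmodule A S'\<^esub> (\<lambda>t. proj (\<Phi> w t)) = (\<lambda>t. proj (U w * \<Phi> w t))" for w
    by (simp add: free_lmodule_simps(4) A_simps)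
  have "lin_ext A (free_lmodule A S') (\<lambda>w t. proj (\<Phi> w t)) (\<lambda>w. proj (U w)) =
      (\<Oplus>\<^bsub>free_lmodule A S'\<^esub>w\<in>T. proj (U w) \<odot>\<^bsub>free_lmodule A S'\<^esub> (\<lambda>t. proj (\<Phi> w t)))"
    by (rule F.lin_ext_superset[of S, OF \<Phi> u T(1,2)]) (use T(3) in \<open>auto simp: A_simps\<close>)
  also have "\<dots> = (\<lambda>t. proj (\<Sum>w\<in>T. U w * \<Phi> w t))"
    unfolding sm
  proof (rule finsum_free_proj[OF T(1)])
    fix w assume "w \<in> T"
    then show "(\<lambda>t. proj (U w * \<Phi> w t)) \<in> carrier (free_lmodule A S')"
      unfolding sm[symmetric] using T(2) by (intro F.smult_closed \<Phi>) auto
  qed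
  finally show ?thesis .
qed

end

text \<open>
  The cells of the presentation complex; the face with index \<open>l\<close> is attached along the
  \<open>l\<close>-th relator.
\<close>

datatype cell = Vertex | Edge letter | Face nat

definition cells :: "nat \<Rightarrow> cell set"
  where "cells n = (if n = 0 then {Vertex} else if n = 1 then range Edge else if n = 2 then range Face else {})"

lemma cells_simps [simp]: "cells 0 = {Vertex}" "cells (Suc 0) = range Edge" "cells 2 = range Face"
  "cells (Suc (Suc 0)) = range Face" "cells (Suc (Suc (Suc n))) = {}" "cells 3 = {}"
  by (simp_all add: cells_def)

fun diff_coeff :: "cell \<Rightarrow> cell \<Rightarrow> 'k::field presalg" where
  "diff_coeff (Edge s) Vertex = gen s"
| "diff_coeff (Face l) (Edge s) = rquot s (relator l)"
| "diff_coeff _ _ = 0"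

abbreviation chains :: "nat \<Rightarrow> ('k::field presalg set, cell \<Rightarrow> 'k presalg set) module"
  where "chains n \<equiv> free_lmodule Q.A (cells n)"

definition boundary :: "nat \<Rightarrow> (cell \<Rightarrow> 'k::field presalg set) \<Rightarrow> cell \<Rightarrow> 'k presalg set"
  where "boundary n = lin_ext Q.A (chains n) (\<lambda>w t. Q.proj (diff_coeff w t))"

definition chain_aug :: "(cell \<Rightarrow> 'k::field presalg set) \<Rightarrow> 'k"
  where "chain_aug u = Q.eps (u Vertex)"

lemma finite_range_Edge: "finite (range Edge)"
  using finite_UNIV_letter by simp

lemma sum_range_Edge: "(\<Sum>w\<in>range Edge. f w) = (\<Sum>s\<in>UNIV. f (Edge s))"
  by (subst sum.reindex) (simp_all add: inj_on_def)

lemma sum_Face: "(\<Sum>w\<in>Face ` L. f w) = (\<Sum>l\<in>L. f (Face l))"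
  by (subst sum.reindex) (simp_all add: inj_on_def)

lemma diff_coeff_closed:
  assumes w: "w \<in> cells (Suc n)"
  shows "(\<lambda>t. Q.proj (diff_coeff w t :: 'k::field presalg)) \<in> carrier (chains n)"
proof (rule Q.proj_family_closed)
  have "{t. (diff_coeff w t :: 'k presalg) \<noteq> 0} \<subseteq> insert Vertex (range Edge)"
  proof
    fix t assume "t \<in> {t. (diff_coeff w t :: 'k presalg) \<noteq> 0}"
    then show "t \<in> insert Vertex (range Edge)" by (cases t; cases w) auto
  qed
  then show "finite {t. (diff_coeff w t :: 'k presalg) \<noteq> 0}"
    by (rule finite_subset) (simp add: finite_range_Edge)
  show "diff_coeff w t = (0 :: 'k presalg)" if "t \<notin> cells n" for t
    using w that by (cases t; cases w) (auto simp: cells_def split: if_splits)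
qed

lemma left_module_chains: "left_module Q.A (chains n)"
  by (rule ring.left_module_free[OF Q.ring_A])

lemma boundary_hom: "boundary n \<in> lmod_hom Q.A (chains (Suc n)) (chains n)"
  unfolding boundary_def by (rule left_module.lin_ext_hom(1)[OF left_module_chains diff_coeff_closed])

lemma boundary_hom_numeral:
  "boundary 0 \<in> lmod_hom Q.A (chains 1) (chains 0)" "boundary 1 \<in> lmod_hom Q.A (chains 2) (chains 1)"
  using boundary_hom[of 0] boundary_hom[of 1] by (simp_all only: numeral_2_eq_2 One_nat_def)

lemma boundary_0:
  assumes "\<And>w. w \<notin> range Edge \<Longrightarrow> U w = 0"
  shows "boundary 0 (\<lambda>w. Q.proj (U w)) = (\<lambda>t. Q.proj (if t = Vertex then \<Sum>s\<in>UNIV. U (Edge s) * gen s else 0))"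
proof -
  have "boundary 0 (\<lambda>w. Q.proj (U w)) = (\<lambda>t. Q.proj (\<Sum>w\<in>range Edge. U w * diff_coeff w t))"
    unfolding boundary_def
    by (rule Q.lin_ext_proj[where S = "cells (Suc 0)", OF diff_coeff_closed finite_range_Edge _ assms]) simp_all
  also have "\<dots> = (\<lambda>t. Q.proj (if t = Vertex then \<Sum>s\<in>UNIV. U (Edge s) * gen s else 0))"
  proof
    show "Q.proj (\<Sum>w\<in>range Edge. U w * diff_coeff w t) = Q.proj (if t = Vertex then \<Sum>s\<in>UNIV. U (Edge s) * gen s else 0)" for t
      by (cases t) (simp_all add: sum_range_Edge)
  qed
  finally show ?thesis .
qed

lemma boundary_1:
  assumes "finite L" "\<And>w. w \<notin> Face ` L \<Longrightarrow> U w = 0"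
  shows "boundary 1 (\<lambda>w. Q.proj (U w)) =
    (\<lambda>t. Q.proj (case t of Edge s \<Rightarrow> \<Sum>l\<in>L. U (Face l) * rquot s (relator l) | _ \<Rightarrow> 0))"
proof -
  have "boundary 1 (\<lambda>w. Q.proj (U w)) = (\<lambda>t. Q.proj (\<Sum>w\<in>Face ` L. U w * diff_coeff w t))"
    unfolding boundary_def
  proof (rule Q.lin_ext_proj[where S = "cells 2", OF _ _ _ assms(2)])
    show "(\<lambda>t. Q.proj (diff_coeff w t)) \<in> carrier (chains 1)" if "w \<in> cells 2" for w
      by (rule diff_coeff_closed) (use that in simp)
  qed (use assms(1) in auto)
  also have "\<dots> = (\<lambda>t. Q.proj (case t of Edge s \<Rightarrow> \<Sum>l\<in>L. U (Face l) * rquot s (relator l) | _ \<Rightarrow> 0))"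
  proof
    show "Q.proj (\<Sum>w\<in>Face ` L. U w * diff_coeff w t) =
      Q.proj (case t of Edge s \<Rightarrow> \<Sum>l\<in>L. U (Face l) * rquot s (relator l) | _ \<Rightarrow> 0)" for t
      by (cases t) (simp_all add: sum_Face)
  qed
  finally show ?thesis .
qed

lemma chains_2_lift:
  assumes "u \<in> carrier (chains 2)"
  obtains U L where "u = (\<lambda>w. Q.proj (U w))" "finite L" "\<And>w. w \<notin> Face ` L \<Longrightarrow> U w = 0"
proof -
  obtain U where U: "u = (\<lambda>w. Q.proj (U w))" "finite {w. U w \<noteq> 0}" "\<And>w. w \<notin> cells 2 \<Longrightarrow> U w = 0"
    using assms by (rule Q.free_lmodule_lift) (rule that)
  define L where "L = {l. U (Face l) \<noteq> 0}"
  have "finite L" unfolding L_def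
    by (rule finite_imageD[of Face], rule finite_subset[OF _ U(2)]) (auto simp: inj_on_def)
  moreover have "U w = 0" if "w \<notin> Face ` L" for w
    using U(3)[of w] that by (cases w) (auto simp: L_def)
  ultimately show thesis by (intro that[OF U(1)])
qed

text \<open>
  The augmentation ideal is generated by the letters as a left ideal.
\<close>

lemma exact_vertex:
  "a_kernel (chains 0) (aug_module Q.eps) chain_aug = boundary 0 ` carrier (chains 1 :: ('k::field presalg set, _) module)"
proof
  show "boundary 0 ` carrier (chains 1) \<subseteq> a_kernel (chains 0) (aug_module Q.eps) (chain_aug :: _ \<Rightarrow> 'k)"
  proof (rule image_subsetI)
    fix u :: "cell \<Rightarrow> 'k presalg set" assume u: "u \<in> carrier (chains 1)"
    obtain U where U: "u = (\<lambda>w. Q.proj (U w))" "\<And>w. w \<notin> cells 1 \<Longrightarrow> U w = 0"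
      using u by (rule Q.free_lmodule_lift) (rule that)
    have "boundary 0 u \<in> carrier (chains 0)"
      by (rule lmod_homD(1)[OF boundary_hom_numeral(1) u])
    moreover have "boundary 0 u Vertex = Q.proj (\<Sum>s\<in>UNIV. U (Edge s) * gen s)"
      unfolding U(1) by (subst boundary_0) (simp_all add: U(2))
    ultimately show "boundary 0 u \<in> a_kernel (chains 0) (aug_module Q.eps) chain_aug"
      by (simp add: a_kernel_iff chain_aug_def Q.quot_aug_proj free_aug_sum)
  qed
  show "a_kernel (chains 0) (aug_module Q.eps) (chain_aug :: _ \<Rightarrow> 'k) \<subseteq> boundary 0 ` carrier (chains 1)"
  proof
    fix u :: "cell \<Rightarrow> 'k presalg set" assume "u \<in> a_kernel (chains 0) (aug_module Q.eps) chain_aug"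
    then have u: "u \<in> carrier (chains 0)" "Q.eps (u Vertex) = 0" by (simp_all add: a_kernel_iff chain_aug_def)
    obtain U where U: "u = (\<lambda>w. Q.proj (U w))" "\<And>w. w \<notin> cells 0 \<Longrightarrow> U w = 0"
      using u(1) by (rule Q.free_lmodule_lift) (rule that)
    define p where "p = U Vertex"
    have p: "free_aug p = 0" using u(2) by (simp add: U(1) Q.quot_aug_proj p_def)
    define V where "V = (\<lambda>w. case w of Edge s \<Rightarrow> rquot s p | _ \<Rightarrow> 0)"
    have V0: "V w = 0" if "w \<notin> range Edge" for w using that by (cases w) (auto simp: V_def)
    have "finite {w. V w \<noteq> 0}" by (rule finite_subset[OF _ finite_range_Edge]) (use V0 in auto)
    then have v: "(\<lambda>w. Q.proj (V w)) \<in> carrier (chains 1)"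
      by (rule Q.proj_family_closed) (use V0 in simp)
    have "boundary 0 (\<lambda>w. Q.proj (V w)) = u"
    proof
      fix t
      have "boundary 0 (\<lambda>w. Q.proj (V w)) t = Q.proj (if t = Vertex then \<Sum>s\<in>UNIV. rquot s p * gen s else 0)"
        by (subst boundary_0[OF V0]) (simp_all add: V_def)
      also have "(\<Sum>s\<in>UNIV. rquot s p * gen s) = p" using letter_expansion[of p] p by simp
      also have "Q.proj (if t = Vertex then p else 0) = u t" using U(2)[of t] by (simp add: U(1) p_def)
      finally show "boundary 0 (\<lambda>w. Q.proj (V w)) t = u t" .
    qed
    then show "u \<in> boundary 0 ` carrier (chains 1)" using v by (rule image_eqI[OF sym])
  qed
qed

lemma rquot_relator_comb:
  "rquot t ((\<Sum>l\<in>T. c l * relator l) + (\<Sum>s\<in>UNIV. j s * gen s)) = (\<Sum>l\<in>T. c l * rquot t (relator l)) + j t"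
proof -
  have "(\<Sum>s\<in>UNIV. rquot t (j s * gen s)) = (\<Sum>s\<in>UNIV. if s = t then j t else 0)"
    by (intro sum.cong) (auto simp: rquot_mult_gen)
  also have "\<dots> = j t" using finite_UNIV_letter by (simp add: sum.delta)
  finally show ?thesis by (simp add: rquot_add rquot_sum rquot_mult relator_aug)
qed

text \<open>
  A lift \<open>U\<close> of a one-cycle satisfies \<open>\<Sum>s. U s * s \<in> J\<close>. Comparing the
  coefficients of the letters in an expression of this element by relators and
  elements of \<open>J I\<close> shows that \<open>U\<close> is congruent to a combination of the boundaries of
  faces.
\<close>

lemma exact_edges:
  "a_kernel (chains 1) (chains 0) (boundary 0) = boundary 1 ` carrier (chains 2 :: ('k::field presalg set, _) module)"
proof
  note J = two_sidedD[OF two_sided_J]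
  show "boundary 1 ` carrier (chains 2) \<subseteq> a_kernel (chains 1) (chains 0) (boundary 0 :: _ \<Rightarrow> _ \<Rightarrow> 'k presalg set)"
  proof (rule image_subsetI)
    fix u :: "cell \<Rightarrow> 'k presalg set" assume u: "u \<in> carrier (chains 2)"
    obtain U L where U: "u = (\<lambda>w. Q.proj (U w))" "finite L" "\<And>w. w \<notin> Face ` L \<Longrightarrow> U w = 0"
      using u by (rule chains_2_lift) (rule that)
    define V where "V = (\<lambda>t. case t of Edge s \<Rightarrow> \<Sum>l\<in>L. U (Face l) * rquot s (relator l) | _ \<Rightarrow> 0)"
    have du: "boundary 1 u = (\<lambda>t. Q.proj (V t))" unfolding U(1) V_def by (rule boundary_1[OF U(2,3)])
    have V0: "V w = 0" if "w \<notin> range Edge" for w using that by (cases w) (auto simp: V_def)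
    have "(\<Sum>s\<in>UNIV. V (Edge s) * gen s) = (\<Sum>l\<in>L. U (Face l) * (\<Sum>s\<in>UNIV. rquot s (relator l) * gen s))"
      by (simp add: V_def sum_distrib_right sum_distrib_left mult.assoc sum.swap[of _ L])
    also have "\<dots> = (\<Sum>l\<in>L. U (Face l) * relator l)"
    proof (rule sum.cong[OF refl])
      show "U (Face l) * (\<Sum>s\<in>UNIV. rquot s (relator l) * gen s) = U (Face l) * relator l" for l
        using letter_expansion[of "relator l :: 'k presalg"] by (simp add: relator_aug)
    qed
    also have "\<dots> \<in> J" by (intro two_sided_sum[OF two_sided_J] J(3) relator_in_J)
    finally have "Q.proj (\<Sum>s\<in>UNIV. V (Edge s) * gen s) = Q.proj 0" by (simp add: Q.proj_eq_iff)
    then have "boundary 0 (boundary 1 u) = \<zero>\<^bsub>chains 0\<^esub>"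
      unfolding du by (subst boundary_0[OF V0]) (assumption, unfold free_lmodule_simps(2) Q.A_simps, intro ext, simp)
    moreover have "boundary 1 u \<in> carrier (chains 1)"
      by (rule lmod_homD(1)[OF boundary_hom_numeral(2) u])
    ultimately show "boundary 1 u \<in> a_kernel (chains 1) (chains 0) (boundary 0)"
      by (simp add: a_kernel_iff)
  qed
  show "a_kernel (chains 1) (chains 0) (boundary 0 :: _ \<Rightarrow> _ \<Rightarrow> 'k presalg set) \<subseteq> boundary 1 ` carrier (chains 2)"
  proof
    fix u :: "cell \<Rightarrow> 'k presalg set" assume "u \<in> a_kernel (chains 1) (chains 0) (boundary 0)"
    then have u: "u \<in> carrier (chains 1)" "boundary 0 u = (\<lambda>_. Q.proj 0)"
      by (simp_all add: a_kernel_iff free_lmodule_simps(2) Q.A_simps)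
    obtain U where U: "u = (\<lambda>w. Q.proj (U w))" "\<And>w. w \<notin> cells 1 \<Longrightarrow> U w = 0"
      using u(1) by (rule Q.free_lmodule_lift) (rule that)
    have "boundary 0 u Vertex = Q.proj (\<Sum>s\<in>UNIV. U (Edge s) * gen s)"
      unfolding U(1) by (subst boundary_0) (simp_all add: U(2))
    then have "Q.proj (\<Sum>s\<in>UNIV. U (Edge s) * gen s) = Q.proj 0" unfolding u(2) by (rule sym)
    then have "(\<Sum>s\<in>UNIV. U (Edge s) * gen s) \<in> J" by (simp only: Q.proj_eq_iff diff_zero)
    then have "(\<Sum>s\<in>UNIV. U (Edge s) * gen s) \<in> relator_span" by (rule subsetD[OF J_subset_relator_span])
    then obtain T j c where T: "finite T" "\<And>s. j s \<in> J"
      "(\<Sum>s\<in>UNIV. U (Edge s) * gen s) = (\<Sum>l\<in>T. c l * relator l) + (\<Sum>s\<in>UNIV. j s * gen s)"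
      by (rule relator_spanE) (rule that)
    have Us: "U (Edge t) = (\<Sum>l\<in>T. c l * rquot t (relator l)) + j t" for t
    proof -
      have "U (Edge t) = rquot t (\<Sum>s\<in>UNIV. U (Edge s) * gen s)"
        using rquot_relator_comb[of t "\<lambda>_. 0" "{}" "\<lambda>s. U (Edge s)"] by simp
      also have "\<dots> = (\<Sum>l\<in>T. c l * rquot t (relator l)) + j t"
        unfolding T(3) by (rule rquot_relator_comb)
      finally show ?thesis .
    qed
    define V where "V = (\<lambda>w. case w of Face l \<Rightarrow> if l \<in> T then c l else 0 | _ \<Rightarrow> 0)"
    have V0: "V w = 0" if "w \<notin> Face ` T" for w using that by (cases w) (auto simp: V_def)
    have "finite {w. V w \<noteq> 0}"
      by (rule finite_subset[of _ "Face ` T"]) (use V0 T(1) in auto)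
    then have v: "(\<lambda>w. Q.proj (V w)) \<in> carrier (chains 2)"
      by (rule Q.proj_family_closed) (use V0 in auto)
    have "u t = boundary 1 (\<lambda>w. Q.proj (V w)) t" for t
    proof (subst boundary_1[OF T(1) V0])
      have "(\<Sum>l\<in>T. V (Face l) * rquot s (relator l)) = (\<Sum>l\<in>T. c l * rquot s (relator l))" for s
        by (intro sum.cong) (simp_all add: V_def)
      moreover have "U Vertex = 0" "U (Face l) = 0" for l by (rule U(2), auto)+
      ultimately show "u t = Q.proj (case t of Edge s \<Rightarrow> \<Sum>l\<in>T. V (Face l) * rquot s (relator l) | _ \<Rightarrow> 0)"
        using T(2) by (cases t) (simp_all add: U(1) Us Q.proj_eq_iff)
    qed
    then show "u \<in> boundary 1 ` carrier (chains 2)" using v by (intro image_eqI[OF ext])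
  qed
qed

lemma append_AB_inj: "x @ La # replicate l Lb = x' @ La # replicate l' Lb \<longleftrightarrow> x = x' \<and> l = l'"
proof
  assume "x @ La # replicate l Lb = x' @ La # replicate l' Lb"
  then have "rev (x @ La # replicate l Lb) = rev (x' @ La # replicate l' Lb)" by (rule arg_cong)
  then have "replicate l Lb @ La # rev x = replicate l' Lb @ La # rev x'" by simp
  from replicate_append_eq[OF this] show "x = x' \<and> l = l'" by simp
qed simp

text \<open>
  Suppose that \<open>\<Sum>l. u\<^sub>l * cap (a b^l) \<in> J\<close>, as the coefficient at the
  edge \<open>c\<close> shows for a cycle, where the \<open>u\<^sub>l\<close> may be taken as combinations of
  normal words. Appending \<open>a b^l\<close> to normal words gives distinct normal words, which
  are linearly independent modulo \<open>J\<close>.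
\<close>

lemma boundary_1_inj:
  fixes u :: "cell \<Rightarrow> 'k::field presalg set"
  assumes u: "u \<in> carrier (chains 2)" and z: "boundary 1 u = \<zero>\<^bsub>chains 1\<^esub>"
  shows "u = \<zero>\<^bsub>chains 2\<^esub>"
proof -
  note J = two_sided_J
  obtain U0 L where U0: "u = (\<lambda>w. Q.proj (U0 w))" "finite L" "\<And>w. w \<notin> Face ` L \<Longrightarrow> U0 w = 0"
    using u by (rule chains_2_lift) (rule that)
  have "\<forall>l. \<exists>n. (\<forall>w\<in>Poly_Mapping.keys n. normal w) \<and> eqmod J (U0 (Face l)) (cap_comb n)"
    by (intro allI exists_normal_comb)
  from choice[OF this] obtain N where N: "\<forall>l. (\<forall>w\<in>Poly_Mapping.keys (N l). normal w) \<and> eqmod J (U0 (Face l)) (cap_comb (N l))"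
    by (elim exE)
  have "boundary 1 u (Edge Lc) = Q.proj (\<Sum>l\<in>L. U0 (Face l) * cap (La # replicate l Lb))"
    unfolding U0(1) by (subst boundary_1[OF U0(2,3)]) (simp_all add: rquot_relator_Lc del: cap_simps)
  then have "Q.proj (\<Sum>l\<in>L. U0 (Face l) * cap (La # replicate l Lb)) = Q.proj 0"
    unfolding z free_lmodule_simps(2) Q.A_simps by (rule sym)
  then have "(\<Sum>l\<in>L. U0 (Face l) * cap (La # replicate l Lb)) \<in> J"
    by (simp only: Q.proj_eq_iff diff_zero)
  moreover have "(\<Sum>l\<in>L. U0 (Face l) * cap (La # replicate l Lb)) - (\<Sum>l\<in>L. cap_comb (N l) * cap (La # replicate l Lb)) \<in> J"
    unfolding sum_subtractf[symmetric] left_diff_distrib[symmetric]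
    by (intro two_sided_sum[OF J] two_sidedD(4)[OF J]) (use N in \<open>simp add: eqmod_def\<close>)
  ultimately have "(\<Sum>l\<in>L. U0 (Face l) * cap (La # replicate l Lb)) -
    ((\<Sum>l\<in>L. U0 (Face l) * cap (La # replicate l Lb)) - (\<Sum>l\<in>L. cap_comb (N l) * cap (La # replicate l Lb))) \<in> J"
    by (rule two_sidedD(6)[OF J])
  then have s: "(\<Sum>l\<in>L. cap_comb (N l) * cap (La # replicate l Lb)) \<in> J" by simp
  \<comment> \<open>The combination of normal words obtained by appending \<open>a b^l\<close> to the
    words of \<open>N l\<close>; its value is the sum above.\<close>
  define M where "M = (\<Sum>l\<in>L. \<Sum>x\<in>Poly_Mapping.keys (N l).
    Poly_Mapping.single (x @ La # replicate l Lb) (Poly_Mapping.lookup (N l) x))"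
  have "cap_comb M = (\<Sum>l\<in>L. cap_comb (N l) * cap (La # replicate l Lb))"
    unfolding M_def cap_comb_def linext_sum linext_single
    by (simp add: linext_def sum_distrib_right mult.assoc)
  with s have "to_group (cap_comb M) = 0" by (simp add: J_iff)
  moreover have "\<forall>w\<in>Poly_Mapping.keys M. normal w"
  proof
    fix w assume "w \<in> Poly_Mapping.keys M"
    then have "w \<in> (\<Union>l\<in>L. Poly_Mapping.keys (\<Sum>x\<in>Poly_Mapping.keys (N l).
        Poly_Mapping.single (x @ La # replicate l Lb) (Poly_Mapping.lookup (N l) x)))"
      unfolding M_def by (rule subsetD[OF keys_sum])
    then obtain l where "w \<in> Poly_Mapping.keys (\<Sum>x\<in>Poly_Mapping.keys (N l).
        Poly_Mapping.single (x @ La # replicate l Lb) (Poly_Mapping.lookup (N l) x))" by (elim UN_E)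
    from subsetD[OF keys_sum this] obtain x where x: "x \<in> Poly_Mapping.keys (N l)"
      "w \<in> Poly_Mapping.keys (Poly_Mapping.single (x @ La # replicate l Lb) (Poly_Mapping.lookup (N l) x))"
      by (elim UN_E)
    then have "w = x @ La # replicate l Lb" by (simp split: if_splits)
    then show "normal w" using N x(1) normal_append_AB by simp
  qed
  ultimately have M: "M = 0" using to_group_cap_comb_eq_0 by (rule_tac to_group_cap_comb_eq_0)
  have "Poly_Mapping.lookup (N l) x = 0" if l: "l \<in> L" for l x
  proof -
    have "0 = Poly_Mapping.lookup M (x @ La # replicate l Lb)" by (simp add: M)
    also have "\<dots> = (\<Sum>l'\<in>L. \<Sum>x'\<in>Poly_Mapping.keys (N l'). if x' = x \<and> l' = l then Poly_Mapping.lookup (N l') x' else 0)"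
      unfolding M_def lookup_sum lookup_single when_def append_AB_inj ..
    also have "\<dots> = (\<Sum>l'\<in>L. if l' = l then Poly_Mapping.lookup (N l) x else 0)"
    proof (rule sum.cong[OF refl])
      fix l'
      have "(\<Sum>x'\<in>Poly_Mapping.keys (N l). if x' = x then Poly_Mapping.lookup (N l) x' else 0) = Poly_Mapping.lookup (N l) x"
        by (simp add: sum.delta in_keys_iff)
      then show "(\<Sum>x'\<in>Poly_Mapping.keys (N l'). if x' = x \<and> l' = l then Poly_Mapping.lookup (N l') x' else 0) =
          (if l' = l then Poly_Mapping.lookup (N l) x else 0)"
        by (cases "l' = l") (simp_all add: in_keys_iff)
    qed
    also have "\<dots> = Poly_Mapping.lookup (N l) x" using U0(2) l by (simp add: sum.delta)
    finally show ?thesis by simp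
  qed
  then have N0: "N l = 0" if "l \<in> L" for l using that by (intro poly_mapping_eqI) simp
  have "Q.proj (U0 w) = Q.proj 0" for w
  proof (cases "w \<in> Face ` L")
    case True
    then obtain l where l: "l \<in> L" "w = Face l" by (elim imageE)
    have "eqmod J (U0 (Face l)) (cap_comb (N l))" using N by simp
    then show ?thesis by (simp add: N0[OF l(1)] l(2) cap_comb_def eqmod_def Q.proj_eq_iff)
  next
    case False
    then show ?thesis by (simp add: U0(3))
  qed
  then show ?thesis by (simp add: U0(1) free_lmodule_simps(2) Q.A_simps)
qed

lemma chain_aug_hom: "chain_aug \<in> lmod_hom Q.A (chains 0) (aug_module Q.eps)"
proof -
  interpret A: augmented_algebra Q.A Q.eps by (rule Q.augmented_A)
  show ?thesis
    by (rule lmod_homI) (simp_all add: chain_aug_def free_lmodule_simps A.eps_hom)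
qed

lemma chains_eq_zero: "carrier (chains (Suc (Suc (Suc n)))) = {\<zero>\<^bsub>chains (Suc (Suc (Suc n)))\<^esub>}"
proof -
  interpret E: left_module Q.A "chains (Suc (Suc (Suc n)))" by (rule left_module_chains)
  have "u = \<zero>\<^bsub>chains (Suc (Suc (Suc n)))\<^esub>" if "u \<in> carrier (chains (Suc (Suc (Suc n))))" for u
    using that by (simp add: free_lmodule_simps(1,2) fun_eq_iff)
  then show ?thesis using E.M.zero_closed by (intro Set.equalityI subsetI) simp_all
qed

lemma boundary_zero: "boundary m \<zero>\<^bsub>chains (Suc m)\<^esub> = \<zero>\<^bsub>chains m\<^esub>"
  by (rule lmod_hom_zero[OF left_module_chains left_module_chains boundary_hom])

lemma exact_faces:
  "a_kernel (chains (Suc (Suc m))) (chains (Suc m)) (boundary (Suc m)) =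
    boundary (Suc (Suc m)) ` carrier (chains (Suc (Suc (Suc m))))"
proof -
  let ?E = "chains (Suc (Suc m))"
  interpret E: left_module Q.A ?E by (rule left_module_chains)
  have inj: "u = \<zero>\<^bsub>?E\<^esub>"
    if u: "u \<in> carrier ?E" "boundary (Suc m) u = \<zero>\<^bsub>chains (Suc m)\<^esub>" for u
  proof (cases m)
    case 0
    show ?thesis using u unfolding 0 by (rule boundary_1_inj[unfolded numeral_2_eq_2 One_nat_def])
  next
    case m: (Suc k)
    show ?thesis using u(1) unfolding m chains_eq_zero by (rule singletonD)
  qed
  have "a_kernel ?E (chains (Suc m)) (boundary (Suc m)) = {\<zero>\<^bsub>?E\<^esub>}"
  proof (intro Set.equalityI subsetI)
    fix u assume "u \<in> a_kernel ?E (chains (Suc m)) (boundary (Suc m))"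
    then have "u \<in> carrier ?E \<and> boundary (Suc m) u = \<zero>\<^bsub>chains (Suc m)\<^esub>" unfolding a_kernel_iff .
    then have "u = \<zero>\<^bsub>?E\<^esub>" by (elim conjE) (rule inj)
    then show "u \<in> {\<zero>\<^bsub>?E\<^esub>}" unfolding singleton_iff .
  next
    fix u assume "u \<in> {\<zero>\<^bsub>?E\<^esub>}"
    then have u: "u = \<zero>\<^bsub>?E\<^esub>" by (rule singletonD)
    show "u \<in> a_kernel ?E (chains (Suc m)) (boundary (Suc m))"
      unfolding u a_kernel_iff by (intro conjI E.M.zero_closed boundary_zero)
  qed
  also have "\<dots> = boundary (Suc (Suc m)) ` carrier (chains (Suc (Suc (Suc m))))"
    unfolding chains_eq_zero image_insert image_empty boundary_zero ..
  finally show ?thesis .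
qed

lemma exact_chains:
  "a_kernel (chains (Suc n)) (chains n) (boundary n) = boundary (Suc n) ` carrier (chains (Suc (Suc n)))"
proof (cases n)
  case 0
  show ?thesis unfolding 0 by (rule exact_edges[unfolded numeral_2_eq_2 One_nat_def])
next
  case n: (Suc m)
  show ?thesis unfolding n by (rule exact_faces)
qed

lemma chain_aug_image: "chain_aug ` carrier (chains 0) = (UNIV :: 'k::field set)"
proof (intro Set.equalityI subset_UNIV subsetI)
  fix c :: 'k
  show "c \<in> chain_aug ` carrier (chains 0)"
  proof (rule image_eqI)
    show "(\<lambda>w. Q.proj (if w = Vertex then scal c else 0)) \<in> carrier (chains 0)"
      by (rule Q.proj_family_closed) simp_all
    show "c = chain_aug (\<lambda>w. Q.proj (if w = Vertex then scal c else 0))"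
      by (simp add: chain_aug_def Q.quot_aug_proj)
  qed
qed

theorem chains_resolution:
  "projective_resolution (Q.A :: ('k::field, 'k presalg set) module) (aug_module Q.eps) chains boundary chain_aug"
proof (intro projective_resolution.intro projective_resolution_axioms.intro)
  show "left_module (Q.A :: ('k, 'k presalg set) module) (aug_module Q.eps)"
    by (rule left_module_aug_module[OF Q.augmented_A])
  show "projective (Q.A :: ('k, 'k presalg set) module) (chains n)" for n
    by (rule projective_free_lmodule[OF Q.ring_A])
  show "boundary n \<in> lmod_hom (Q.A :: ('k, 'k presalg set) module) (chains (Suc n)) (chains n)" for n
    by (rule boundary_hom)
  show "chain_aug \<in> lmod_hom (Q.A :: ('k, 'k presalg set) module) (chains 0) (aug_module Q.eps)"
    by (rule chain_aug_hom)
  show "chain_aug ` carrier (chains 0) = carrier (aug_module (Q.eps :: _ \<Rightarrow> 'k))"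
    unfolding chain_aug_image by (simp add: aug_module_def)
  show "a_kernel (chains 0) (aug_module Q.eps) chain_aug = boundary 0 ` carrier (chains 1 :: ('k presalg set, _) module)"
    by (rule exact_vertex)
  show "a_kernel (chains (Suc n)) (chains n) (boundary n) =
      boundary (Suc n) ` carrier (chains (Suc (Suc n)) :: ('k presalg set, _) module)" for n
    by (rule exact_chains)
qed


section \<open>The second homology\<close>

lemma reduce_proj: "reduce Q.eps (\<lambda>w. Q.proj (U w)) = (\<lambda>w. free_aug (U w))"
  by (simp add: reduce_def Q.quot_aug_proj)

lemma chain_reduction_lift:
  fixes v :: "cell \<Rightarrow> 'k::field"
  assumes "v \<in> carrier (free_lmodule ground (cells n))"
  shows "(\<lambda>w. Q.proj (scal (v w))) \<in> carrier (chains n)" "reduce Q.eps (\<lambda>w. Q.proj (scal (v w))) = v"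
proof -
  have v: "finite {w. v w \<noteq> 0}" "w \<notin> cells n \<Longrightarrow> v w = 0" for w
    using assms by (simp_all add: free_lmodule_simps(1))
  have "{w. scal (v w) \<noteq> 0} \<subseteq> {w. v w \<noteq> 0}" by auto
  then have "finite {w. scal (v w) \<noteq> 0}" using v(1) by (rule finite_subset)
  then show "(\<lambda>w. Q.proj (scal (v w))) \<in> carrier (chains n)"
    by (rule Q.proj_family_closed) (simp add: v(2))
  show "reduce Q.eps (\<lambda>w. Q.proj (scal (v w))) = v" by (simp add: reduce_proj)
qed

text \<open>
  The boundary of the face with index \<open>l\<close> reduces to \<open>(1, l, 1, -1, -l, -1)\<close>.
\<close>

lemma reduce_boundary_eq_zero_iff:
  fixes U :: "cell \<Rightarrow> 'k::field presalg"
  assumes "finite L" "\<And>w. w \<notin> Face ` L \<Longrightarrow> U w = 0"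
  shows "reduce Q.eps (boundary 1 (\<lambda>w. Q.proj (U w))) = (\<lambda>_. 0) \<longleftrightarrow>
    (\<Sum>l\<in>L. free_aug (U (Face l))) = 0 \<and> (\<Sum>l\<in>L. free_aug (U (Face l)) * of_nat l) = 0"
    (is "?z \<longleftrightarrow> ?s = 0 \<and> ?t = 0")
proof -
  define r :: "cell \<Rightarrow> 'k" where "r = reduce Q.eps (boundary 1 (\<lambda>w. Q.proj (U w)))"
  have r: "r t = free_aug (case t of Edge s \<Rightarrow> \<Sum>l\<in>L. U (Face l) * rquot s (relator l) | _ \<Rightarrow> 0)" for t
    unfolding r_def by (subst boundary_1[OF assms]) (simp_all add: reduce_proj)
  have e: "r (Edge s) = (\<Sum>l\<in>L. free_aug (U (Face l)) * free_aug (rquot s (relator l)))" for s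
    by (simp add: r free_aug_sum)
  have "r (Edge La) = ?s" "r (Edge Lb) = ?t" "r (Edge Lc) = ?s" "r (Edge Ld) = - ?s" "r (Edge Lx) = - ?t" "r (Edge Ly) = - ?s"
    by (simp_all add: e free_aug_rquot_relator sum_negf)
  moreover have "r Vertex = 0" "r (Face l) = 0" for l by (simp_all add: r)
  moreover have "r = (\<lambda>_. 0) \<longleftrightarrow> (\<forall>s. r (Edge s) = 0)"
  proof
    assume "\<forall>s. r (Edge s) = 0"
    then show "r = (\<lambda>_. 0)" using calculation(7,8) by (intro ext) (rename_tac t, case_tac t, simp_all)
  qed simp
  ultimately show ?thesis unfolding r_def[symmetric] by (metis (no_types) letter.exhaust neg_equal_0_iff_equal)
qed

text \<open>
  The coordinates on the reduced cycles: the values at the first two faces are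
  determined by the others.
\<close>

definition shift_faces :: "(cell \<Rightarrow> 'k::field) \<Rightarrow> nat \<Rightarrow> 'k"
  where "shift_faces v n = v (Face (n + 2))"

definition face_cycles :: "(cell \<Rightarrow> 'k::field) set"
  where "face_cycles = {v. \<exists>L. finite L \<and> (\<forall>w. w \<notin> Face ` L \<longrightarrow> v w = 0) \<and>
    (\<Sum>l\<in>L. v (Face l)) = 0 \<and> (\<Sum>l\<in>L. v (Face l) * of_nat l) = 0}"

lemma shift_faces_hom: "shift_faces \<in> lmod_hom ground (free_lmodule ground (cells 2)) (free_lmodule ground UNIV)"
proof (rule lmod_homI)
  fix v :: "cell \<Rightarrow> 'a" assume "v \<in> carrier (free_lmodule ground (cells 2))"
  then have "finite ((\<lambda>n. Face (n + 2)) -` {w. v w \<noteq> 0})"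
    by (intro finite_vimageI) (simp_all add: free_lmodule_simps(1) inj_on_def)
  then show "shift_faces v \<in> carrier (free_lmodule ground UNIV)"
    by (simp add: free_lmodule_simps(1) shift_faces_def vimage_def)
qed (simp_all add: free_lmodule_simps shift_faces_def fun_eq_iff)

lemma sum_first_two:
  fixes f :: "nat \<Rightarrow> 'k::field"
  assumes "finite L" "\<And>l. l \<notin> L \<Longrightarrow> f l = 0"
  shows "sum f L = f 0 + f 1 + (\<Sum>n | n + 2 \<in> L. f (n + 2))"
proof -
  have fin: "finite {n. n + 2 \<in> L}"
    using finite_vimageI[OF assms(1), of "\<lambda>n. n + 2"] by (simp add: vimage_def inj_on_def)
  have "sum f L = sum f ({0, 1} \<union> (\<lambda>n. n + 2) ` {n. n + 2 \<in> L})"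
  proof (rule sum.mono_neutral_left)
    show "L \<subseteq> {0, 1} \<union> (\<lambda>n. n + 2) ` {n. n + 2 \<in> L}"
    proof
      fix l assume "l \<in> L"
      then show "l \<in> {0, 1} \<union> (\<lambda>n. n + 2) ` {n. n + 2 \<in> L}"
      proof (cases "l < 2")
        case False
        then have "l = (l - 2) + 2" by simp
        moreover from this have "l - 2 \<in> {n. n + 2 \<in> L}" using \<open>l \<in> L\<close> by simp
        ultimately show ?thesis by (intro UnI2 image_eqI)
      qed auto
    qed
  qed (use fin assms(2) in auto)
  also have "\<dots> = sum f {0, 1} + sum f ((\<lambda>n. n + 2) ` {n. n + 2 \<in> L})"
    using fin by (intro sum.union_disjoint) auto
  also have "sum f ((\<lambda>n. n + 2) ` {n. n + 2 \<in> L}) = (\<Sum>n | n + 2 \<in> L. f (n + 2))"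
    by (subst sum.reindex) (simp_all add: inj_on_def)
  finally show ?thesis by simp
qed

text \<open>
  The two equations can be solved for \<open>v 0\<close> and \<open>v 1\<close> over any field, since their
  coefficient matrix at these places, with rows \<open>(1, 1)\<close> and \<open>(0, 1)\<close>, is invertible.
\<close>

lemma shift_faces_bij: "bij_betw shift_faces face_cycles (carrier (free_lmodule ground (UNIV :: nat set)) :: (nat \<Rightarrow> 'k::field) set)"
proof (rule bij_betw_imageI)
  have first: "v (Face 1) = - (\<Sum>n\<in>{n. n + 2 \<in> L}. v (Face (n + 2)) * of_nat (n + 2))"
    "v (Face 0) = - v (Face 1) - (\<Sum>n\<in>{n. n + 2 \<in> L}. v (Face (n + 2)))"
    if "finite L" "\<forall>w. w \<notin> Face ` L \<longrightarrow> v w = 0" "(\<Sum>l\<in>L. v (Face l)) = 0" "(\<Sum>l\<in>L. v (Face l) * of_nat l) = 0"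
    for v :: "cell \<Rightarrow> 'k" and L
  proof -
    have v0: "v (Face l) = 0" if "l \<notin> L" for l using that \<open>\<forall>w. w \<notin> Face ` L \<longrightarrow> v w = 0\<close> by auto
    have "0 = v (Face 0) * of_nat 0 + v (Face 1) * of_nat 1 + (\<Sum>n | n + 2 \<in> L. v (Face (n + 2)) * of_nat (n + 2))"
      unfolding that(4)[symmetric] by (rule sum_first_two[OF that(1)]) (simp add: v0)
    then show "v (Face 1) = - (\<Sum>n\<in>{n. n + 2 \<in> L}. v (Face (n + 2)) * of_nat (n + 2))"
      by (simp add: eq_neg_iff_add_eq_0 del: of_nat_add)
    have "0 = v (Face 0) + v (Face 1) + (\<Sum>n | n + 2 \<in> L. v (Face (n + 2)))"
      unfolding that(3)[symmetric] by (rule sum_first_two[OF that(1)]) (simp add: v0)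
    then show "v (Face 0) = - v (Face 1) - (\<Sum>n\<in>{n. n + 2 \<in> L}. v (Face (n + 2)))"
      by (simp add: algebra_simps eq_neg_iff_add_eq_0)
  qed
  show "inj_on shift_faces (face_cycles :: (cell \<Rightarrow> 'k) set)"
  proof (rule inj_onI)
    fix v v' :: "cell \<Rightarrow> 'k"
    assume "v \<in> face_cycles" "v' \<in> face_cycles" and eq: "shift_faces v = shift_faces v'"
    then obtain L L' where
      L: "finite L" "\<forall>w. w \<notin> Face ` L \<longrightarrow> v w = 0" "(\<Sum>l\<in>L. v (Face l)) = 0" "(\<Sum>l\<in>L. v (Face l) * of_nat l) = 0"
      and L': "finite L'" "\<forall>w. w \<notin> Face ` L' \<longrightarrow> v' w = 0" "(\<Sum>l\<in>L'. v' (Face l)) = 0" "(\<Sum>l\<in>L'. v' (Face l) * of_nat l) = 0"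
      unfolding face_cycles_def by auto
    have shift: "v (Face (n + 2)) = v' (Face (n + 2))" for n using fun_cong[OF eq, of n] by (simp add: shift_faces_def)
    define M where "M = L \<union> L'"
    have M: "finite M" "\<forall>w. w \<notin> Face ` M \<longrightarrow> v w = 0" "\<forall>w. w \<notin> Face ` M \<longrightarrow> v' w = 0"
      using L L' by (auto simp: M_def)
    have sums: "(\<Sum>l\<in>M. v (Face l) * f l) = (\<Sum>l\<in>L. v (Face l) * f l)" "(\<Sum>l\<in>M. v' (Face l) * f l) = (\<Sum>l\<in>L'. v' (Face l) * f l)" for f
      by (rule sum.mono_neutral_right; use M(1) L(2) L'(2) in \<open>auto simp: M_def\<close>)+
    have z: "(\<Sum>l\<in>M. v (Face l)) = 0" "(\<Sum>l\<in>M. v (Face l) * of_nat l) = 0"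
      "(\<Sum>l\<in>M. v' (Face l)) = 0" "(\<Sum>l\<in>M. v' (Face l) * of_nat l) = 0"
      using sums(1)[of "\<lambda>_. 1"] sums(2)[of "\<lambda>_. 1"] sums(1)[of of_nat] sums(2)[of of_nat] L(3,4) L'(3,4) by simp_all
    note f = first[OF M(1,2) z(1,2)] and f' = first[OF M(1,3) z(3,4)]
    have v1: "v (Face 1) = v' (Face 1)" unfolding f(1) f'(1) shift ..
    have v0: "v (Face 0) = v' (Face 0)" unfolding f(2) f'(2) shift v1 ..
    show "v = v'"
    proof
      fix w
      show "v w = v' w"
      proof (cases w)
        case (Face l)
        then consider "l = 0" | "l = 1" | "l = (l - 2) + 2" by linarith
        then show ?thesis using v0 v1 shift[of "l - 2"] unfolding Face by cases simp_all
      next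
        case Vertex
        show ?thesis using M(2,3) unfolding Vertex by (metis cell.distinct image_iff)
      next
        case (Edge s)
        show ?thesis using M(2,3) unfolding Edge by (metis cell.distinct image_iff)
      qed
    qed
  qed
  show "shift_faces ` face_cycles = (carrier (free_lmodule ground UNIV) :: (nat \<Rightarrow> 'k) set)"
  proof (intro Set.equalityI subsetI)
    fix g :: "nat \<Rightarrow> 'k" assume "g \<in> shift_faces ` face_cycles"
    then obtain v L where v: "g = shift_faces v" "finite L" "\<forall>w. w \<notin> Face ` L \<longrightarrow> v w = 0"
      unfolding face_cycles_def by auto
    have "{w. v w \<noteq> 0} \<subseteq> Face ` L" using v(3) by auto
    then have "finite {w. v w \<noteq> 0}" by (rule finite_subset) (simp add: v(2))
    moreover have "v w = 0" if "w \<notin> range Face" for w using v(3) that by auto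
    ultimately have "v \<in> carrier (free_lmodule ground (cells 2))" by (simp add: free_lmodule_simps(1))
    then show "g \<in> carrier (free_lmodule ground UNIV)" unfolding v(1) by (rule lmod_homD(1)[OF shift_faces_hom])
  next
    fix g :: "nat \<Rightarrow> 'k" assume "g \<in> carrier (free_lmodule ground UNIV)"
    then have fin: "finite {n. g n \<noteq> 0}" by (simp add: free_lmodule_simps(1))
    define N where "N = {n. g n \<noteq> 0}"
    \<comment> \<open>The values that the two equations force at the faces with index \<open>0\<close>
      and \<open>1\<close>.\<close>
    define c where "c = - (\<Sum>n\<in>N. g n * of_nat (n + 2))"
    define v where "v = (\<lambda>w. case w of Face l \<Rightarrow>
      if l = 0 then - c - (\<Sum>n\<in>N. g n) else if l = 1 then c else g (l - 2) | _ \<Rightarrow> 0)"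
    define L where "L = {0, 1} \<union> (\<lambda>n. n + 2) ` N"
    have L: "finite L" using fin by (simp add: L_def N_def)
    have v0: "v w = 0" if "w \<notin> Face ` L" for w
    proof (cases w)
      case (Face l)
      then have l: "l \<notin> L" using that by auto
      then have "l \<noteq> 0" "l \<noteq> 1" by (auto simp: L_def)
      moreover from this have "l = (l - 2) + 2" by simp
      with l have "l - 2 \<notin> N" unfolding L_def by (metis UnI2 image_eqI)
      ultimately show ?thesis by (simp add: v_def Face N_def)
    qed (simp_all add: v_def)
    have N: "{n. Suc (Suc n) \<in> L} = N" by (auto simp: L_def)
    have v0': "v (Face l) = 0" if "l \<notin> L" for l using v0[of "Face l"] that by auto
    have "(\<Sum>l\<in>L. v (Face l)) = 0"
      by (subst sum_first_two[OF L v0']) (simp_all add: N v_def)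
    moreover have "(\<Sum>l\<in>L. v (Face l) * of_nat l) = v (Face 0) * of_nat 0 + v (Face 1) * of_nat 1
        + (\<Sum>n | n + 2 \<in> L. v (Face (n + 2)) * of_nat (n + 2))"
      by (rule sum_first_two[OF L]) (simp add: v0')
    then have "(\<Sum>l\<in>L. v (Face l) * of_nat l) = 0"
      by (simp add: N v_def c_def del: of_nat_add)
    ultimately have "v \<in> face_cycles" unfolding face_cycles_def using L v0 by blast
    moreover have "g = shift_faces v" by (simp add: shift_faces_def v_def fun_eq_iff)
    ultimately show "g \<in> shift_faces ` face_cycles" by simp
  qed
qed

lemma second_homology:
  assumes "projective_resolution (Q.A :: ('k::field, 'k presalg set) module) (aug_module Q.eps) P d \<eta>"
  shows "lmod_isomorphic ground (tor_by (Q.A :: ('k, 'k presalg set) module) (aug_module Q.eps) P d 2)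
    (free_lmodule ground (UNIV :: nat set))"
proof -
  interpret R: resolution_pair "Q.A :: ('k, 'k presalg set) module" Q.eps P d \<eta> cells boundary chain_aug
    by (intro resolution_pair.intro resolution_pair_axioms.intro Q.augmented_A assms chains_resolution cells_simps(6))
  have "R.reduced_cycles = face_cycles"
  proof (intro Set.equalityI subsetI)
    fix v assume "v \<in> R.reduced_cycles"
    then obtain u where u: "v = reduce Q.eps u" "u \<in> carrier (chains 2)" "reduce Q.eps (boundary 1 u) = (\<lambda>_. 0)"
      unfolding R.reduced_cycles_def by (elim CollectE exE conjE)
    obtain U L where U: "u = (\<lambda>w. Q.proj (U w))" "finite L" "\<And>w. w \<notin> Face ` L \<Longrightarrow> U w = 0"
      using u(2) by (rule chains_2_lift) (rule that)
    have v: "v = (\<lambda>w. free_aug (U w))" unfolding u(1) U(1) by (rule reduce_proj)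
    have "(\<Sum>l\<in>L. v (Face l)) = 0 \<and> (\<Sum>l\<in>L. v (Face l) * of_nat l) = 0"
      unfolding v by (rule iffD1[OF reduce_boundary_eq_zero_iff[OF U(2,3)] u(3)[unfolded U(1)]])
    moreover have "\<forall>w. w \<notin> Face ` L \<longrightarrow> v w = 0" by (simp add: v U(3))
    ultimately show "v \<in> face_cycles" unfolding face_cycles_def using U(2) by (intro CollectI exI[of _ L] conjI) simp_all
  next
    fix v :: "cell \<Rightarrow> 'k" assume "v \<in> face_cycles"
    then obtain L where L: "finite L" "\<forall>w. w \<notin> Face ` L \<longrightarrow> v w = 0" "(\<Sum>l\<in>L. v (Face l)) = 0" "(\<Sum>l\<in>L. v (Face l) * of_nat l) = 0"
      unfolding face_cycles_def by (elim CollectE exE conjE)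
    have "{w. v w \<noteq> 0} \<subseteq> Face ` L" using L(2) by auto
    then have "finite {w. v w \<noteq> 0}" by (rule finite_subset) (simp add: L(1))
    moreover have "v w = 0" if "w \<notin> range Face" for w using L(2) that by auto
    ultimately have v: "v \<in> carrier (free_lmodule ground (cells 2))" by (simp add: free_lmodule_simps(1))
    have z: "scal (v w) = 0" if "w \<notin> Face ` L" for w using L(2) that by simp
    have "reduce Q.eps (boundary 1 (\<lambda>w. Q.proj (scal (v w)))) = (\<lambda>_. 0)"
      by (subst reduce_boundary_eq_zero_iff[OF L(1) z]) (simp_all add: L(3,4))
    with chain_reduction_lift[OF v] show "v \<in> R.reduced_cycles"
      unfolding R.reduced_cycles_def by (intro CollectI exI conjI) (erule sym)
  qed
  then have "bij_betw shift_faces R.reduced_cycles (carrier (free_lmodule ground (UNIV :: nat set)))"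
    using shift_faces_bij by simp
  with ring.left_module_free[OF ring_ground] shift_faces_hom show ?thesis by (rule R.tor_2_isomorphic)
qed

theorem theorem1:
  fixes P :: "('k::field, letter word \<Rightarrow>\<^sub>0 'k) module"
    and A :: "('k, (letter word \<Rightarrow>\<^sub>0 'k) set) module"
    and \<epsilon> :: "(letter word \<Rightarrow>\<^sub>0 'k) set \<Rightarrow> 'k"
  assumes "P = free_algebra UNIV"
    and "A = quot P (Idl\<^bsub>P\<^esub> (range relator))"
    and "\<epsilon> = quot_aug free_aug"
  shows "parafree_of_rank 4 A \<epsilon> \<and>
    (\<forall>(Q :: nat \<Rightarrow> ((letter word \<Rightarrow>\<^sub>0 'k) set, 'p) module) d \<eta>.
      projective_resolution A (aug_module \<epsilon>) Q d \<eta> \<longrightarrow>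
      lmod_isomorphic (ground :: ('k, 'k) module) (tor_by A (aug_module \<epsilon>) Q d 2)
        (free_lmodule ground (UNIV :: nat set))) \<and>
    finitely_generated A \<and>
    \<not> finitely_presented A"
proof -
  have A: "A = Q.A" using assms(1,2) by (simp add: genideal_eq_ideal_gen)
  show ?thesis unfolding A assms(3)
    by (intro conjI allI impI parafree_A second_homology Q.finitely_generated_A finite_UNIV_letter not_finitely_presented_A)
qed

end
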